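(* Let $w$ be a majorant satisfying $\int_0^1\frac{w^2(t)}{t}\,dt=\infty$. Then there exists an outer function $b_w:\mathbb{D}\to\mathbb{D}$ such that the corresponding de Branges–Rovnyak space satisfies $\mathcal{H}(b_w)\cap W^1_a(w)=\{0\}$. In particular, every non-trivial function $f\in\mathcal{H}(b_w)$ satisfies $$\sum_{n\ge1}|f_n|\,w(1/n)=+\infty,$$ where $(f_n)_n$ denotes the Taylor coefficients of $f$ centered at the origin.
   Context: $\mathbb{D}$ is the open unit disc, $dA$ area measure on $\mathbb{D}$. A majorant is a continuous non-decreasing function $w$ on $[0,1]$, positive on $(0,1]$, for which there is $0<\alpha<1$ such that $w(t)/t^\alpha$ increases up to $\infty$ as $t\to0+$ (constants are allowed). $W^1_a(w)$ is the Banach space of holomorphic $f$ in $\mathbb{D}$ with $\|f\|_{W^1_a(w)}=|f(0)|+\int_{\mathbb{D}}|f'(z)|\,w(1-|z|)\,dA(z)<\infty$. For an analytic $b:\mathbb{D}\to\mathbb{D}$, the de Branges–Rovnyak space $\mathcal{H}(b)$ is the Hilbert space of holomorphic functions in $\mathbb{D}$ with reproducing kernels $\kappa_b(z,\lambda)=\frac{1-\overline{b(\lambda)}b(z)}{1-\overline{\lambda}z}$, $z,\lambda\in\mathbb{D}$. *)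

theory Defs
  imports "HOL-Complex_Analysis.Complex_Analysis"
begin

abbreviation unit_disc :: "complex set" (\<open>\<D>\<close>)
  where "\<D> \<equiv> ball 0 1"

(* Functions on the disc are represented by total functions that vanish off the disc, so that
   equality of such functions is equality on the disc. *)
definition hol_disc :: "(complex \<Rightarrow> complex) set"
  where "hol_disc = {f. f holomorphic_on \<D> \<and> (\<forall>z. z \<notin> \<D> \<longrightarrow> f z = 0)}"

(* w(t)/t^alpha increases (weakly) to infinity as t decreases to 0; the value w(0) may be positive,
   so that positive constant functions are majorants. *)
definition majorant :: "(real \<Rightarrow> real) \<Rightarrow> bool"
  where "majorant w \<longleftrightarrow>
    continuous_on {0..1} w \<and> mono_on {0..1} w \<and> (\<forall>t\<in>{0<..1}. 0 < w t) \<and>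
    (\<exists>\<alpha>. 0 < \<alpha> \<and> \<alpha> < 1 \<and>
      antimono_on {0<..1} (\<lambda>t. w t / t powr \<alpha>) \<and>
      filterlim (\<lambda>t. w t / t powr \<alpha>) at_top (at_right 0))"

definition W1a_norm :: "(real \<Rightarrow> real) \<Rightarrow> (complex \<Rightarrow> complex) \<Rightarrow> ennreal"
  where "W1a_norm w f =
    ennreal (cmod (f 0)) + (\<integral>\<^sup>+z\<in>\<D>. ennreal (cmod (deriv f z) * w (1 - cmod z)) \<partial>lborel)"

definition W1a :: "(real \<Rightarrow> real) \<Rightarrow> (complex \<Rightarrow> complex) set"
  where "W1a w = {f \<in> hol_disc. W1a_norm w f < \<infinity>}"

(* A complex Hilbert space of holomorphic functions in the disc with carrier H and inner product
   ip (linear in the first argument) whose reproducing kernel is K. *)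
locale disc_rkhs =
  fixes K :: "complex \<Rightarrow> complex \<Rightarrow> complex"
    and H :: "(complex \<Rightarrow> complex) set"
    and ip :: "(complex \<Rightarrow> complex) \<Rightarrow> (complex \<Rightarrow> complex) \<Rightarrow> complex"
  assumes holomorphic: "H \<subseteq> hol_disc"
    and zero: "(\<lambda>z. 0) \<in> H"
    and add: "\<And>f g. f \<in> H \<Longrightarrow> g \<in> H \<Longrightarrow> (\<lambda>z. f z + g z) \<in> H"
    and scale: "\<And>c f. f \<in> H \<Longrightarrow> (\<lambda>z. c * f z) \<in> H"
    and ip_add: "\<And>f g h. f \<in> H \<Longrightarrow> g \<in> H \<Longrightarrow> h \<in> H \<Longrightarrow>
      ip (\<lambda>z. f z + g z) h = ip f h + ip g h"
    and ip_scale: "\<And>c f g. f \<in> H \<Longrightarrow> g \<in> H \<Longrightarrow> ip (\<lambda>z. c * f z) g = c * ip f g"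
    and ip_commute: "\<And>f g. f \<in> H \<Longrightarrow> g \<in> H \<Longrightarrow> ip g f = cnj (ip f g)"
    and ip_ge_zero: "\<And>f. f \<in> H \<Longrightarrow> 0 \<le> Re (ip f f)"
    and ip_eq_zero: "\<And>f. f \<in> H \<Longrightarrow> ip f f = 0 \<Longrightarrow> f = (\<lambda>z. 0)"
    and complete: "\<And>s :: nat \<Rightarrow> complex \<Rightarrow> complex.
      (\<And>n. s n \<in> H) \<Longrightarrow>
      (\<And>e. 0 < e \<Longrightarrow> \<exists>N. \<forall>m\<ge>N. \<forall>n\<ge>N.
        sqrt (Re (ip (\<lambda>z. s m z - s n z) (\<lambda>z. s m z - s n z))) < e) \<Longrightarrow>
      \<exists>f\<in>H. (\<lambda>n. sqrt (Re (ip (\<lambda>z. s n z - f z) (\<lambda>z. s n z - f z)))) \<longlonglongrightarrow> 0"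
    and kernel: "\<And>l. l \<in> \<D> \<Longrightarrow> (\<lambda>z. if z \<in> \<D> then K z l else 0) \<in> H"
    and reproducing: "\<And>f l. f \<in> H \<Longrightarrow> l \<in> \<D> \<Longrightarrow>
      f l = ip f (\<lambda>z. if z \<in> \<D> then K z l else 0)"

definition dBR_kernel :: "(complex \<Rightarrow> complex) \<Rightarrow> complex \<Rightarrow> complex \<Rightarrow> complex"
  where "dBR_kernel b z l = (1 - cnj (b l) * b z) / (1 - cnj l * z)"

(* A Hilbert space of functions is determined by its reproducing kernel, and dBR_kernel b is
   positive definite when b is an analytic self-map of the disc, so the description is proper. *)
definition dBR :: "(complex \<Rightarrow> complex) \<Rightarrow> (complex \<Rightarrow> complex) set"
  where "dBR b = (THE H. \<exists>ip. disc_rkhs (dBR_kernel b) H ip)"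

(* b is a unimodular multiple of the exponential of the Herglotz integral of log phi, where
   phi > 0 and log phi is integrable on the unit circle (parametrized by [0, 2 pi]). *)
definition outer_function :: "(complex \<Rightarrow> complex) \<Rightarrow> bool"
  where "outer_function b \<longleftrightarrow>
    (\<exists>(c :: complex) (\<phi> :: real \<Rightarrow> real).
      cmod c = 1 \<and> (\<forall>t. 0 < \<phi> t) \<and>
      set_integrable lborel {0..2 * pi} (\<lambda>t. ln (\<phi> t)) \<and>
      (\<forall>z\<in>\<D>. b z = c * exp (1 / (2 * of_real pi) *
        (CLBINT t:{0..2 * pi}. (cis t + z) / (cis t - z) * of_real (ln (\<phi> t))))))"

end

(* If f lies in H(b) and b p = Q, then |<f, Q>|^2 <= ||f||^2 (||p||^2 - ||Q||^2), with norms and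
   pairing taken in H^2: for a combination g of Szegoe kernels, f sees g through
   ||g||^2 - ||T g||^2, where T is the Toeplitz operator with symbol the conjugate of b; test T g
   against p and let g tend to Q.

   The divergence of the integral of w(t)^2/t makes the Riesz products prod (1 + eta w(q^-k) cos(q^k t))
   tend to 0 in measure however small eta is. Their Herglotz transforms H satisfy
   (1-|z|) |H'| <= C eta w(1-|z|) Re H, so that G = exp(B H/(1+sH) - B/(1+s)) yields polynomials G_n
   with G_n(0) = 1, with (1-|z|) |G_n'| <= eps_n w(1-|z|), and with |G_n| <= eps_n on the circle off a
   set of measure at most eps_n.

   Let E be the set, of positive measure, on which |G_n| <= eps_n for all n, and let b be the outer
   function with modulus exp(-1/2) on E and 1 off E. For Q = z^j G_n the norms of p = Q/b and Q
   differ by O(eps_n^2), so <f, z^j G_n> tends to 0 for f in H(b). For f in W^1_a(w) the pairing tends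
   to the j-th Taylor coefficient of f, by the area-integral duality between W^1_a(w) and the functions
   with derivative O(w(1-|z|)/(1-|z|)). Hence f = 0. *)

theory Submission
  imports Defs
begin


subsection \<open>Positive kernels and Gram--Schmidt orthogonalisation\<close>

text \<open>\<open>dBR b\<close> is a definite description, so its members are accessible only after
  existence and uniqueness of the space are proved; afterwards only the reproducing property is
  used. On most of the circle Re H is small, but H is unbounded, so exp (B (H - 1)) will not do. K =
  H / (1 + s H) caps the size at 1 / s, and K' = H' / (1 + s H)^2: the factor Re H in the bound for
  H' is absorbed by |1 + s H|^2, so the bound for G' does not see the size of the Riesz product. The
  price is a constant of size B exp (B / s) / s, paid by eta, which is chosen after B and s; as the
  sum of eta^2 w(q^-k)^2 diverges for every eta, the length of the product can be chosen last. The
  exponent \<alpha> < 1 of the majorant enters through q: the frequencies q^k must outgrow the decay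
  of w(q^-k), which is at most q^\<alpha> per step, with a spare factor 4. The modulus exp (-1/2)
  keeps 2 Re log (1/b) in [0, 1], where exp x <= 1 + 2 x. The norm of Q / b is then estimated by an
  expression linear in log b, which for polynomials Q is a finite sum; no boundary values of b are
  needed.\<close>

definition psd_on :: "'a set \<Rightarrow> ('a \<Rightarrow> 'a \<Rightarrow> complex) \<Rightarrow> bool" where
  "psd_on X K \<longleftrightarrow> (\<forall>z\<in>X. \<forall>l\<in>X. K z l = cnj (K l z)) \<and>
     (\<forall>S c. finite S \<longrightarrow> S \<subseteq> X \<longrightarrow> 0 \<le> Re (\<Sum>z\<in>S. \<Sum>l\<in>S. cnj (c z) * K z l * c l))"

lemma psd_on_herm: "psd_on X K \<Longrightarrow> z \<in> X \<Longrightarrow> l \<in> X \<Longrightarrow> K l z = cnj (K z l)"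
  unfolding psd_on_def by blast

lemma psd_on_form:
  "psd_on X K \<Longrightarrow> finite S \<Longrightarrow> S \<subseteq> X \<Longrightarrow> 0 \<le> Re (\<Sum>z\<in>S. \<Sum>l\<in>S. cnj (c z) * K z l * c l)"
  unfolding psd_on_def by blast

lemma psd_on_diag:
  assumes "psd_on X K" "z \<in> X"
  shows "0 \<le> Re (K z z)" "K z z = of_real (Re (K z z))"
proof -
  show "0 \<le> Re (K z z)"
    using psd_on_form[OF assms(1), of "{z}" "\<lambda>_. 1"] assms(2) by simp
  have "Im (K z z) = 0"
    using psd_on_herm[OF assms(1) assms(2) assms(2)] by (metis complex_cnj_cancel_iff cnj.simps(2) equal_neg_zero)
  then show "K z z = of_real (Re (K z z))"
    by (simp add: complex_eq_iff)
qed

text \<open>With \<open>K a a = 0\<close> the form on the two points \<open>z\<close>,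
  \<open>a\<close> with coefficients 1 and \<open>- t * K a z\<close> is affine in \<open>t\<close>
  with slope minus twice the squared modulus of \<open>K z a\<close>; an affine function bounded
  below is constant.\<close>

lemma psd_on_diag_zero:
  assumes psd: "psd_on X K" and "z \<in> X" "a \<in> X" "K a a = 0"
  shows "K z a = 0"
proof (cases "z = a")
  case True
  then show ?thesis using assms by simp
next
  case False
  define A where "A = (cmod (K z a))\<^sup>2"
  have az: "K a z = cnj (K z a)"
    using psd_on_herm[OF psd \<open>z \<in> X\<close> \<open>a \<in> X\<close>] .
  have ineq: "0 \<le> Re (K z z) - 2 * t * A" for t :: real
  proof -
    let ?c = "\<lambda>x. if x = a then - of_real t * K a z else 1"
    have "0 \<le> Re (\<Sum>x\<in>{z,a}. \<Sum>y\<in>{z,a}. cnj (?c x) * K x y * ?c y)"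
      by (rule psd_on_form[OF psd]) (use assms in auto)
    also have "(\<Sum>x\<in>{z,a}. \<Sum>y\<in>{z,a}. cnj (?c x) * K x y * ?c y)
        = K z z - of_real (2 * t) * (K z a * cnj (K z a))"
      using False assms(4) by (simp add: az algebra_simps)
    also have "K z a * cnj (K z a) = of_real A"
      unfolding A_def by (rule complex_norm_square[symmetric])
    finally show ?thesis by (simp add: algebra_simps)
  qed
  have "A = 0"
  proof (rule ccontr)
    assume "A \<noteq> 0"
    then have "A > 0" unfolding A_def by simp
    show False
      using ineq[of "(Re (K z z) + 1) / (2 * A)"] \<open>A > 0\<close> by simp
  qed
  then show ?thesis by (simp add: A_def)
qed

text \<open>Schur complement: the new form at \<open>c\<close> is the old form at \<open>c\<close>
  shifted by \<open>- t\<close> at the point \<open>a\<close>, where \<open>t\<close> is the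
  minimising shift. Since \<open>a\<close> may or may not belong to \<open>S\<close>,
  \<open>c\<close> is first extended by zero to \<open>insert a S\<close>.\<close>

lemma psd_on_schur:
  assumes psd: "psd_on X K" and a: "a \<in> X"
  shows "psd_on X (\<lambda>z l. K z l - K z a * K a l / K a a)"
  unfolding psd_on_def
proof (intro conjI allI impI ballI)
  fix z l assume "z \<in> X" "l \<in> X"
  then show "K z l - K z a * K a l / K a a = cnj (K l z - K l a * K a z / K a a)"
    using psd_on_herm[OF psd] a by (smt (verit) complex_cnj_diff complex_cnj_divide complex_cnj_mult mult.commute)
next
  fix S :: "'a set" and c :: "'a \<Rightarrow> complex"
  assume S: "finite S" "S \<subseteq> X"
  show "0 \<le> Re (\<Sum>z\<in>S. \<Sum>l\<in>S. cnj (c z) * (K z l - K z a * K a l / K a a) * c l)"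
  proof (cases "K a a = 0")
    case True
    \<comment> \<open>Division by zero gives 0, so a vanishing pivot leaves the kernel
      unchanged.\<close>
    then show ?thesis using psd_on_form[OF psd S] by simp
  next
    case False
    define T where "T = insert a S"
    define d where "d = (\<lambda>z. if z \<in> S then c z else 0)"
    define u where "u = (\<Sum>l\<in>S. K a l * c l)"
    define t where "t = u / K a a"
    have T: "finite T" "T \<subseteq> X" "S \<subseteq> T" "a \<in> T" using S a by (auto simp: T_def)
    have Kaa: "cnj (K a a) = K a a" using psd_on_herm[OF psd a a] by simp
    have sumS: "(\<Sum>z\<in>T. cnj (d z) * f z) = (\<Sum>z\<in>S. cnj (c z) * f z)"
               "(\<Sum>z\<in>T. f z * d z) = (\<Sum>z\<in>S. f z * c z)" for f
      by (rule sum.mono_neutral_cong_right; use T in \<open>auto simp: d_def\<close>)+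
    have delta: "(\<Sum>z\<in>T. f z * (if z = a then t else 0)) = f a * t"
        "(\<Sum>z\<in>T. (if z = a then cnj t else 0) * f z) = cnj t * f a" for f
      using T by (simp_all add: if_distrib if_distribR sum.delta cong: if_cong)
    have cu: "(\<Sum>z\<in>S. cnj (c z) * K z a) = cnj u"
      unfolding u_def cnj_sum complex_cnj_mult
      by (rule sum.cong) (use psd_on_herm[OF psd a] S in \<open>auto simp: mult.commute\<close>)
    have "0 \<le> Re (\<Sum>z\<in>T. \<Sum>l\<in>T. cnj (d z - (if z = a then t else 0)) * K z l * (d l - (if l = a then t else 0)))"
      by (rule psd_on_form[OF psd T(1,2)])
    also have "(\<Sum>z\<in>T. \<Sum>l\<in>T. cnj (d z - (if z = a then t else 0)) * K z l * (d l - (if l = a then t else 0)))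
      = (\<Sum>z\<in>T. (cnj (d z) - (if z = a then cnj t else 0)) * (\<Sum>l\<in>T. K z l * d l - K z l * (if l = a then t else 0)))"
      by (intro sum.cong refl) (simp add: sum_distrib_left algebra_simps if_distrib cong: if_cong)
    also have "\<dots> = (\<Sum>z\<in>T. (cnj (d z) - (if z = a then cnj t else 0)) * ((\<Sum>l\<in>S. K z l * c l) - K z a * t))"
      by (simp only: sum_subtractf sumS delta)
    also have "\<dots> = (\<Sum>z\<in>S. cnj (c z) * ((\<Sum>l\<in>S. K z l * c l) - K z a * t)) - cnj t * (u - K a a * t)"
      by (simp only: left_diff_distrib sum_subtractf sumS delta u_def)
    also have "u - K a a * t = 0"
      using False by (simp add: t_def)
    also have "(\<Sum>z\<in>S. cnj (c z) * ((\<Sum>l\<in>S. K z l * c l) - K z a * t)) - cnj t * 0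
      = (\<Sum>z\<in>S. \<Sum>l\<in>S. cnj (c z) * (K z l - K z a * K a l / K a a) * c l)"
    proof -
      have "K z a * t = (\<Sum>l\<in>S. K z a * K a l / K a a * c l)" for z
        unfolding t_def u_def by (simp add: sum_distrib_left sum_divide_distrib mult.assoc)
      then show ?thesis
        by (simp add: sum_subtractf[symmetric] sum_distrib_left algebra_simps)
    qed
    finally show ?thesis .
  qed
qed

text \<open>Kernel of the orthogonal complement of the kernel functions at \<open>p 0\<close>, ...,
  \<open>p (n - 1)\<close>, one Schur complement per point. A zero pivot contributes the quotient 0,
  so linearly dependent points are skipped silently.\<close>

primrec gs_kernel :: "('a \<Rightarrow> 'a \<Rightarrow> complex) \<Rightarrow> (nat \<Rightarrow> 'a) \<Rightarrow> nat \<Rightarrow> 'a \<Rightarrow> 'a \<Rightarrow> complex" where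
  "gs_kernel K p 0 = K"
| "gs_kernel K p (Suc n) = (\<lambda>z l. gs_kernel K p n z l -
     gs_kernel K p n z (p n) * gs_kernel K p n (p n) l / gs_kernel K p n (p n) (p n))"

text \<open>The Gram--Schmidt vector of step \<open>n\<close>; when the pivot vanishes, division by
  zero makes it identically zero.\<close>

definition gs_vec :: "('a \<Rightarrow> 'a \<Rightarrow> complex) \<Rightarrow> (nat \<Rightarrow> 'a) \<Rightarrow> nat \<Rightarrow> 'a \<Rightarrow> complex" where
  "gs_vec K p n z = gs_kernel K p n z (p n) / of_real (sqrt (Re (gs_kernel K p n (p n) (p n))))"

context
  fixes X :: "'a set" and K and p :: "nat \<Rightarrow> 'a"
  assumes psd: "psd_on X K" and p: "\<And>n. p n \<in> X"
begin

lemma gs_kernel_psd: "psd_on X (gs_kernel K p n)"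
  by (induction n) (simp_all add: psd psd_on_schur p)

lemma gs_vec_mult:
  assumes "z \<in> X" "l \<in> X"
  shows "gs_vec K p n z * cnj (gs_vec K p n l) =
    gs_kernel K p n z (p n) * gs_kernel K p n (p n) l / gs_kernel K p n (p n) (p n)"
proof -
  let ?s = "Re (gs_kernel K p n (p n) (p n))"
  have "of_real (sqrt ?s) * of_real (sqrt ?s) = gs_kernel K p n (p n) (p n)"
    using psd_on_diag[OF gs_kernel_psd p, of n n] by (metis of_real_mult real_sqrt_mult_self abs_of_nonneg)
  moreover have "gs_kernel K p n (p n) l = cnj (gs_kernel K p n l (p n))"
    using psd_on_herm[OF gs_kernel_psd assms(2) p] .
  ultimately show ?thesis
    unfolding gs_vec_def by simp
qed

lemma gs_kernel_eq:
  assumes "z \<in> X" "l \<in> X"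
  shows "K z l = gs_kernel K p n z l + (\<Sum>k<n. gs_vec K p k z * cnj (gs_vec K p k l))"
  by (induction n) (simp_all add: gs_vec_mult assms)

text \<open>A column once eliminated stays zero, because each later step subtracts a multiple of an
  entry of that column. When the pivot is zero, the new column vanishes by positivity.\<close>

lemma gs_kernel_vanish:
  assumes "j < n" "z \<in> X"
  shows "gs_kernel K p n z (p j) = 0"
  using assms
proof (induction n arbitrary: z)
  case (Suc n)
  show ?case
  proof (cases "j = n")
    case True
    show ?thesis
    proof (cases "gs_kernel K p n (p n) (p n) = 0")
      case True
      then show ?thesis
        using psd_on_diag_zero[OF gs_kernel_psd Suc.prems(2) p True] \<open>j = n\<close> by simp
    next
      case False
      then show ?thesis using \<open>j = n\<close> by simp
    qed
  next
    case False
    then have "j < n" using Suc.prems by simp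
    then show ?thesis using Suc.IH Suc.prems p by simp
  qed
qed simp

lemma gs_vec_vanish: "j < n \<Longrightarrow> gs_vec K p n (p j) = 0"
  using gs_kernel_vanish[of j n "p n"] psd_on_herm[OF gs_kernel_psd p p, of n n j] p
  unfolding gs_vec_def by simp

lemma gs_vec_self: "gs_vec K p n (p n) = of_real (sqrt (Re (gs_kernel K p n (p n) (p n))))"
  unfolding gs_vec_def using psd_on_diag[OF gs_kernel_psd p, of n n]
  by (metis of_real_divide real_div_sqrt)

lemma gs_vec_zero:
  assumes "gs_vec K p n (p n) = 0" shows "gs_vec K p n z = 0"
  using assms by (simp add: gs_vec_self) (simp add: gs_vec_def)

text \<open>The residual kernel vanishes at \<open>p j\<close> after step \<open>j\<close>, so at a
  point of the sequence the expansion is a finite sum and no convergence question arises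
  there.\<close>

lemma gs_kernel_point:
  assumes "z \<in> X"
  shows "K z (p j) = (\<Sum>k\<le>j. gs_vec K p k z * cnj (gs_vec K p k (p j)))"
  using gs_kernel_eq[OF assms p, of j "Suc j"] gs_kernel_vanish[OF lessI assms, of j]
  by (simp only: lessThan_Suc_atMost add_0)

text \<open>The residual kernel is still positive, hence has a nonnegative diagonal.\<close>

lemma gs_vec_bessel:
  assumes "z \<in> X"
  shows "(\<Sum>k<n. (cmod (gs_vec K p k z))\<^sup>2) \<le> Re (K z z)"
proof -
  have "Re (K z z) = Re (gs_kernel K p n z z) + (\<Sum>k<n. (cmod (gs_vec K p k z))\<^sup>2)"
    by (subst gs_kernel_eq[OF assms assms, of n]) (simp add: complex_norm_square[symmetric])
  then show ?thesis using psd_on_diag[OF gs_kernel_psd assms, of n] by simp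
qed

end


subsection \<open>Square summable sequences and reproducing kernel Hilbert spaces\<close>

definition square_summable :: "(nat \<Rightarrow> complex) \<Rightarrow> bool" where
  "square_summable c \<longleftrightarrow> summable (\<lambda>k. (cmod (c k))\<^sup>2)"

lemma square_summable_mult_summable:
  assumes "square_summable c" "square_summable d"
  shows "summable (\<lambda>k. cmod (c k * d k))"
proof (rule summable_comparison_test)
  show "summable (\<lambda>k. (cmod (c k))\<^sup>2 + (cmod (d k))\<^sup>2)"
    using assms unfolding square_summable_def by (rule summable_add)
  have "cmod (c n) * cmod (d n) \<le> (cmod (c n))\<^sup>2 + (cmod (d n))\<^sup>2" for n
  proof -
    have "0 \<le> cmod (c n) * cmod (d n)" by simp
    then show ?thesis using sum_squares_bound[of "cmod (c n)" "cmod (d n)"] by linarith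
  qed
  then show "\<exists>N. \<forall>n\<ge>N. norm (cmod (c n * d n)) \<le> (cmod (c n))\<^sup>2 + (cmod (d n))\<^sup>2"
    by (auto simp: norm_mult)
qed

lemma square_summable_cnj: "square_summable c \<Longrightarrow> square_summable (\<lambda>k. cnj (c k))"
  unfolding square_summable_def by simp

lemma square_summable_scale: "square_summable c \<Longrightarrow> square_summable (\<lambda>k. a * c k)"
  unfolding square_summable_def norm_mult power_mult_distrib by (rule summable_mult)

lemma square_summable_add:
  assumes "square_summable c" "square_summable d" shows "square_summable (\<lambda>k. c k + d k)"
  unfolding square_summable_def
proof (rule summable_comparison_test)
  show "summable (\<lambda>k. 2 * ((cmod (c k))\<^sup>2 + (cmod (d k))\<^sup>2))"
    using assms unfolding square_summable_def by (intro summable_mult summable_add)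
  have "(cmod (c n + d n))\<^sup>2 \<le> 2 * ((cmod (c n))\<^sup>2 + (cmod (d n))\<^sup>2)" for n
  proof -
    have "(cmod (c n + d n))\<^sup>2 \<le> (cmod (c n) + cmod (d n))\<^sup>2"
      by (intro power_mono norm_triangle_ineq) auto
    also have "\<dots> \<le> 2 * ((cmod (c n))\<^sup>2 + (cmod (d n))\<^sup>2)"
      using sum_squares_bound[of "cmod (c n)" "cmod (d n)"] by (simp add: power2_sum)
    finally show ?thesis .
  qed
  then show "\<exists>N. \<forall>n\<ge>N. norm ((cmod (c n + d n))\<^sup>2) \<le> 2 * ((cmod (c n))\<^sup>2 + (cmod (d n))\<^sup>2)"
    by auto
qed

lemma square_summable_diff: "square_summable c \<Longrightarrow> square_summable d \<Longrightarrow> square_summable (\<lambda>k. c k - d k)"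
  using square_summable_add[of c "\<lambda>k. (-1) * d k"] square_summable_scale[of d "-1"] by simp

lemma square_summable_bounded_sums:
  assumes "\<And>n. (\<Sum>k<n. (cmod (c k))\<^sup>2) \<le> M"
  shows "square_summable c" "(\<Sum>k. (cmod (c k))\<^sup>2) \<le> M"
proof -
  show "square_summable c" unfolding square_summable_def
    by (rule summableI_nonneg_bounded[where x=M]) (use assms in auto)
  then show "(\<Sum>k. (cmod (c k))\<^sup>2) \<le> M"
    unfolding square_summable_def by (rule suminf_le_const) (use assms in auto)
qed

lemma sum_cauchy_schwarz:
  fixes c d :: "'a \<Rightarrow> complex"
  shows "cmod (\<Sum>k\<in>A. c k * d k) \<le> sqrt (\<Sum>k\<in>A. (cmod (c k))\<^sup>2) * sqrt (\<Sum>k\<in>A. (cmod (d k))\<^sup>2)"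
proof -
  have "cmod (\<Sum>k\<in>A. c k * d k) \<le> (\<Sum>k\<in>A. \<bar>cmod (c k)\<bar> * \<bar>cmod (d k)\<bar>)"
    by (rule order_trans[OF norm_sum]) (simp add: norm_mult)
  also have "\<dots> \<le> L2_set (\<lambda>k. cmod (c k)) A * L2_set (\<lambda>k. cmod (d k)) A"
    by (rule L2_set_mult_ineq)
  finally show ?thesis by (simp add: L2_set_def)
qed

lemma square_summable_cauchy_schwarz:
  assumes "square_summable c" "square_summable d"
  shows "cmod (\<Sum>k. c k * d k) \<le> sqrt (\<Sum>k. (cmod (c k))\<^sup>2) * sqrt (\<Sum>k. (cmod (d k))\<^sup>2)"
proof (rule LIMSEQ_le_const2)
  have "summable (\<lambda>k. c k * d k)"
    using square_summable_mult_summable[OF assms] by (rule summable_norm_cancel)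
  then show "(\<lambda>n. cmod (\<Sum>k<n. c k * d k)) \<longlonglongrightarrow> cmod (\<Sum>k. c k * d k)"
    by (intro tendsto_norm summable_LIMSEQ)
  have "cmod (\<Sum>k<n. c k * d k) \<le> sqrt (\<Sum>k. (cmod (c k))\<^sup>2) * sqrt (\<Sum>k. (cmod (d k))\<^sup>2)" for n
    by (rule order_trans[OF sum_cauchy_schwarz])
       (use assms in \<open>auto intro!: mult_mono sum_le_suminf real_sqrt_le_mono suminf_nonneg sum_nonneg simp: square_summable_def\<close>)
  then show "\<exists>N. \<forall>n\<ge>N. cmod (\<Sum>k<n. c k * d k) \<le> sqrt (\<Sum>k. (cmod (c k))\<^sup>2) * sqrt (\<Sum>k. (cmod (d k))\<^sup>2)"
    by blast
qed

text \<open>Coordinatewise limits, followed by a Fatou argument on finite partial sums.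
  Coordinatewise convergence is part of the conclusion because the support condition
  \<open>valid\<close> has to pass to the limit.\<close>

lemma square_summable_complete:
  fixes c :: "nat \<Rightarrow> nat \<Rightarrow> complex"
  assumes square_summable: "\<And>n. square_summable (c n)"
    and cau: "\<And>e. 0 < e \<Longrightarrow> \<exists>N. \<forall>m\<ge>N. \<forall>n\<ge>N. sqrt (\<Sum>k. (cmod (c m k - c n k))\<^sup>2) < e"
  obtains d where "square_summable d" "\<And>k. (\<lambda>n. c n k) \<longlonglongrightarrow> d k"
    "(\<lambda>n. sqrt (\<Sum>k. (cmod (c n k - d k))\<^sup>2)) \<longlonglongrightarrow> 0"
proof -
  have comp: "cmod (c m k - c n k) \<le> sqrt (\<Sum>k. (cmod (c m k - c n k))\<^sup>2)" for m n k
  proof (rule real_le_rsqrt)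
    show "(cmod (c m k - c n k))\<^sup>2 \<le> (\<Sum>k. (cmod (c m k - c n k))\<^sup>2)"
    proof -
      have "(\<Sum>k\<in>{k}. (cmod (c m k - c n k))\<^sup>2) \<le> (\<Sum>k. (cmod (c m k - c n k))\<^sup>2)"
        by (rule sum_le_suminf) (use square_summable_diff[OF square_summable square_summable, of m n] in \<open>auto simp: square_summable_def\<close>)
      then show ?thesis by simp
    qed
  qed
  have "Cauchy (\<lambda>n. c n k)" for k
    unfolding Cauchy_def dist_norm
  proof (intro allI impI)
    fix e :: real assume "e > 0"
    then show "\<exists>M. \<forall>m\<ge>M. \<forall>n\<ge>M. cmod (c m k - c n k) < e"
      using cau[of e] comp[of _ k] by (meson order_le_less_trans)
  qed
  then have "\<exists>d. \<forall>k. (\<lambda>n. c n k) \<longlonglongrightarrow> d k"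
    by (intro choice allI) (simp add: Cauchy_convergent_iff convergent_def)
  then obtain d where d: "\<And>k. (\<lambda>n. c n k) \<longlonglongrightarrow> d k" by blast
  have fin: "\<exists>N. \<forall>n\<ge>N. \<forall>M. (\<Sum>k<M. (cmod (c n k - d k))\<^sup>2) \<le> e\<^sup>2" if epos: "e > 0" for e
  proof -
    obtain N where N: "\<And>m n. m \<ge> N \<Longrightarrow> n \<ge> N \<Longrightarrow> sqrt (\<Sum>k. (cmod (c m k - c n k))\<^sup>2) < e"
      using cau[OF epos] by blast
    have "(\<Sum>k<M. (cmod (c n k - d k))\<^sup>2) \<le> e\<^sup>2" if "n \<ge> N" for n M
    proof (rule LIMSEQ_le_const2)
      show "(\<lambda>m. \<Sum>k<M. (cmod (c n k - c m k))\<^sup>2) \<longlonglongrightarrow> (\<Sum>k<M. (cmod (c n k - d k))\<^sup>2)"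
        by (intro tendsto_intros d)
      have "(\<Sum>k<M. (cmod (c n k - c m k))\<^sup>2) \<le> e\<^sup>2" if "m \<ge> N" for m
      proof -
        have "(\<Sum>k<M. (cmod (c n k - c m k))\<^sup>2) \<le> (\<Sum>k. (cmod (c n k - c m k))\<^sup>2)"
          using square_summable_diff[OF square_summable square_summable, of n m] by (intro sum_le_suminf) (auto simp: square_summable_def)
        also have "\<dots> \<le> e\<^sup>2"
          using N[OF \<open>n \<ge> N\<close> that] epos by (simp add: sqrt_le_D less_imp_le)
        finally show ?thesis .
      qed
      then show "\<exists>N. \<forall>m\<ge>N. (\<Sum>k<M. (cmod (c n k - c m k))\<^sup>2) \<le> e\<^sup>2" by blast
    qed
    then show ?thesis by blast
  qed
  have diffl2: "\<exists>N. \<forall>n\<ge>N. square_summable (\<lambda>k. c n k - d k) \<and> sqrt (\<Sum>k. (cmod (c n k - d k))\<^sup>2) \<le> e" if "e > 0" for e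
  proof -
    obtain N where N: "\<And>n M. n \<ge> N \<Longrightarrow> (\<Sum>k<M. (cmod (c n k - d k))\<^sup>2) \<le> e\<^sup>2"
      using fin[OF \<open>e > 0\<close>] by blast
    have "square_summable (\<lambda>k. c n k - d k)" "sqrt (\<Sum>k. (cmod (c n k - d k))\<^sup>2) \<le> e" if "n \<ge> N" for n
      using square_summable_bounded_sums[of "\<lambda>k. c n k - d k", OF N[OF that]] \<open>e > 0\<close>
      by (auto intro: real_le_lsqrt)
    then show ?thesis by blast
  qed
  show ?thesis
  proof
    obtain n where "square_summable (\<lambda>k. c n k - d k)" using diffl2[of 1] by auto
    from square_summable_diff[OF square_summable[of n] this] show "square_summable d" by simp
    show "(\<lambda>n. c n k) \<longlonglongrightarrow> d k" for k by (rule d)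
    show "(\<lambda>n. sqrt (\<Sum>k. (cmod (c n k - d k))\<^sup>2)) \<longlonglongrightarrow> 0"
    proof (rule LIMSEQ_I)
      fix e :: real assume "e > 0"
      then obtain N where N: "\<And>n. n \<ge> N \<Longrightarrow> square_summable (\<lambda>k. c n k - d k) \<and> sqrt (\<Sum>k. (cmod (c n k - d k))\<^sup>2) \<le> e/2"
        using diffl2[of "e/2"] by auto
      have "norm (sqrt (\<Sum>k. (cmod (c n k - d k))\<^sup>2) - 0) < e" if "n \<ge> N" for n
      proof -
        have "0 \<le> (\<Sum>k. (cmod (c n k - d k))\<^sup>2)"
          using N[OF that] unfolding square_summable_def by (intro suminf_nonneg) auto
        then show ?thesis using N[OF that] \<open>e > 0\<close> by simp
      qed
      then show "\<exists>N. \<forall>n\<ge>N. norm (sqrt (\<Sum>k. (cmod (c n k - d k))\<^sup>2) - 0) < e" by blast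
    qed
  qed
qed

section \<open>Inner product algebra and Cauchy--Schwarz in a reproducing kernel space\<close>

context disc_rkhs
begin

abbreviation kfun :: "complex \<Rightarrow> complex \<Rightarrow> complex" where
  "kfun l \<equiv> (\<lambda>z. if z \<in> \<D> then K z l else 0)"

lemma ip_zero_left: assumes "g \<in> H" shows "ip (\<lambda>z. 0) g = 0"
proof -
  have "ip (\<lambda>z. 0 * 0) g = 0 * ip (\<lambda>z. 0) g" by (rule ip_scale[OF zero assms])
  then show ?thesis by (simp only: mult_zero_left)
qed

lemma diff_mem:
  assumes "f \<in> H" "g \<in> H" shows "(\<lambda>z. f z - g z) \<in> H"
proof -
  have "(\<lambda>z. f z + (-1) * g z) \<in> H" by (rule add[OF assms(1) scale[OF assms(2)]])
  then show ?thesis by (simp only: mult_minus1 add_uminus_conv_diff)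
qed

lemma ip_diff:
  assumes "f \<in> H" "g \<in> H" "h \<in> H" shows "ip (\<lambda>z. f z - g z) h = ip f h - ip g h"
proof -
  have "ip (\<lambda>z. f z + (-1) * g z) h = ip f h + ip (\<lambda>z. (-1) * g z) h"
    by (rule ip_add[OF assms(1) scale[OF assms(2)] assms(3)])
  also have "ip (\<lambda>z. (-1) * g z) h = (-1) * ip g h" by (rule ip_scale[OF assms(2,3)])
  finally show ?thesis by (simp only: mult_minus1 add_uminus_conv_diff)
qed

lemma ip_scale_right:
  assumes "f \<in> H" "g \<in> H" shows "ip f (\<lambda>z. c * g z) = cnj c * ip f g"
proof -
  have "ip f (\<lambda>z. c * g z) = cnj (c * ip g f)"
    using ip_commute[OF scale[OF assms(2)] assms(1)] ip_scale[OF assms(2,1)] by metis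
  also have "\<dots> = cnj c * ip f g" using ip_commute[OF assms] by (metis complex_cnj_cnj complex_cnj_mult)
  finally show ?thesis .
qed

lemma ip_diff_right:
  assumes "f \<in> H" "g \<in> H" "h \<in> H" shows "ip f (\<lambda>z. g z - h z) = ip f g - ip f h"
proof -
  have "ip f (\<lambda>z. g z - h z) = cnj (ip g f - ip h f)"
    using ip_commute[OF diff_mem[OF assms(2,3)] assms(1)] ip_diff[OF assms(2,3,1)] by metis
  also have "\<dots> = ip f g - ip f h"
    using ip_commute[OF assms(1,2)] ip_commute[OF assms(1,3)] by (metis complex_cnj_cnj complex_cnj_diff)
  finally show ?thesis .
qed

lemma ip_self_real:
  assumes "f \<in> H" shows "ip f f = of_real (Re (ip f f))"
proof -
  have "Im (ip f f) = - Im (ip f f)"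
    by (subst ip_commute[OF assms assms]) (rule cnj.sel)
  then show ?thesis by (intro complex_eqI) simp_all
qed

lemma sum_mem:
  assumes "finite I" "\<And>i. i \<in> I \<Longrightarrow> f i \<in> H"
  shows "(\<lambda>z. \<Sum>i\<in>I. c i * f i z) \<in> H"
  using assms
proof (induction I rule: finite_induct)
  case empty
  show ?case unfolding sum.empty by (rule zero)
next
  case (insert a I)
  have "(\<lambda>z. c a * f a z + (\<Sum>i\<in>I. c i * f i z)) \<in> H"
    by (rule add[OF scale[OF insert.prems[OF insertI1]] insert.IH[OF insert.prems[OF insertI2]]])
  then show ?case unfolding sum.insert[OF insert.hyps] .
qed

lemma ip_sum:
  assumes "finite I" "\<And>i. i \<in> I \<Longrightarrow> f i \<in> H" "g \<in> H"
  shows "ip (\<lambda>z. \<Sum>i\<in>I. c i * f i z) g = (\<Sum>i\<in>I. c i * ip (f i) g)"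
  using assms
proof (induction I rule: finite_induct)
  case empty
  show ?case unfolding sum.empty by (rule ip_zero_left[OF empty(2)])
next
  case (insert a I)
  have fa: "f a \<in> H" and fI: "(\<lambda>z. \<Sum>i\<in>I. c i * f i z) \<in> H"
    by (rule insert.prems(1)[OF insertI1], rule sum_mem[OF insert.hyps(1) insert.prems(1)[OF insertI2]])
  have "ip (\<lambda>z. c a * f a z + (\<Sum>i\<in>I. c i * f i z)) g = c a * ip (f a) g + (\<Sum>i\<in>I. c i * ip (f i) g)"
    unfolding ip_add[OF scale[OF fa] fI insert.prems(2)] ip_scale[OF fa insert.prems(2)]
    using insert.IH[OF insert.prems(1)[OF insertI2] insert.prems(2)] by (rule arg_cong)
  then show ?case unfolding sum.insert[OF insert.hyps] .
qed

lemma ip_sum_right: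
  assumes "finite I" "\<And>i. i \<in> I \<Longrightarrow> f i \<in> H" "g \<in> H"
  shows "ip g (\<lambda>z. \<Sum>i\<in>I. c i * f i z) = (\<Sum>i\<in>I. cnj (c i) * ip g (f i))"
proof -
  have "ip g (\<lambda>z. \<Sum>i\<in>I. c i * f i z) = cnj (ip (\<lambda>z. \<Sum>i\<in>I. c i * f i z) g)"
    by (rule ip_commute[OF sum_mem[OF assms(1,2)] assms(3)])
  also have "\<dots> = (\<Sum>i\<in>I. cnj (c i) * cnj (ip (f i) g))"
    by (subst ip_sum[OF assms(1)]) (simp_all only: assms cnj_sum complex_cnj_mult)
  also have "\<dots> = (\<Sum>i\<in>I. cnj (c i) * ip g (f i))"
    by (intro sum.cong refl) (simp only: ip_commute[OF assms(2) assms(3)])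
  finally show ?thesis .
qed

lemma cauchy_schwarz:
  assumes f: "f \<in> H" and g: "g \<in> H"
  shows "(cmod (ip f g))\<^sup>2 \<le> Re (ip f f) * Re (ip g g)"
proof (cases "Re (ip g g) = 0")
  case True
  then have "g = (\<lambda>z. 0)" using ip_eq_zero[OF g] ip_self_real[OF g] by (metis of_real_0)
  then have "ip f g = 0" using ip_commute[OF zero f] ip_zero_left[OF f] by (metis complex_cnj_zero)
  then show ?thesis using True by simp
next
  case False
  then have pos: "Re (ip g g) > 0" using ip_ge_zero[OF g] by simp
  define G where "G = Re (ip g g)"
  define A where "A = (cmod (ip f g))\<^sup>2"
  define t where "t = ip f g / of_real G"
  have G: "ip g g = of_real G" "G > 0" unfolding G_def by (rule ip_self_real[OF g], rule pos)
  have h: "(\<lambda>z. t * g z) \<in> H" using scale[OF g] .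
  have sq: "ip f g * cnj (ip f g) = of_real A"
    unfolding A_def by (rule complex_norm_square[symmetric])
  have "ip (\<lambda>z. f z - t * g z) (\<lambda>z. f z - t * g z)
     = (ip f f - cnj t * ip f g) - (t * ip g f - t * (cnj t * ip g g))"
    unfolding ip_diff[OF f h diff_mem[OF f h]] ip_diff_right[OF f f h] ip_scale_right[OF f g]
      ip_diff_right[OF h f h] ip_scale[OF g f] ip_scale[OF g h] ip_scale_right[OF g g] ..
  also have "\<dots> = ip f f - of_real (A / G)"
    unfolding ip_commute[OF f g] G(1) t_def using G(2) sq by (simp add: field_simps)
  finally have "0 \<le> Re (ip f f) - A / G"
    using ip_ge_zero[OF diff_mem[OF f h]] by simp
  then have "A \<le> Re (ip f f) * G" using G(2) by (simp add: field_simps)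
  then show ?thesis by (simp only: A_def G_def)
qed

lemma kernel_ip:
  assumes "l \<in> \<D>" "z \<in> \<D>" shows "ip (kfun l) (kfun z) = K z l"
  unfolding reproducing[OF kernel[OF assms(1)] assms(2), symmetric] by (rule if_P[OF assms(2)])

end


section \<open>Existence of the space: orthonormal expansions along a uniqueness sequence\<close>

definition disc_pt :: "nat \<Rightarrow> complex" where
  "disc_pt n = of_real (1 / (real n + 2))"

lemma disc_pt_in [simp]: "disc_pt n \<in> \<D>"
  unfolding disc_pt_def mem_ball_0 norm_of_real by simp

lemma disc_pt_norm [simp]: "cmod (disc_pt n) < 1"
  using disc_pt_in[of n] by (simp only: mem_ball_0)

text \<open>Accumulation at an interior point makes the sequence a uniqueness set, so a holomorphic
  identity need only be checked where the expansions are finite sums.\<close>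

lemma disc_pt_islimpt: "0 islimpt range disc_pt"
proof (rule islimpt_sequential[THEN iffD2], intro exI conjI allI)
  show "disc_pt n \<in> range disc_pt - {0}" for n
    by (auto simp: disc_pt_def simp flip: of_real_add of_nat_Suc) 
  have "(\<lambda>n. 1 / (real n + 2)) \<longlonglongrightarrow> 0" by real_asymp
  then show "disc_pt \<longlonglongrightarrow> 0"
    unfolding disc_pt_def using tendsto_of_real[of "\<lambda>n. 1 / (real n + 2)" 0] by (metis of_real_0)
qed

lemma hol_eq_on_pts:
  assumes "f holomorphic_on \<D>" "g holomorphic_on \<D>" "\<And>j. f (disc_pt j) = g (disc_pt j)" "z \<in> \<D>"
  shows "f z = g z"
proof -
  have "f z - g z = 0"
  proof (rule analytic_continuation[of "\<lambda>z. f z - g z" \<D> "range disc_pt" 0])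
    show "0 islimpt range disc_pt" by (rule disc_pt_islimpt)
  qed (use assms in \<open>auto intro!: holomorphic_intros\<close>)
  then show ?thesis by simp
qed

text \<open>\<open>bound\<close> turns the estimate of tails by \<open>sqrt (Re (K z z))\<close>
  into locally uniform convergence, so that the sums of the expansions are holomorphic.\<close>

locale disc_kernel =
  fixes K :: "complex \<Rightarrow> complex \<Rightarrow> complex"
  assumes psd: "psd_on \<D> K"
    and hol: "\<And>l. l \<in> \<D> \<Longrightarrow> (\<lambda>z. K z l) holomorphic_on \<D>"
    and bound: "\<And>r. r < 1 \<Longrightarrow> \<exists>M. \<forall>z\<in>cball 0 r. Re (K z z) \<le> M"
begin

definition e :: "nat \<Rightarrow> complex \<Rightarrow> complex" where "e = gs_vec K disc_pt"

lemma e_vanish: "j < n \<Longrightarrow> e n (disc_pt j) = 0"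
  unfolding e_def by (rule gs_vec_vanish[OF psd disc_pt_in])

lemma e_zero: "e n (disc_pt n) = 0 \<Longrightarrow> e n z = 0"
  unfolding e_def by (rule gs_vec_zero[OF psd disc_pt_in])

lemma gs_hol: "l \<in> \<D> \<Longrightarrow> (\<lambda>z. gs_kernel K disc_pt n z l) holomorphic_on \<D>"
proof (induction n arbitrary: l)
  case 0
  then show ?case using hol by simp
next
  case (Suc n)
  show ?case unfolding gs_kernel.simps divide_inverse
    by (intro holomorphic_intros Suc disc_pt_in)
qed

lemma e_hol: "e n holomorphic_on \<D>"
proof -
  have "(\<lambda>z. gs_kernel K disc_pt n z (disc_pt n) * inverse (of_real (sqrt (Re (gs_kernel K disc_pt n (disc_pt n) (disc_pt n))))))
     holomorphic_on \<D>"
    by (intro holomorphic_intros gs_hol disc_pt_in)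
  then show ?thesis unfolding e_def gs_vec_def[abs_def] divide_inverse .
qed

lemma e_l2: assumes "z \<in> \<D>" shows "square_summable (\<lambda>k. e k z)" "(\<Sum>k. (cmod (e k z))\<^sup>2) \<le> Re (K z z)"
  unfolding e_def by (rule square_summable_bounded_sums[OF gs_vec_bessel[OF psd disc_pt_in assms]])+

definition ser :: "(nat \<Rightarrow> complex) \<Rightarrow> complex \<Rightarrow> complex" where
  "ser c z = (if z \<in> \<D> then \<Sum>k. c k * e k z else 0)"

lemma ser_summable: "square_summable c \<Longrightarrow> z \<in> \<D> \<Longrightarrow> summable (\<lambda>k. c k * e k z)"
  using square_summable_mult_summable[OF _ e_l2(1)] by (rule summable_norm_cancel)

lemma tail_bound:
  assumes "square_summable c" "z \<in> \<D>"
  shows "cmod ((\<Sum>k. c k * e k z) - (\<Sum>k<n. c k * e k z)) \<le> sqrt (\<Sum>k. (cmod (c (k + n)))\<^sup>2) * sqrt (Re (K z z))"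
proof -
  have l2c: "square_summable (\<lambda>k. c (k + n))" using assms(1) unfolding square_summable_def by (rule summable_ignore_initial_segment)
  have l2e: "square_summable (\<lambda>k. e (k + n) z)" using e_l2(1)[OF assms(2)] unfolding square_summable_def by (rule summable_ignore_initial_segment)
  have "(\<Sum>k. c k * e k z) - (\<Sum>k<n. c k * e k z) = (\<Sum>k. c (k + n) * e (k + n) z)"
    using suminf_split_initial_segment[OF ser_summable[OF assms], of n] by simp
  also have "cmod \<dots> \<le> sqrt (\<Sum>k. (cmod (c (k + n)))\<^sup>2) * sqrt (\<Sum>k. (cmod (e (k + n) z))\<^sup>2)"
    by (rule square_summable_cauchy_schwarz[OF l2c l2e])
  also have "\<dots> \<le> sqrt (\<Sum>k. (cmod (c (k + n)))\<^sup>2) * sqrt (Re (K z z))"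
  proof (intro mult_left_mono real_sqrt_le_mono)
    have "(\<Sum>k. (cmod (e k z))\<^sup>2) = (\<Sum>k. (cmod (e (k + n) z))\<^sup>2) + (\<Sum>k<n. (cmod (e k z))\<^sup>2)"
      by (rule suminf_split_initial_segment) (use e_l2[OF assms(2)] in \<open>simp add: square_summable_def\<close>)
    moreover have "0 \<le> (\<Sum>k<n. (cmod (e k z))\<^sup>2)" by (intro sum_nonneg) auto
    ultimately show "(\<Sum>k. (cmod (e (k + n) z))\<^sup>2) \<le> Re (K z z)" using e_l2(2)[OF assms(2)] by linarith
    show "0 \<le> sqrt (\<Sum>k. (cmod (c (k + n)))\<^sup>2)"
      using l2c unfolding square_summable_def by (intro real_sqrt_ge_zero suminf_nonneg) auto
  qed
  finally show ?thesis .
qed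

lemma tail_zero: "square_summable c \<Longrightarrow> (\<lambda>n. sqrt (\<Sum>k. (cmod (c (k + n)))\<^sup>2)) \<longlonglongrightarrow> 0"
  using tendsto_real_sqrt[OF suminf_exist_split2[of "\<lambda>k. (cmod (c k))\<^sup>2"]] unfolding square_summable_def by simp

lemma ser_hol: assumes "square_summable c" shows "ser c \<in> hol_disc"
proof -
  have "(\<lambda>z. \<Sum>k. c k * e k z) holomorphic_on \<D>"
  proof (rule holomorphic_uniform_sequence[of _ "\<lambda>n z. \<Sum>k<n. c k * e k z"])
    show "(\<lambda>z. \<Sum>k<n. c k * e k z) holomorphic_on \<D>" for n
      by (intro holomorphic_intros e_hol)
    fix x assume x: "x \<in> \<D>"
    define d where "d = (1 - cmod x) / 2"
    have d: "d > 0" "cball x d \<subseteq> cball 0 ((1 + cmod x) / 2)" "(1 + cmod x) / 2 < 1"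
      using x by (auto simp: d_def cball_subset_cball_iff field_simps)
    have sub: "cball x d \<subseteq> \<D>" using d(2,3) by (auto simp: subset_iff)
    obtain M where M: "\<And>z. z \<in> cball 0 ((1 + cmod x) / 2) \<Longrightarrow> Re (K z z) \<le> M" using bound[OF d(3)] by blast
    have "uniform_limit (cball x d) (\<lambda>n z. \<Sum>k<n. c k * e k z) (\<lambda>z. \<Sum>k. c k * e k z) sequentially"
      unfolding uniform_limit_iff
    proof (intro allI impI)
      fix \<epsilon> :: real assume "\<epsilon> > 0"
      have "(\<lambda>n. sqrt (\<Sum>k. (cmod (c (k + n)))\<^sup>2) * sqrt M) \<longlonglongrightarrow> 0 * sqrt M"
        by (intro tendsto_intros tail_zero assms)
      then have "\<forall>\<^sub>F n in sequentially. sqrt (\<Sum>k. (cmod (c (k + n)))\<^sup>2) * sqrt M < \<epsilon>"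
        using \<open>\<epsilon> > 0\<close> by (simp add: order_tendstoD)
      then show "\<forall>\<^sub>F n in sequentially. \<forall>z\<in>cball x d. dist (\<Sum>k<n. c k * e k z) (\<Sum>k. c k * e k z) < \<epsilon>"
      proof (rule eventually_mono, intro ballI)
        fix n z assume n: "sqrt (\<Sum>k. (cmod (c (k + n)))\<^sup>2) * sqrt M < \<epsilon>" and z: "z \<in> cball x d"
        have "dist (\<Sum>k<n. c k * e k z) (\<Sum>k. c k * e k z) \<le> sqrt (\<Sum>k. (cmod (c (k + n)))\<^sup>2) * sqrt (Re (K z z))"
          unfolding dist_norm by (subst norm_minus_commute) (rule tail_bound[OF assms], use z sub in auto)
        also have "\<dots> \<le> sqrt (\<Sum>k. (cmod (c (k + n)))\<^sup>2) * sqrt M"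
        proof (intro mult_left_mono real_sqrt_le_mono)
          show "Re (K z z) \<le> M" using M z d(2) by auto
          show "0 \<le> sqrt (\<Sum>k. (cmod (c (k + n)))\<^sup>2)"
            using summable_ignore_initial_segment[of "\<lambda>k. (cmod (c k))\<^sup>2" n] assms unfolding square_summable_def
            by (intro real_sqrt_ge_zero suminf_nonneg) auto
        qed
        finally show "dist (\<Sum>k<n. c k * e k z) (\<Sum>k. c k * e k z) < \<epsilon>" using n by linarith
      qed
    qed
    then show "\<exists>d>0. cball x d \<subseteq> \<D> \<and> uniform_limit (cball x d) (\<lambda>n z. \<Sum>k<n. c k * e k z) (\<lambda>z. \<Sum>k. c k * e k z) sequentially"
      using d(1) sub by blast
  qed auto
  then have "ser c holomorphic_on \<D>"
    by (rule holomorphic_transform) (simp add: ser_def)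
  then show ?thesis by (auto simp: hol_disc_def ser_def)
qed

lemma ser_pt: assumes "square_summable c" shows "ser c (disc_pt j) = (\<Sum>k\<le>j. c k * e k (disc_pt j))"
proof -
  have "(\<Sum>k. c k * e k (disc_pt j)) = (\<Sum>k\<le>j. c k * e k (disc_pt j))"
    by (rule suminf_finite) (auto simp: e_vanish)
  then show ?thesis by (simp add: ser_def)
qed

text \<open>Both sides are holomorphic in \<open>z\<close>, and at the points
  \<open>disc_pt j\<close> the series is the finite Gram--Schmidt expansion.\<close>

lemma kernel_ser: assumes "l \<in> \<D>" shows "(\<lambda>z. if z \<in> \<D> then K z l else 0) = ser (\<lambda>k. cnj (e k l))"
proof
  fix z
  show "(if z \<in> \<D> then K z l else 0) = ser (\<lambda>k. cnj (e k l)) z"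
  proof (cases "z \<in> \<D>")
    case True
    have square_summable: "square_summable (\<lambda>k. cnj (e k l))" by (rule square_summable_cnj[OF e_l2(1)[OF assms]])
    have "K z l = ser (\<lambda>k. cnj (e k l)) z"
    proof (rule hol_eq_on_pts[OF hol[OF assms] _ _ True])
      show "ser (\<lambda>k. cnj (e k l)) holomorphic_on \<D>" using ser_hol[OF square_summable] by (simp add: hol_disc_def)
      fix j
      have "K (disc_pt j) l = cnj (K l (disc_pt j))" by (rule psd_on_herm[OF psd assms disc_pt_in])
      also have "\<dots> = (\<Sum>k\<le>j. cnj (e k l) * e k (disc_pt j))"
        by (subst gs_kernel_point[OF psd disc_pt_in assms]) (simp add: e_def)
      finally show "K (disc_pt j) l = ser (\<lambda>k. cnj (e k l)) (disc_pt j)" unfolding ser_pt[OF square_summable] .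
    qed
    then show ?thesis using True by simp
  qed (simp add: ser_def)
qed

text \<open>Where the pivot vanishes, \<open>e k\<close> is the zero function on the disc and its
  coefficient is invisible; fixing that coefficient to 0 makes \<open>ser\<close> injective.\<close>

definition valid :: "(nat \<Rightarrow> complex) \<Rightarrow> bool" where
  "valid c \<longleftrightarrow> square_summable c \<and> (\<forall>k. e k (disc_pt k) = 0 \<longrightarrow> c k = 0)"

text \<open>Evaluation at \<open>disc_pt k\<close> sees only the coefficients up to
  \<open>k\<close>: a triangular system, solved by strong induction.\<close>

lemma ser_inj: assumes "valid c" "valid d" "ser c = ser d" shows "c = d"
proof
  fix k show "c k = d k"
  proof (induction k rule: less_induct)
    case (less k)
    have square_summable: "square_summable c" "square_summable d" using assms by (auto simp: valid_def)
    have "(\<Sum>i\<le>k. c i * e i (disc_pt k)) = (\<Sum>i\<le>k. d i * e i (disc_pt k))"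
      using assms(3) ser_pt[OF square_summable(1), of k] ser_pt[OF square_summable(2), of k] by simp
    moreover have "(\<Sum>i<k. c i * e i (disc_pt k)) = (\<Sum>i<k. d i * e i (disc_pt k))"
      using less by (intro sum.cong) auto
    ultimately have "c k * e k (disc_pt k) = d k * e k (disc_pt k)"
      by (simp flip: lessThan_Suc_atMost)
    then show ?case using assms(1,2) by (cases "e k (disc_pt k) = 0") (auto simp: valid_def)
  qed
qed

definition space :: "(complex \<Rightarrow> complex) set" where "space = ser ` Collect valid"
definition coord :: "(complex \<Rightarrow> complex) \<Rightarrow> nat \<Rightarrow> complex" where "coord = the_inv_into (Collect valid) ser"
definition inprod :: "(complex \<Rightarrow> complex) \<Rightarrow> (complex \<Rightarrow> complex) \<Rightarrow> complex" where
  "inprod f g = (\<Sum>k. coord f k * cnj (coord g k))"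

lemma coord_ser: "valid c \<Longrightarrow> coord (ser c) = c"
  unfolding coord_def by (rule the_inv_into_f_f) (auto intro: inj_onI ser_inj)

lemma valid_add: "valid c \<Longrightarrow> valid d \<Longrightarrow> valid (\<lambda>k. c k + d k)"
  and valid_diff: "valid c \<Longrightarrow> valid d \<Longrightarrow> valid (\<lambda>k. c k - d k)"
  and valid_scale: "valid c \<Longrightarrow> valid (\<lambda>k. a * c k)"
  and valid_l2: "valid c \<Longrightarrow> square_summable c"
  by (simp_all add: valid_def square_summable_add square_summable_diff square_summable_scale)

lemma valid_zero: "valid (\<lambda>k. 0)" by (simp add: valid_def square_summable_def)

lemma valid_e: "l \<in> \<D> \<Longrightarrow> valid (\<lambda>k. cnj (e k l))"
  unfolding valid_def using square_summable_cnj[OF e_l2(1)] e_zero by simp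

lemma ser_add: "valid c \<Longrightarrow> valid d \<Longrightarrow> (\<lambda>z. ser c z + ser d z) = ser (\<lambda>k. c k + d k)"
  by (rule ext) (simp add: ser_def ser_summable valid_l2 suminf_add distrib_right)

lemma ser_diff: "valid c \<Longrightarrow> valid d \<Longrightarrow> (\<lambda>z. ser c z - ser d z) = ser (\<lambda>k. c k - d k)"
  by (rule ext) (simp add: ser_def ser_summable valid_l2 suminf_diff left_diff_distrib)

lemma ser_scale: "valid c \<Longrightarrow> (\<lambda>z. a * ser c z) = ser (\<lambda>k. a * c k)"
  by (rule ext) (simp add: ser_def ser_summable valid_l2 suminf_mult mult.assoc)

lemma inprod_ser: "valid c \<Longrightarrow> valid d \<Longrightarrow> inprod (ser c) (ser d) = (\<Sum>k. c k * cnj (d k))"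
  by (simp add: inprod_def coord_ser)

lemma inprod_summable: "valid c \<Longrightarrow> valid d \<Longrightarrow> summable (\<lambda>k. c k * cnj (d k))"
  using square_summable_mult_summable[OF valid_l2 square_summable_cnj[OF valid_l2]] by (rule summable_norm_cancel)

lemma inprod_self: "valid c \<Longrightarrow> inprod (ser c) (ser c) = of_real (\<Sum>k. (cmod (c k))\<^sup>2)"
  by (simp add: inprod_ser complex_norm_square[symmetric] suminf_of_real valid_l2[unfolded square_summable_def] del: of_real_power)

lemma ser_zero: "ser (\<lambda>k. 0) = (\<lambda>z. 0)" by (rule ext) (simp add: ser_def)

lemma spaceE: assumes "f \<in> space" obtains c where "valid c" "f = ser c"
  using assms by (auto simp: space_def)

lemma space_ser: "valid c \<Longrightarrow> ser c \<in> space" by (simp add: space_def)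

text \<open>\<open>inprod\<close> is defined so that \<open>ser\<close> is an isometry from the
  valid square summable sequences; each axiom is pulled back along it.\<close>

theorem space_rkhs: "disc_rkhs K space inprod"
proof
  show "space \<subseteq> hol_disc" by (auto simp: space_def ser_hol valid_l2)
  show "(\<lambda>z. 0) \<in> space" using space_ser[OF valid_zero] by (simp only: ser_zero)
next
  fix f g assume "f \<in> space" "g \<in> space"
  then show "(\<lambda>z. f z + g z) \<in> space"
    by (elim spaceE) (simp only: ser_add space_ser valid_add)
next
  fix c f assume "f \<in> space"
  then show "(\<lambda>z. c * f z) \<in> space"
    by (elim spaceE) (simp only: ser_scale space_ser valid_scale)
next
  fix f g h assume "f \<in> space" "g \<in> space" "h \<in> space"
  then show "inprod (\<lambda>z. f z + g z) h = inprod f h + inprod g h"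
    by (elim spaceE) (simp add: ser_add inprod_ser valid_add suminf_add inprod_summable distrib_right)
next
  fix a f g assume "f \<in> space" "g \<in> space"
  then show "inprod (\<lambda>z. a * f z) g = a * inprod f g"
    by (elim spaceE) (simp add: ser_scale inprod_ser valid_scale suminf_mult inprod_summable mult.assoc)
next
  fix f g assume "f \<in> space" "g \<in> space"
  then obtain c d where cd: "valid c" "f = ser c" "valid d" "g = ser d" by (elim spaceE)
  have "(\<lambda>k. c k * cnj (d k)) sums inprod f g"
    using inprod_summable[of c d] cd by (simp add: inprod_ser summable_sums)
  then have "(\<lambda>k. cnj (c k * cnj (d k))) sums cnj (inprod f g)" by (simp only: sums_cnj)
  then show "inprod g f = cnj (inprod f g)"
    using cd by (simp add: inprod_ser mult.commute sums_iff)
next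
  fix f assume "f \<in> space"
  then obtain c where c: "valid c" "f = ser c" by (elim spaceE)
  have "0 \<le> (\<Sum>k. (cmod (c k))\<^sup>2)" using valid_l2[OF c(1)] unfolding square_summable_def by (intro suminf_nonneg) auto
  then show "0 \<le> Re (inprod f f)" using c by (simp add: inprod_self)
next
  fix f assume "f \<in> space" "inprod f f = 0"
  then obtain c where c: "valid c" "f = ser c" "(\<Sum>k. (cmod (c k))\<^sup>2) = 0"
    by (elim spaceE) (simp add: inprod_self)
  have "(cmod (c k))\<^sup>2 = 0" for k
    using suminf_eq_zero_iff[OF valid_l2[OF c(1), unfolded square_summable_def]] c(3) by simp
  then have "c = (\<lambda>k. 0)" by (intro ext) simp
  then show "f = (\<lambda>z. 0)" using c(2) ser_zero by simp
next
  fix s :: "nat \<Rightarrow> complex \<Rightarrow> complex"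
  assume s: "\<And>n. s n \<in> space" and cau: "\<And>e. 0 < e \<Longrightarrow> \<exists>N. \<forall>m\<ge>N. \<forall>n\<ge>N.
        sqrt (Re (inprod (\<lambda>z. s m z - s n z) (\<lambda>z. s m z - s n z))) < e"
  have "\<forall>n. \<exists>c. valid c \<and> s n = ser c" using s by (auto elim: spaceE)
  then obtain c where c: "\<And>n. valid (c n)" "\<And>n. s n = ser (c n)" by metis
  have sq: "Re (inprod (\<lambda>z. s m z - ser d z) (\<lambda>z. s m z - ser d z)) = (\<Sum>k. (cmod (c m k - d k))\<^sup>2)"
    if "valid d" for m d
    unfolding c(2) ser_diff[OF c(1) that] inprod_self[OF valid_diff[OF c(1) that]] by simp
  have cau': "\<exists>N. \<forall>m\<ge>N. \<forall>n\<ge>N. sqrt (\<Sum>k. (cmod (c m k - c n k))\<^sup>2) < e" if "e > 0" for e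
    using cau[OF that] unfolding sq[OF c(1), folded c(2)] .
  obtain d where d: "square_summable d" "\<And>k. (\<lambda>n. c n k) \<longlonglongrightarrow> d k" "(\<lambda>n. sqrt (\<Sum>k. (cmod (c n k - d k))\<^sup>2)) \<longlonglongrightarrow> 0"
    using square_summable_complete[of c, OF valid_l2[OF c(1)] cau'] by blast
  have vd: "valid d" unfolding valid_def
  proof (intro conjI allI impI d(1))
    fix k assume "e k (disc_pt k) = 0"
    then have "(\<lambda>n. c n k) = (\<lambda>n. 0)" using c(1) by (auto simp: valid_def)
    then show "d k = 0" using d(2)[of k] by (simp add: LIMSEQ_const_iff)
  qed
  show "\<exists>f\<in>space. (\<lambda>n. sqrt (Re (inprod (\<lambda>z. s n z - f z) (\<lambda>z. s n z - f z)))) \<longlonglongrightarrow> 0"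
    by (rule bexI[OF _ space_ser[OF vd]]) (simp only: sq[OF vd] d(3))
next
  fix l assume l: "l \<in> \<D>"
  show "(\<lambda>z. if z \<in> \<D> then K z l else 0) \<in> space"
    unfolding kernel_ser[OF l] by (rule space_ser[OF valid_e[OF l]])
  fix f assume "f \<in> space"
  then obtain c where c: "valid c" "f = ser c" by (elim spaceE)
  show "f l = inprod f (\<lambda>z. if z \<in> \<D> then K z l else 0)"
    unfolding kernel_ser[OF l] c(2) inprod_ser[OF c(1) valid_e[OF l]] using l by (simp add: ser_def)
qed

end


section \<open>Uniqueness of the space with a given kernel\<close>

locale disc_kernel_rkhs = disc_kernel K + disc_rkhs K H ip for K H ip
begin

text \<open>Members of \<open>H\<close> vanish off the disc, whereas the values of
  \<open>e k\<close> there are not controlled.\<close>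

definition er :: "nat \<Rightarrow> complex \<Rightarrow> complex" where "er k = (\<lambda>z. if z \<in> \<D> then e k z else 0)"

definition res :: "nat \<Rightarrow> complex \<Rightarrow> complex \<Rightarrow> complex" where
  "res n l = (\<lambda>z. kfun l z - (\<Sum>k<n. cnj (e k l) * er k z))"

definition len :: "nat \<Rightarrow> real" where
  "len n = sqrt (Re (gs_kernel K disc_pt n (disc_pt n) (disc_pt n)))"

lemma e_len: "e n (disc_pt n) = of_real (len n)"
  unfolding e_def len_def by (rule gs_vec_self[OF psd disc_pt_in])

lemma res_eq: "z \<in> \<D> \<Longrightarrow> l \<in> \<D> \<Longrightarrow> res n l z = gs_kernel K disc_pt n z l"
  using gs_kernel_eq[where p = disc_pt and n = n, OF psd disc_pt_in, of z l] by (simp add: res_def er_def e_def mult.commute)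

lemma er_res: "er n = (\<lambda>z. inverse (of_real (len n)) * res n (disc_pt n) z)"
proof
  fix z show "er n z = inverse (of_real (len n)) * res n (disc_pt n) z"
  proof (cases "z \<in> \<D>")
    case True
    then show ?thesis
      unfolding res_eq[OF True disc_pt_in] by (simp add: er_def e_def gs_vec_def len_def divide_inverse mult.commute)
  next
    case False
    then show ?thesis by (simp add: er_def res_def)
  qed
qed

lemma res_len_zero: "len n = 0 \<Longrightarrow> res n (disc_pt n) = (\<lambda>z. 0)"
proof
  fix z assume 0: "len n = 0"
  show "res n (disc_pt n) z = 0"
  proof (cases "z \<in> \<D>")
    case True
    have psdn: "psd_on \<D> (gs_kernel K disc_pt n)" by (rule gs_kernel_psd[OF psd disc_pt_in])
    have "gs_kernel K disc_pt n (disc_pt n) (disc_pt n) = 0"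
      using 0 psd_on_diag[OF psdn disc_pt_in, of n] unfolding len_def by (metis of_real_0 real_sqrt_eq_zero_cancel_iff)
    then show ?thesis
      using psd_on_diag_zero[OF psdn True disc_pt_in] res_eq[OF True disc_pt_in] by simp
  next
    case False
    then show ?thesis by (simp add: er_def res_def)
  qed
qed

text \<open>By recursion \<open>er n\<close> is a finite combination of kernel functions, which lie
  in every space with this kernel.\<close>

lemma er_mem: "er n \<in> H"
proof (induction n rule: less_induct)
  case (less n)
  have "res n (disc_pt n) \<in> H"
    unfolding res_def by (rule diff_mem[OF kernel[OF disc_pt_in] sum_mem]) (use less in auto)
  then show ?case unfolding er_res[of n] by (rule scale)
qed

lemma res_mem: "l \<in> \<D> \<Longrightarrow> res n l \<in> H"
  unfolding res_def by (rule diff_mem[OF kernel sum_mem]) (use er_mem in auto)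

lemma ip_res:
  assumes f: "f \<in> H" and l: "l \<in> \<D>"
  shows "ip f (res n l) = f l - (\<Sum>k<n. e k l * ip f (er k))"
proof -
  have "ip f (res n l) = ip f (kfun l) - ip f (\<lambda>z. \<Sum>k<n. cnj (e k l) * er k z)"
    unfolding res_def by (rule ip_diff_right[OF f kernel[OF l] sum_mem]) (use er_mem in auto)
  also have "ip f (kfun l) = f l" by (rule reproducing[OF f l, symmetric])
  also have "ip f (\<lambda>z. \<Sum>k<n. cnj (e k l) * er k z) = (\<Sum>k<n. cnj (cnj (e k l)) * ip f (er k))"
    by (rule ip_sum_right) (use er_mem f in auto)
  finally show ?thesis by simp
qed

text \<open>The coefficients of \<open>f\<close> against \<open>er\<close> solve the same triangular
  system as the coefficients of a series that takes the values of \<open>f\<close> at the points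
  \<open>disc_pt n\<close>.\<close>

lemma coeff_eq:
  assumes f: "f \<in> H"
  shows "of_real (len n) * ip f (er n) = f (disc_pt n) - (\<Sum>k<n. e k (disc_pt n) * ip f (er k))"
proof (cases "len n = 0")
  case True
  have "ip f (\<lambda>z. 0) = 0" using ip_commute[OF zero f] ip_zero_left[OF f] by (simp only: complex_cnj_zero)
  then show ?thesis
    using ip_res[OF f disc_pt_in, of n n] True unfolding res_len_zero[OF True] by simp
next
  case False
  have "ip f (er n) = cnj (inverse (of_real (len n))) * ip f (res n (disc_pt n))"
    unfolding er_res[of n] by (rule ip_scale_right[OF f res_mem[OF disc_pt_in]])
  then show ?thesis using False by (simp add: ip_res[OF f disc_pt_in])
qed

lemma er_zero: "len n = 0 \<Longrightarrow> er n = (\<lambda>z. 0)"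
  unfolding er_def by (rule ext) (simp add: e_zero e_len)

text \<open>Both facts come from \<open>coeff_eq\<close> applied to the vectors \<open>er m\<close>
  themselves. They share one induction because orthogonality at \<open>n\<close> uses the
  normalisation at smaller indices.\<close>

lemma er_orth_less:
  "m < n \<Longrightarrow> ip (er m) (er n) = 0" and er_self: "len m \<noteq> 0 \<Longrightarrow> ip (er m) (er m) = 1"
proof -
  have "(\<forall>m<n. ip (er m) (er n) = 0) \<and> (len n \<noteq> 0 \<longrightarrow> ip (er n) (er n) = 1)" for n
  proof (induction n rule: less_induct)
    case (less n)
    have sym: "ip (er i) (er j) = 0" if "i < n" "j < n" "i \<noteq> j" for i j
    proof (cases "i < j")
      case True then show ?thesis using less[of j] that by simp
    next
      case False
      then have "ip (er j) (er i) = 0" using less[of i] that by simp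
      then show ?thesis using ip_commute[OF er_mem er_mem, of j i] by simp
    qed
    have "ip (er m) (er n) = 0" if m: "m < n" for m
    proof (cases "len n = 0 \<or> len m = 0")
      case True
      have "ip (er m) (er n) = 0" if "len n = 0"
        using ip_commute[OF zero er_mem, of m] ip_zero_left[OF er_mem, of m] by (simp only: er_zero[OF that] complex_cnj_zero)
      moreover have "ip (er m) (er n) = 0" if "len m = 0"
        by (simp only: er_zero[OF that] ip_zero_left[OF er_mem])
      ultimately show ?thesis using True by blast
    next
      case False
      have "(\<Sum>k<n. e k (disc_pt n) * ip (er m) (er k)) = (\<Sum>k\<in>{m}. e k (disc_pt n) * ip (er m) (er k))"
        by (rule sum.mono_neutral_right) (use m sym in auto)
      also have "\<dots> = e m (disc_pt n)" using less[OF m] False by simp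
      also have "\<dots> = er m (disc_pt n)" by (simp add: er_def)
      finally have "of_real (len n) * ip (er m) (er n) = 0"
        using coeff_eq[OF er_mem, of n m] by simp
      then show ?thesis using False by simp
    qed
    then have orth: "\<forall>m<n. ip (er m) (er n) = 0" by blast
    have "ip (er n) (er n) = 1" if "len n \<noteq> 0"
    proof -
      have "ip (er n) (er k) = 0" if "k < n" for k
        using orth that ip_commute[OF er_mem er_mem, of k n] by simp
      then have "of_real (len n) * ip (er n) (er n) = er n (disc_pt n)"
        using coeff_eq[OF er_mem, of n n] by simp
      also have "\<dots> = of_real (len n)" by (simp add: er_def e_len)
      finally show ?thesis using that by simp
    qed
    then show ?case using orth by blast
  qed
  then show "m < n \<Longrightarrow> ip (er m) (er n) = 0" "len m \<noteq> 0 \<Longrightarrow> ip (er m) (er m) = 1" by blast+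
qed

lemma er_ip: "ip (er i) (er j) = (if i = j \<and> len i \<noteq> 0 then 1 else 0)"
proof -
  consider "i < j" | "j < i" | "i = j" by linarith
  then show ?thesis
  proof cases
    case 1 then show ?thesis using er_orth_less by simp
  next
    case 2
    then show ?thesis using er_orth_less[of j i] ip_commute[OF er_mem er_mem, of j i] by simp
  next
    case 3
    show ?thesis
    proof (cases "len i = 0")
      case True
      then show ?thesis by (simp only: er_zero[OF True] ip_zero_left[OF er_mem]) (simp add: ip_zero_left[OF zero] 3 er_zero[OF True])
    next
      case False
      then show ?thesis using 3 er_self by simp
    qed
  qed
qed

lemma part_ip:
  assumes "valid c" "finite A"
  shows "ip (\<lambda>z. \<Sum>k\<in>A. c k * er k z) (\<lambda>z. \<Sum>k\<in>A. c k * er k z) = of_real (\<Sum>k\<in>A. (cmod (c k))\<^sup>2)"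
proof -
  have mem: "(\<lambda>z. \<Sum>k\<in>A. c k * er k z) \<in> H" by (rule sum_mem) (use assms er_mem in auto)
  have "ip (\<lambda>z. \<Sum>k\<in>A. c k * er k z) (\<lambda>z. \<Sum>k\<in>A. c k * er k z)
      = (\<Sum>k\<in>A. c k * ip (er k) (\<lambda>z. \<Sum>k\<in>A. c k * er k z))"
    by (rule ip_sum) (use assms mem er_mem in auto)
  also have "\<dots> = (\<Sum>k\<in>A. c k * (\<Sum>j\<in>A. cnj (c j) * ip (er k) (er j)))"
    by (intro sum.cong refl arg_cong2[of _ _ _ _ "(*)"] ip_sum_right) (use assms er_mem in auto)
  also have "\<dots> = (\<Sum>k\<in>A. c k * (if len k \<noteq> 0 then cnj (c k) else 0))"
  proof (intro sum.cong refl arg_cong2[of _ _ _ _ "(*)"])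
    fix k assume "k \<in> A"
    have "(\<Sum>j\<in>A. cnj (c j) * ip (er k) (er j)) = (\<Sum>j\<in>A. if k = j then (if len k \<noteq> 0 then cnj (c k) else 0) else 0)"
      by (intro sum.cong refl) (simp add: er_ip)
    then show "(\<Sum>j\<in>A. cnj (c j) * ip (er k) (er j)) = (if len k \<noteq> 0 then cnj (c k) else 0)"
      using \<open>k \<in> A\<close> assms by simp
  qed
  also have "\<dots> = (\<Sum>k\<in>A. of_real ((cmod (c k))\<^sup>2))"
  proof (intro sum.cong refl)
    fix k show "c k * (if len k \<noteq> 0 then cnj (c k) else 0) = of_real ((cmod (c k))\<^sup>2)"
      using assms(1) by (cases "len k = 0") (auto simp: valid_def e_len complex_norm_square[symmetric] simp del: of_real_power)
  qed
  finally show ?thesis by simp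
qed

text \<open>Bessel's inequality makes the coefficients square summable, and by
  \<open>coeff_eq\<close> the resulting series agrees with \<open>f\<close> on the uniqueness
  sequence.\<close>

lemma H_subset_space: "H \<subseteq> space"
proof
  fix f assume f: "f \<in> H"
  define c where "c = (\<lambda>k. ip f (er k))"
  have czero: "c k = 0" if "len k = 0" for k
    unfolding c_def er_zero[OF that] using ip_commute[OF zero f] ip_zero_left[OF f] by (simp only: complex_cnj_zero)
  have "(\<Sum>k<n. (cmod (c k))\<^sup>2) \<le> Re (ip f f)" for n
  proof -
    let ?s = "\<lambda>z. \<Sum>k<n. c k * er k z"
    define S where "S = (\<Sum>k<n. (cmod (c k))\<^sup>2)"
    have s: "?s \<in> H" by (rule sum_mem) (use er_mem in auto)
    have fs: "ip f ?s = of_real S"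
    proof -
      have "ip f ?s = (\<Sum>k<n. cnj (c k) * ip f (er k))" by (rule ip_sum_right) (use er_mem f in auto)
      also have "\<dots> = (\<Sum>k<n. of_real ((cmod (c k))\<^sup>2))"
        by (intro sum.cong refl) (simp add: c_def complex_norm_square[symmetric] mult.commute del: of_real_power)
      finally show ?thesis by (simp add: S_def)
    qed
    have ss: "ip ?s ?s = of_real S"
    proof -
      have "ip ?s ?s = (\<Sum>k<n. c k * ip (er k) ?s)" by (rule ip_sum) (use er_mem s in auto)
      also have "\<dots> = (\<Sum>k<n. c k * (\<Sum>j<n. cnj (c j) * ip (er k) (er j)))"
        by (intro sum.cong refl arg_cong2[of _ _ _ _ "(*)"] ip_sum_right) (use er_mem in auto)
      also have "\<dots> = (\<Sum>k<n. of_real ((cmod (c k))\<^sup>2))"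
      proof (intro sum.cong refl)
        fix k assume k: "k \<in> {..<n}"
        have "(\<Sum>j<n. cnj (c j) * ip (er k) (er j)) = (\<Sum>j<n. if k = j then (if len k \<noteq> 0 then cnj (c k) else 0) else 0)"
          by (intro sum.cong refl) (simp add: er_ip)
        also have "\<dots> = (if len k \<noteq> 0 then cnj (c k) else 0)" using k by simp
        finally show "c k * (\<Sum>j<n. cnj (c j) * ip (er k) (er j)) = of_real ((cmod (c k))\<^sup>2)"
          using czero[of k] by (cases "len k = 0") (simp_all add: complex_norm_square[symmetric] del: of_real_power)
      qed
      finally show ?thesis by (simp add: S_def)
    qed
    have sf: "ip ?s f = of_real S" using ip_commute[OF f s] fs by simp
    have "ip (\<lambda>z. f z - ?s z) (\<lambda>z. f z - ?s z) = (ip f f - ip f ?s) - (ip ?s f - ip ?s ?s)"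
      unfolding ip_diff[OF f s diff_mem[OF f s]] ip_diff_right[OF f f s] ip_diff_right[OF s f s] ..
    also have "\<dots> = ip f f - of_real S" unfolding fs ss sf by simp
    finally show ?thesis using ip_ge_zero[OF diff_mem[OF f s]] by (simp add: S_def)
  qed
  then have "square_summable c" by (rule square_summable_bounded_sums)
  then have valid: "valid c" using czero by (simp add: valid_def e_len)
  have fd: "f \<in> hol_disc" using holomorphic f by blast
  have "f = ser c"
  proof
    fix z
    show "f z = ser c z"
    proof (cases "z \<in> \<D>")
      case True
      show ?thesis
      proof (rule hol_eq_on_pts[OF _ _ _ True])
        show "f holomorphic_on \<D>" "ser c holomorphic_on \<D>"
          using fd ser_hol[OF \<open>square_summable c\<close>] by (auto simp: hol_disc_def)
        fix j
        have "(\<Sum>k\<le>j. c k * e k (disc_pt j)) = of_real (len j) * ip f (er j) + (\<Sum>k<j. e k (disc_pt j) * ip f (er k))"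
          by (simp add: c_def e_len mult.commute flip: lessThan_Suc_atMost)
        then show "f (disc_pt j) = ser c (disc_pt j)"
          unfolding ser_pt[OF \<open>square_summable c\<close>] using coeff_eq[OF f, of j] by simp
      qed
    next
      case False
      then show ?thesis using fd by (simp add: ser_def hol_disc_def)
    qed
  qed
  then show "f \<in> space" using space_ser[OF valid] by simp
qed

text \<open>The partial sums are Cauchy in \<open>H\<close>. Norm convergence forces pointwise
  convergence through the reproducing property, so the limit that completeness provides is the given
  series.\<close>

lemma space_subset_H: "space \<subseteq> H"
proof
  fix f assume "f \<in> space"
  then obtain c where c: "valid c" "f = ser c" by (elim spaceE)
  define s where "s n = (\<lambda>z. \<Sum>k<n. c k * er k z)" for n
  have s: "s n \<in> H" for n unfolding s_def by (rule sum_mem) (use er_mem in auto)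
  have cs: "summable (\<lambda>k. (cmod (c k))\<^sup>2)" using valid_l2[OF c(1)] by (simp add: square_summable_def)
  have diff: "sqrt (Re (ip (\<lambda>z. s m z - s n z) (\<lambda>z. s m z - s n z))) \<le> sqrt (\<Sum>k. (cmod (c (k + n)))\<^sup>2)"
    if "n \<le> m" for m n
  proof -
    have split: "{..<m} = {..<n} \<union> {n..<m}" using that by auto
    have "s m z = s n z + (\<Sum>k\<in>{n..<m}. c k * er k z)" for z
      unfolding s_def split by (rule sum.union_disjoint) auto
    then have "(\<lambda>z. s m z - s n z) = (\<lambda>z. \<Sum>k\<in>{n..<m}. c k * er k z)" by simp
    then have "Re (ip (\<lambda>z. s m z - s n z) (\<lambda>z. s m z - s n z)) = (\<Sum>k\<in>{n..<m}. (cmod (c k))\<^sup>2)"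
      using part_ip[OF c(1), of "{n..<m}"] by simp
    also have "\<dots> = (\<Sum>k<m-n. (cmod (c (k + n)))\<^sup>2)"
      using sum.shift_bounds_nat_ivl[of "\<lambda>k. (cmod (c k))\<^sup>2" 0 n "m-n"] that by (simp add: atLeast0LessThan)
    also have "\<dots> \<le> (\<Sum>k. (cmod (c (k + n)))\<^sup>2)"
      using summable_ignore_initial_segment[OF cs, of n] by (intro sum_le_suminf) auto
    finally show ?thesis by (rule real_sqrt_le_mono)
  qed
  have cau: "\<exists>N. \<forall>m\<ge>N. \<forall>n\<ge>N. sqrt (Re (ip (\<lambda>z. s m z - s n z) (\<lambda>z. s m z - s n z))) < \<epsilon>" if epos: "0 < \<epsilon>" for \<epsilon>
  proof -
    obtain N where N: "\<And>n. n \<ge> N \<Longrightarrow> sqrt (\<Sum>k. (cmod (c (k + n)))\<^sup>2) < \<epsilon>"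
      using order_tendstoD(2)[OF tail_zero[OF valid_l2[OF c(1)]] epos] unfolding eventually_sequentially by blast
    have sym: "ip (\<lambda>z. s m z - s n z) (\<lambda>z. s m z - s n z) = ip (\<lambda>z. s n z - s m z) (\<lambda>z. s n z - s m z)" for m n
    proof -
      have "(\<lambda>z. s n z - s m z) = (\<lambda>z. (-1) * (s m z - s n z))" by simp
      then show ?thesis
        using ip_scale[OF diff_mem[OF s s] scale[OF diff_mem[OF s s]], of "-1" m n "-1" m n]
          ip_scale_right[OF diff_mem[OF s s] diff_mem[OF s s], of m n "-1" m n] by simp
    qed
    have "sqrt (Re (ip (\<lambda>z. s m z - s n z) (\<lambda>z. s m z - s n z))) < \<epsilon>" if "m \<ge> N" "n \<ge> N" for m n
    proof (cases "n \<le> m")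
      case True then show ?thesis using diff[OF True] N[OF that(2)] by linarith
    next
      case False
      then have "m \<le> n" by simp
      show ?thesis unfolding sym[of m n] using diff[OF \<open>m \<le> n\<close>] N[OF that(1)] by linarith
    qed
    then show ?thesis by blast
  qed
  have "\<exists>F\<in>H. (\<lambda>n. sqrt (Re (ip (\<lambda>z. s n z - F z) (\<lambda>z. s n z - F z)))) \<longlonglongrightarrow> 0"
    by (rule complete[OF s cau])
  then obtain F where F: "F \<in> H" "(\<lambda>n. sqrt (Re (ip (\<lambda>z. s n z - F z) (\<lambda>z. s n z - F z)))) \<longlonglongrightarrow> 0"
    by (rule bexE)
  have "F = f"
  proof
    fix z show "F z = f z"
    proof (cases "z \<in> \<D>")
      case True
      have "(\<lambda>n. s n z - F z) \<longlonglongrightarrow> 0"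
      proof (rule Lim_null_comparison)
        show "(\<lambda>n. sqrt (Re (ip (\<lambda>z. s n z - F z) (\<lambda>z. s n z - F z))) * sqrt (Re (K z z))) \<longlonglongrightarrow> 0"
          using tendsto_mult_left_zero[OF F(2)] .
        have "cmod (s n z - F z) \<le> sqrt (Re (ip (\<lambda>z. s n z - F z) (\<lambda>z. s n z - F z))) * sqrt (Re (K z z))" for n
        proof -
          have "s n z - F z = ip (\<lambda>z. s n z - F z) (kfun z)"
            by (rule reproducing[OF diff_mem[OF s F(1)] True])
          then have "(cmod (s n z - F z))\<^sup>2 \<le> Re (ip (\<lambda>z. s n z - F z) (\<lambda>z. s n z - F z)) * Re (K z z)"
            using cauchy_schwarz[OF diff_mem[OF s F(1)] kernel[OF True], of n] kernel_ip[OF True True] by simp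
          then show ?thesis unfolding real_sqrt_mult[symmetric] by (rule real_le_rsqrt)
        qed
        then show "\<forall>\<^sub>F n in sequentially. cmod (s n z - F z) \<le> sqrt (Re (ip (\<lambda>z. s n z - F z) (\<lambda>z. s n z - F z))) * sqrt (Re (K z z))"
          by (intro always_eventually allI)
      qed
      then have "(\<lambda>n. s n z) \<longlonglongrightarrow> F z" by (rule LIM_zero_cancel)
      moreover have "(\<lambda>n. s n z) \<longlonglongrightarrow> f z"
        using summable_LIMSEQ[OF ser_summable[OF valid_l2[OF c(1)] True]] True by (simp add: s_def er_def c(2) ser_def)
      ultimately show ?thesis by (rule LIMSEQ_unique)
    next
      case False
      then show ?thesis using holomorphic F(1) by (auto simp: c(2) ser_def hol_disc_def)
    qed
  qed
  then show "f \<in> H" using F(1) by simp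
qed

lemma H_eq_space: "H = space" using H_subset_space space_subset_H by blast

end

text \<open>This is what licenses the definite description in \<open>dBR\<close>.\<close>

theorem (in disc_kernel) rkhs_the: "\<exists>ip. disc_rkhs K (THE H. \<exists>ip. disc_rkhs K H ip) ip"
proof -
  have "\<exists>!H. \<exists>ip. disc_rkhs K H ip"
  proof (rule ex1I[of _ space])
    show "\<exists>ip. disc_rkhs K space ip" using space_rkhs by blast
    fix H assume "\<exists>ip. disc_rkhs K H ip"
    then obtain ip where "disc_rkhs K H ip" by blast
    then interpret disc_kernel_rkhs K H ip
      by (intro disc_kernel_rkhs.intro disc_kernel_axioms)
    show "H = space" by (rule H_eq_space)
  qed
  then show ?thesis by (rule theI')
qed


subsection \<open>Parseval on circles\<close>

lemma has_integral_cis: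
  "((\<lambda>t. cis (of_int k * t)) has_integral (if k = 0 then of_real (2 * pi) else 0)) {0..2*pi}"
proof (cases "k = 0")
  case True
  have "((\<lambda>t. 1 :: complex) has_integral (2 * pi - 0) *\<^sub>R 1) {0..2*pi}"
    by (rule has_integral_const_real[of 1 0 "2*pi", simplified, THEN has_integral_eq_rhs]) (simp_all add: scaleR_conv_of_real)
  then show ?thesis using True by (simp add: scaleR_conv_of_real)
next
  case False
  have "((\<lambda>t. cis (of_int k * t)) has_integral
      (exp (\<i> * of_int k * of_real (2*pi)) / (\<i> * of_int k) - exp (\<i> * of_int k * of_real 0) / (\<i> * of_int k))) {0..2*pi}"
  proof (rule fundamental_theorem_of_calculus)
    fix t :: real
    have "((\<lambda>z. exp (\<i> * of_int k * z) / (\<i> * of_int k)) has_field_derivative exp (\<i> * of_int k * of_real t)) (at (of_real t))"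
      using False by (auto intro!: derivative_eq_intros)
    from has_vector_derivative_real_field[OF this]
    show "((\<lambda>t. exp (\<i> * of_int k * of_real t) / (\<i> * of_int k)) has_vector_derivative cis (of_int k * t)) (at t within {0..2*pi})"
      by (simp add: cis_conv_exp mult.assoc)
  qed auto
  moreover have "exp (\<i> * of_int k * of_real (2*pi)) = 1"
    using exp_integer_2pi[of "of_int k"] by (simp add: algebra_simps)
  ultimately show ?thesis using False by simp
qed

definition power_series :: "(nat \<Rightarrow> complex) \<Rightarrow> complex \<Rightarrow> complex" where
  "power_series a z = (\<Sum>m. a m * z ^ m)"

text \<open>Absolute summability at radius \<open>r\<close> makes the partial sums converge
  uniformly on the circle, so products may be integrated termwise and orthogonality leaves the
  diagonal. The value stays a limit \<open>J\<close> because summability of the diagonal series is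
  deduced from it afterwards.\<close>

lemma circle_parseval_aux:
  assumes a: "summable (\<lambda>m. cmod (a m) * r ^ m)" and h: "summable (\<lambda>m. cmod (h m) * r ^ m)" and r: "0 \<le> r"
  obtains J where "((\<lambda>t. power_series a (of_real r * cis t) * cnj (power_series h (of_real r * cis t))) has_integral J) {0..2*pi}"
    "(\<lambda>n. of_real (2 * pi) * (\<Sum>m<n. a m * cnj (h m) * of_real (r ^ (2 * m)))) \<longlonglongrightarrow> J"
proof -
  define F where "F = (\<lambda>a n t. \<Sum>m<n. a m * (of_real r * cis t :: complex) ^ m)"
  have nrm: "norm (a m * (of_real r * cis t) ^ m) = cmod (a m) * r ^ m" for a m t
    using r by (simp add: norm_mult norm_power)
  have ul: "uniform_limit {0..2*pi} (F a) (\<lambda>t. power_series a (of_real r * cis t)) sequentially"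
    and bd: "bounded ((\<lambda>t. power_series a (of_real r * cis t)) ` {0..2*pi})"
    if "summable (\<lambda>m. cmod (a m) * r ^ m)" for a
  proof -
    show "uniform_limit {0..2*pi} (F a) (\<lambda>t. power_series a (of_real r * cis t)) sequentially"
      unfolding F_def power_series_def by (rule Weierstrass_m_test[OF _ that]) (simp only: nrm order_refl)
    have "cmod (power_series a (of_real r * cis t)) \<le> (\<Sum>m. cmod (a m) * r ^ m)" for t
      unfolding power_series_def by (rule norm_suminf_le[OF _ that]) (simp only: nrm order_refl)
    then show "bounded ((\<lambda>t. power_series a (of_real r * cis t)) ` {0..2*pi})" by (auto simp: bounded_iff)
  qed
  have ulc: "uniform_limit {0..2*pi} (\<lambda>n t. cnj (F h n t)) (\<lambda>t. cnj (power_series h (of_real r * cis t))) sequentially"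
    using ul[OF h] unfolding uniform_limit_iff dist_norm complex_cnj_diff[symmetric] complex_mod_cnj .
  have bdc: "bounded ((\<lambda>t. cnj (power_series h (of_real r * cis t))) ` {0..2*pi})"
    using bd[OF h] by (auto simp: bounded_iff)
  have cont: "continuous_on {0..2*pi} (\<lambda>t. F a n t * cnj (F h n t))" for n
    unfolding F_def by (intro continuous_intros)
  obtain I J where IJ: "\<And>n. ((\<lambda>t. F a n t * cnj (F h n t)) has_integral I n) {0..2*pi}"
     "((\<lambda>t. power_series a (of_real r * cis t) * cnj (power_series h (of_real r * cis t))) has_integral J) {0..2*pi}" "I \<longlonglongrightarrow> J"
    by (rule uniform_limit_integral[OF uniform_lim_mult[OF ul[OF a] ulc bd[OF a] bdc] cont sequentially_bot], rule that)
  have "I n = of_real (2 * pi) * (\<Sum>m<n. a m * cnj (h m) * of_real (r ^ (2 * m)))" for n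
  proof (rule has_integral_unique[OF IJ(1)])
    have "((\<lambda>t. \<Sum>i<n. \<Sum>j<n. a i * cnj (h j) * of_real (r ^ (i + j)) * cis (of_int (int i - int j) * t)) has_integral
       (\<Sum>i<n. \<Sum>j<n. a i * cnj (h j) * of_real (r ^ (i + j)) * (if int i - int j = 0 then of_real (2 * pi) else 0))) {0..2*pi}"
      by (intro has_integral_sum has_integral_mult_right has_integral_cis) auto
    moreover have "(\<Sum>i<n. \<Sum>j<n. a i * cnj (h j) * of_real (r ^ (i + j)) * cis (of_int (int i - int j) * t)) = F a n t * cnj (F h n t)" for t
      unfolding F_def cnj_sum sum_product
    proof (intro sum.cong refl)
      fix i j
      have "cis (of_int (int i - int j) * t) = cis t ^ i * cnj (cis t) ^ j"
        unfolding cis_cnj Complex.DeMoivre cis_mult by (rule arg_cong[of _ _ cis]) (simp add: algebra_simps)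
      then show "a i * cnj (h j) * of_real (r ^ (i + j)) * cis (of_int (int i - int j) * t)
        = a i * (of_real r * cis t) ^ i * cnj (h j * (of_real r * cis t) ^ j)"
        by (simp add: power_add power_mult_distrib)
    qed
    moreover have "(\<Sum>i<n. \<Sum>j<n. a i * cnj (h j) * of_real (r ^ (i + j)) * (if int i - int j = 0 then of_real (2 * pi) else 0))
      = of_real (2 * pi) * (\<Sum>m<n. a m * cnj (h m) * of_real (r ^ (2 * m)))"
    proof -
      have "(\<Sum>j<n. a i * cnj (h j) * of_real (r ^ (i + j)) * (if int i - int j = 0 then of_real (2 * pi) else 0))
         = (\<Sum>j<n. if i = j then a i * cnj (h i) * of_real (r ^ (2 * i)) * of_real (2 * pi) else 0)" for i
      proof (intro sum.cong refl)
        fix j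
        have eq0: "(int i - int j = 0) = (i = j)" by linarith
        show "a i * cnj (h j) * of_real (r ^ (i + j)) * (if int i - int j = 0 then of_real (2 * pi) else 0)
          = (if i = j then a i * cnj (h i) * of_real (r ^ (2 * i)) * of_real (2 * pi) else 0)"
        proof (cases "i = j")
          case True
          show ?thesis unfolding True by (simp only: diff_self refl if_True mult_2)
        next
          case False
          then show ?thesis by (simp only: eq0 if_False mult_zero_right)
        qed
      qed
      then show ?thesis by (simp add: sum_distrib_left mult_ac)
    qed
    ultimately show "((\<lambda>t. F a n t * cnj (F h n t)) has_integral of_real (2 * pi) * (\<Sum>m<n. a m * cnj (h m) * of_real (r ^ (2 * m)))) {0..2*pi}"
      by (simp only:)
  qed
  then have "I = (\<lambda>n. of_real (2 * pi) * (\<Sum>m<n. a m * cnj (h m) * of_real (r ^ (2 * m))))" by (rule ext)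
  then show ?thesis using that IJ(2,3) by simp
qed

lemma circle_parseval:
  assumes "summable (\<lambda>m. cmod (a m) * r ^ m)" "summable (\<lambda>m. cmod (h m) * r ^ m)" "0 \<le> r"
  shows "summable (\<lambda>m. a m * cnj (h m) * of_real (r ^ (2 * m)))"
    and "((\<lambda>t. power_series a (of_real r * cis t) * cnj (power_series h (of_real r * cis t))) has_integral
       of_real (2 * pi) * (\<Sum>m. a m * cnj (h m) * of_real (r ^ (2 * m)))) {0..2*pi}"
proof -
  obtain J where J: "((\<lambda>t. power_series a (of_real r * cis t) * cnj (power_series h (of_real r * cis t))) has_integral J) {0..2*pi}"
    "(\<lambda>n. of_real (2 * pi) * (\<Sum>m<n. a m * cnj (h m) * of_real (r ^ (2 * m)))) \<longlonglongrightarrow> J"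
    using circle_parseval_aux[OF assms] by blast
  have nz: "complex_of_real (2 * pi) \<noteq> 0" by simp
  have "(\<lambda>n. inverse (complex_of_real (2 * pi)) * (of_real (2 * pi) * (\<Sum>m<n. a m * cnj (h m) * of_real (r ^ (2 * m))))) \<longlonglongrightarrow> inverse (of_real (2*pi)) * J"
    by (intro tendsto_intros J(2))
  then have "(\<lambda>m. a m * cnj (h m) * of_real (r ^ (2 * m))) sums (inverse (of_real (2*pi)) * J)"
    unfolding sums_def mult.assoc[of "inverse (complex_of_real (2 * pi))", symmetric] left_inverse[OF nz] mult_1_left .
  then have S: "summable (\<lambda>m. a m * cnj (h m) * of_real (r ^ (2 * m)))"
    "(\<Sum>m. a m * cnj (h m) * of_real (r ^ (2 * m))) = inverse (complex_of_real (2*pi)) * J"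
    by (rule sums_summable, rule sums_unique[symmetric])
  show "summable (\<lambda>m. a m * cnj (h m) * of_real (r ^ (2 * m)))" by (rule S(1))
  have "of_real (2 * pi) * (\<Sum>m. a m * cnj (h m) * of_real (r ^ (2 * m))) = J"
    unfolding S(2) mult.assoc[symmetric] right_inverse[OF nz] by (rule mult_1_left)
  then show "((\<lambda>t. power_series a (of_real r * cis t) * cnj (power_series h (of_real r * cis t))) has_integral
       of_real (2 * pi) * (\<Sum>m. a m * cnj (h m) * of_real (r ^ (2 * m)))) {0..2*pi}"
    using J(1) by (simp only:)
qed

lemma circle_parseval_norm:
  assumes "summable (\<lambda>m. cmod (a m) * r ^ m)" "0 \<le> r"
  shows "summable (\<lambda>m. (cmod (a m))\<^sup>2 * r ^ (2 * m))"
    and "((\<lambda>t. (cmod (power_series a (of_real r * cis t)))\<^sup>2) has_integral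
       2 * pi * (\<Sum>m. (cmod (a m))\<^sup>2 * r ^ (2 * m))) {0..2*pi}"
proof -
  have eq: "a m * cnj (a m) * of_real (r ^ (2 * m)) = complex_of_real ((cmod (a m))\<^sup>2 * r ^ (2 * m))" for m
    by (simp add: complex_norm_square[symmetric] del: of_real_power)
  have s: "summable (\<lambda>m. complex_of_real ((cmod (a m))\<^sup>2 * r ^ (2 * m)))"
    using circle_parseval(1)[OF assms(1) assms(1) assms(2)] unfolding eq .
  then show s': "summable (\<lambda>m. (cmod (a m))\<^sup>2 * r ^ (2 * m))"
    using summable_Re[OF s] by simp
  have "((\<lambda>t. Re (power_series a (of_real r * cis t) * cnj (power_series a (of_real r * cis t)))) has_integral
     Re (of_real (2 * pi) * (\<Sum>m. a m * cnj (a m) * of_real (r ^ (2 * m))))) {0..2*pi}"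
    using has_integral_linear[OF circle_parseval(2)[OF assms(1) assms(1) assms(2)] bounded_linear_Re] by (simp add: o_def)
  then show "((\<lambda>t. (cmod (power_series a (of_real r * cis t)))\<^sup>2) has_integral
       2 * pi * (\<Sum>m. (cmod (a m))\<^sup>2 * r ^ (2 * m))) {0..2*pi}"
    unfolding eq complex_norm_square[symmetric] Re_complex_of_real suminf_of_real[OF s', symmetric]
      of_real_mult[symmetric] .
qed

definition taylor_coeff :: "(complex \<Rightarrow> complex) \<Rightarrow> nat \<Rightarrow> complex" where
  "taylor_coeff f m = (deriv ^^ m) f 0 / fact m"

lemma taylor_coeff_sums: "f holomorphic_on \<D> \<Longrightarrow> z \<in> \<D> \<Longrightarrow> (\<lambda>m. taylor_coeff f m * z ^ m) sums f z"
  using holomorphic_power_series[of f 0 1 z] by (simp add: taylor_coeff_def)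

lemma taylor_coeff_psum: "f holomorphic_on \<D> \<Longrightarrow> z \<in> \<D> \<Longrightarrow> power_series (taylor_coeff f) z = f z"
  unfolding power_series_def using taylor_coeff_sums by (simp add: sums_iff)

lemma taylor_coeff_summable:
  assumes "f holomorphic_on \<D>" "0 \<le> r" "r < 1"
  shows "summable (\<lambda>m. cmod (taylor_coeff f m) * r ^ m)"
proof -
  obtain s where s: "r < s" "s < 1" using assms(3) dense by blast
  have "summable (\<lambda>m. taylor_coeff f m * (of_real s) ^ m)"
    using taylor_coeff_sums[OF assms(1), of "of_real s"] s assms(2) by (auto simp: sums_iff)
  then have "summable (\<lambda>m. norm (taylor_coeff f m * (of_real r) ^ m))"
    by (rule powser_insidea) (use s assms(2) in auto)
  then show ?thesis using assms(2) by (simp add: norm_mult norm_power)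
qed

lemma taylor_coeff_unique:
  assumes f: "f holomorphic_on \<D>" and a: "\<And>z. z \<in> \<D> \<Longrightarrow> (\<lambda>m. a m * z ^ m) sums f z"
  shows "taylor_coeff f = a"
proof
  fix m
  have "fps_conv_radius (Abs_fps a) \<ge> 1"
    unfolding fps_conv_radius_def
  proof (rule conv_radius_geI_ex)
    fix r :: real assume "0 < r" "ereal r < 1"
    then show "\<exists>z. norm z = r \<and> summable (\<lambda>n. fps_nth (Abs_fps a) n * z ^ n)"
      using a[of "of_real r"] by (intro exI[of _ "of_real r"]) (auto simp: sums_iff)
  qed
  then have "f has_fps_expansion Abs_fps a"
    unfolding has_fps_expansion_def
  proof (intro conjI)
    have "\<forall>\<^sub>F z in nhds 0. z \<in> \<D>" by (intro eventually_nhds_in_open) auto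
    then show "\<forall>\<^sub>F z in nhds 0. eval_fps (Abs_fps a) z = f z"
      by (rule eventually_mono) (use a in \<open>auto simp: eval_fps_def sums_iff\<close>)
    show "0 < fps_conv_radius (Abs_fps a)" 
      by (rule less_le_trans[OF _ \<open>fps_conv_radius (Abs_fps a) \<ge> 1\<close>]) simp
  qed
  then have "fps_expansion f 0 = Abs_fps a" by (rule fps_expansion_eqI)
  then have "fps_nth (fps_expansion f 0) m = a m" by simp
  then show "taylor_coeff f m = a m" unfolding taylor_coeff_def fps_expansion_def by simp
qed

lemma bounded_series_mono:
  fixes x :: "nat \<Rightarrow> real"
  assumes nn: "\<And>m. 0 \<le> x m" and le: "\<And>r. 0 \<le> r \<Longrightarrow> r < 1 \<Longrightarrow> (\<Sum>m<n. x m * r ^ (2 * m)) \<le> M"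
  shows "(\<Sum>m<n. x m) \<le> M"
proof (rule tendsto_upperbound)
  show "((\<lambda>r. \<Sum>m<n. x m * r ^ (2 * m)) \<longlongrightarrow> (\<Sum>m<n. x m)) (at_left (1::real))"
    by (auto intro!: tendsto_eq_intros)
  show "\<forall>\<^sub>F r in at_left 1. (\<Sum>m<n. x m * r ^ (2 * m)) \<le> M"
    using eventually_at_left_real[of 0 1] by (rule eventually_mono[OF _ le]) auto
qed auto

text \<open>On each circle the mean square can only shrink under multiplication by \<open>b\<close>;
  the radius then tends to 1 in finite partial sums.\<close>

lemma mult_contraction:
  assumes b: "b holomorphic_on \<D>" "\<And>z. z \<in> \<D> \<Longrightarrow> cmod (b z) \<le> 1" and Y: "Y holomorphic_on \<D>" "square_summable (taylor_coeff Y)"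
  shows "square_summable (taylor_coeff (\<lambda>z. b z * Y z))" "(\<Sum>m. (cmod (taylor_coeff (\<lambda>z. b z * Y z) m))\<^sup>2) \<le> (\<Sum>m. (cmod (taylor_coeff Y m))\<^sup>2)"
proof -
  have bY: "(\<lambda>z. b z * Y z) holomorphic_on \<D>" by (intro holomorphic_intros b Y)
  have "(\<Sum>m<n. (cmod (taylor_coeff (\<lambda>z. b z * Y z) m))\<^sup>2) \<le> (\<Sum>m. (cmod (taylor_coeff Y m))\<^sup>2)" for n
  proof (rule bounded_series_mono)
    fix r :: real assume r: "0 \<le> r" "r < 1"
    have in_D: "of_real r * cis t \<in> \<D>" for t using r by (simp add: norm_mult)
    note P1 = circle_parseval_norm[OF taylor_coeff_summable[OF bY r] r(1)] 
    note P2 = circle_parseval_norm[OF taylor_coeff_summable[OF Y(1) r] r(1)]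
    have "(\<Sum>m<n. (cmod (taylor_coeff (\<lambda>z. b z * Y z) m))\<^sup>2 * r ^ (2 * m)) \<le> (\<Sum>m. (cmod (taylor_coeff (\<lambda>z. b z * Y z) m))\<^sup>2 * r ^ (2 * m))"
      using r by (intro sum_le_suminf P1(1)) auto
    also have "2 * pi * (\<Sum>m. (cmod (taylor_coeff (\<lambda>z. b z * Y z) m))\<^sup>2 * r ^ (2 * m)) \<le> 2 * pi * (\<Sum>m. (cmod (taylor_coeff Y m))\<^sup>2 * r ^ (2 * m))"
    proof (rule has_integral_le[OF P1(2) P2(2)])
      fix t
      have "cmod (b (of_real r * cis t)) * cmod (Y (of_real r * cis t)) \<le> 1 * cmod (Y (of_real r * cis t))"
        by (intro mult_right_mono b(2) in_D) auto
      then show "(cmod (power_series (taylor_coeff (\<lambda>z. b z * Y z)) (of_real r * cis t)))\<^sup>2 \<le> (cmod (power_series (taylor_coeff Y) (of_real r * cis t)))\<^sup>2"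
        unfolding taylor_coeff_psum[OF bY in_D] taylor_coeff_psum[OF Y(1) in_D] norm_mult by (intro power_mono) auto
    qed
    then have "(\<Sum>m. (cmod (taylor_coeff (\<lambda>z. b z * Y z) m))\<^sup>2 * r ^ (2 * m)) \<le> (\<Sum>m. (cmod (taylor_coeff Y m))\<^sup>2 * r ^ (2 * m))" by simp
    also have "\<dots> \<le> (\<Sum>m. (cmod (taylor_coeff Y m))\<^sup>2)"
    proof (rule suminf_le[OF _ P2(1)])
      show "summable (\<lambda>m. (cmod (taylor_coeff Y m))\<^sup>2)" using Y(2) by (simp add: square_summable_def)
      fix m show "(cmod (taylor_coeff Y m))\<^sup>2 * r ^ (2 * m) \<le> (cmod (taylor_coeff Y m))\<^sup>2"
        using r by (intro mult_left_le power_le_one) auto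
    qed
    finally show "(\<Sum>m<n. (cmod (taylor_coeff (\<lambda>z. b z * Y z) m))\<^sup>2 * r ^ (2 * m)) \<le> (\<Sum>m. (cmod (taylor_coeff Y m))\<^sup>2)" .
  qed simp
  then show "square_summable (taylor_coeff (\<lambda>z. b z * Y z))" "(\<Sum>m. (cmod (taylor_coeff (\<lambda>z. b z * Y z) m))\<^sup>2) \<le> (\<Sum>m. (cmod (taylor_coeff Y m))\<^sup>2)"
    by (rule square_summable_bounded_sums)+
qed


subsection \<open>De Branges--Rovnyak spaces\<close>

text \<open>Taylor coefficients of the combination of Szegoe kernels 1 / (1 - cnj (p i) z) with
  weights \<open>c i\<close>. The points form an indexed family and may coincide.\<close>

definition szego_coeff :: "'i set \<Rightarrow> ('i \<Rightarrow> complex) \<Rightarrow> ('i \<Rightarrow> complex) \<Rightarrow> nat \<Rightarrow> complex" where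
  "szego_coeff I p c m = (\<Sum>i\<in>I. c i * cnj (p i) ^ m)"

lemma square_summable_sum: "finite I \<Longrightarrow> (\<And>i. i \<in> I \<Longrightarrow> square_summable (f i)) \<Longrightarrow> square_summable (\<lambda>m. \<Sum>i\<in>I. f i m)"
proof (induction I rule: finite_induct)
  case empty then show ?case by (simp add: square_summable_def)
next
  case (insert a I)
  then show ?case using square_summable_add[of "f a" "\<lambda>m. \<Sum>i\<in>I. f i m"] by simp
qed

lemma square_summable_geometric: "cmod z < 1 \<Longrightarrow> square_summable (\<lambda>m. z ^ m)"
  unfolding square_summable_def norm_power power_mult[symmetric]
  by (subst mult.commute) (simp add: power_mult summable_geometric power_less_one_iff)

lemma szego_coeff_l2: "finite I \<Longrightarrow> p ` I \<subseteq> \<D> \<Longrightarrow> square_summable (szego_coeff I p c)"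
  unfolding szego_coeff_def[abs_def] by (rule square_summable_sum) (auto intro!: square_summable_scale square_summable_geometric)

text \<open>The reproducing property of the Szegoe kernel in H^2, with \<open>a\<close> the Taylor
  coefficients of \<open>f\<close>.\<close>

lemma szego_coeff_eval:
  assumes "finite I" "p ` I \<subseteq> \<D>" "\<And>z. z \<in> \<D> \<Longrightarrow> (\<lambda>m. a m * z ^ m) sums f z"
  shows "(\<lambda>m. a m * cnj (szego_coeff I p c m)) sums (\<Sum>i\<in>I. cnj (c i) * f (p i))"
proof -
  have "(\<lambda>m. \<Sum>i\<in>I. cnj (c i) * (a m * p i ^ m)) sums (\<Sum>i\<in>I. cnj (c i) * f (p i))"
    by (rule sums_sum) (use assms in \<open>auto intro!: sums_mult\<close>)
  then show ?thesis by (simp add: szego_coeff_def sum_distrib_left mult_ac)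
qed

lemma disc_denom: "z \<in> \<D> \<Longrightarrow> l \<in> \<D> \<Longrightarrow> 1 - cnj l * z \<noteq> 0"
proof
  assume "z \<in> \<D>" "l \<in> \<D>" "1 - cnj l * z = 0"
  then have "cmod l * cmod z = 1" by (metis complex_mod_cnj eq_iff_diff_eq_0 norm_mult norm_one)
  moreover have "cmod l * cmod z \<le> 1 * cmod z" using \<open>l \<in> \<D>\<close> by (intro mult_right_mono) auto
  ultimately show False using \<open>z \<in> \<D>\<close> by simp
qed

definition szego_comb :: "'i set \<Rightarrow> ('i \<Rightarrow> complex) \<Rightarrow> ('i \<Rightarrow> complex) \<Rightarrow> complex \<Rightarrow> complex" where
  "szego_comb I p c z = (\<Sum>i\<in>I. c i / (1 - cnj (p i) * z))"

lemma szego_comb_sums: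
  assumes "finite I" "p ` I \<subseteq> \<D>" "z \<in> \<D>"
  shows "(\<lambda>m. szego_coeff I p c m * z ^ m) sums szego_comb I p c z"
proof -
  have "(\<lambda>m. c i * (cnj (p i) * z) ^ m) sums (c i * (1 / (1 - cnj (p i) * z)))" if "i \<in> I" for i
  proof (intro sums_mult geometric_sums)
    have "cmod (p i) * cmod z \<le> 1 * cmod z" using that assms(2) by (intro mult_right_mono) auto
    then show "cmod (cnj (p i) * z) < 1" using assms(3) by (simp add: norm_mult)
  qed
  then have "(\<lambda>m. \<Sum>i\<in>I. c i * (cnj (p i) * z) ^ m) sums (\<Sum>i\<in>I. c i * (1 / (1 - cnj (p i) * z)))"
    by (rule sums_sum)
  then show ?thesis by (simp add: szego_coeff_def szego_comb_def sum_distrib_left power_mult_distrib mult_ac)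
qed

lemma szego_comb_hol: "finite I \<Longrightarrow> p ` I \<subseteq> \<D> \<Longrightarrow> szego_comb I p c holomorphic_on \<D>"
  unfolding szego_comb_def[abs_def] by (intro holomorphic_intros) (use disc_denom in auto)

lemma szego_comb_tc: "finite I \<Longrightarrow> p ` I \<subseteq> \<D> \<Longrightarrow> taylor_coeff (szego_comb I p c) = szego_coeff I p c"
  by (intro taylor_coeff_unique szego_comb_hol szego_comb_sums)

lemma szego_coeff_form:
  assumes "finite I" "p ` I \<subseteq> \<D>"
  shows "(\<Sum>i\<in>I. \<Sum>j\<in>I. cnj (c i) * (1 / (1 - cnj (p j) * p i)) * c j) = of_real (\<Sum>m. (cmod (szego_coeff I p c m))\<^sup>2)"
proof -
  have "(\<lambda>m. szego_coeff I p c m * cnj (szego_coeff I p c m)) sums (\<Sum>i\<in>I. cnj (c i) * szego_comb I p c (p i))"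
    by (rule szego_coeff_eval[OF assms szego_comb_sums[OF assms]])
  moreover have "(\<lambda>m. of_real ((cmod (szego_coeff I p c m))\<^sup>2)) sums complex_of_real (\<Sum>m. (cmod (szego_coeff I p c m))\<^sup>2)"
    by (intro sums_of_real summable_sums) (use szego_coeff_l2[OF assms, of c] in \<open>simp add: square_summable_def\<close>)
  ultimately have "(\<Sum>i\<in>I. cnj (c i) * szego_comb I p c (p i)) = of_real (\<Sum>m. (cmod (szego_coeff I p c m))\<^sup>2)"
    unfolding complex_norm_square by (rule sums_unique2)
  then show ?thesis by (simp add: szego_comb_def sum_distrib_left)
qed

text \<open>The kernel of H(b) is the Szegoe kernel minus its copy weighted by \<open>b\<close>. So
  the form is ||g||^2 - ||T g||^2, where T multiplies the weight at \<open>p i\<close> by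
  \<open>cnj (b (p i))\<close>.\<close>

lemma dBR_form:
  assumes "finite I" "p ` I \<subseteq> \<D>"
  shows "(\<Sum>i\<in>I. \<Sum>j\<in>I. cnj (c i) * dBR_kernel b (p i) (p j) * c j) =
    of_real ((\<Sum>m. (cmod (szego_coeff I p c m))\<^sup>2) - (\<Sum>m. (cmod (szego_coeff I p (\<lambda>i. c i * cnj (b (p i))) m))\<^sup>2))"
  unfolding of_real_diff szego_coeff_form[OF assms, symmetric] sum_subtractf[symmetric] dBR_kernel_def
  by (intro sum.cong refl) (simp add: algebra_simps diff_divide_distrib)

lemma square_summable_inner_le:
  assumes "square_summable a" "square_summable x"
  shows "(cmod (\<Sum>m. a m * cnj (x m)))\<^sup>2 \<le> (\<Sum>m. (cmod (a m))\<^sup>2) * (\<Sum>m. (cmod (x m))\<^sup>2)"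
proof -
  have nn: "0 \<le> (\<Sum>m. (cmod (a m))\<^sup>2)" "0 \<le> (\<Sum>m. (cmod (x m))\<^sup>2)"
    using assms unfolding square_summable_def by (auto intro!: suminf_nonneg)
  have "(cmod (\<Sum>m. a m * cnj (x m)))\<^sup>2 \<le> (sqrt (\<Sum>m. (cmod (a m))\<^sup>2) * sqrt (\<Sum>m. (cmod (x m))\<^sup>2))\<^sup>2"
    using square_summable_cauchy_schwarz[OF assms(1) square_summable_cnj[OF assms(2)]] by (intro power_mono) auto
  then show ?thesis using nn by (simp add: power_mult_distrib)
qed

text \<open>With g the combination with weights \<open>c\<close> and Y = T g, the reproducing
  property gives ||Y||^2 = <b Y, g>. As multiplication by \<open>b\<close> is a contraction, this is
  at most ||Y|| ||g||.\<close>

lemma szego_coeff_contraction: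
  assumes b: "b holomorphic_on \<D>" "b ` \<D> \<subseteq> \<D>" and I: "finite I" "p ` I \<subseteq> \<D>"
  shows "(\<Sum>m. (cmod (szego_coeff I p (\<lambda>i. c i * cnj (b (p i))) m))\<^sup>2) \<le> (\<Sum>m. (cmod (szego_coeff I p c m))\<^sup>2)"
proof -
  define d where "d = (\<lambda>i. c i * cnj (b (p i)))"
  define Y where "Y = szego_comb I p d"
  define S where "S = (\<Sum>m. (cmod (szego_coeff I p d m))\<^sup>2)"
  define T where "T = (\<Sum>m. (cmod (szego_coeff I p c m))\<^sup>2)"
  have Y: "Y holomorphic_on \<D>" "taylor_coeff Y = szego_coeff I p d" unfolding Y_def by (rule szego_comb_hol[OF I], rule szego_comb_tc[OF I])
  have l2Y: "square_summable (taylor_coeff Y)" unfolding Y(2) by (rule szego_coeff_l2[OF I])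
  have b1: "cmod (b z) \<le> 1" if "z \<in> \<D>" for z using b(2) that by (auto simp: image_subset_iff less_imp_le)
  have bY: "(\<lambda>z. b z * Y z) holomorphic_on \<D>" by (intro holomorphic_intros b Y)
  note contr = mult_contraction[OF b(1) b1 Y(1) l2Y]
  have nn: "0 \<le> S" "0 \<le> T" unfolding S_def T_def
    using szego_coeff_l2[OF I] unfolding square_summable_def by (auto intro!: suminf_nonneg)
  have "of_real S = (\<Sum>i\<in>I. cnj (d i) * Y (p i))"
    unfolding S_def szego_coeff_form[OF I, symmetric] Y_def szego_comb_def by (simp add: sum_distrib_left)
  also have "\<dots> = (\<Sum>i\<in>I. cnj (c i) * (b (p i) * Y (p i)))" by (simp add: d_def mult.assoc)
  also have "\<dots> = (\<Sum>m. taylor_coeff (\<lambda>z. b z * Y z) m * cnj (szego_coeff I p c m))"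
    by (rule sums_unique[OF szego_coeff_eval[OF I taylor_coeff_sums[OF bY]]])
  finally have "S\<^sup>2 = (cmod (\<Sum>m. taylor_coeff (\<lambda>z. b z * Y z) m * cnj (szego_coeff I p c m)))\<^sup>2"
    by (metis norm_of_real power2_abs)
  also have "\<dots> \<le> (\<Sum>m. (cmod (taylor_coeff (\<lambda>z. b z * Y z) m))\<^sup>2) * T"
    unfolding T_def by (rule square_summable_inner_le[OF contr(1) szego_coeff_l2[OF I]])
  also have "\<dots> \<le> S * T" using contr(2) nn(2) unfolding Y(2) S_def[symmetric] by (rule mult_right_mono)
  finally have "S * S \<le> S * T" by (simp add: power2_eq_square)
  then have "S \<le> T" using nn by (cases "S = 0") auto
  then show ?thesis by (simp add: S_def T_def d_def)
qed

lemma dBR_disc_kernel: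
  assumes b: "b holomorphic_on \<D>" "b ` \<D> \<subseteq> \<D>"
  shows "disc_kernel (dBR_kernel b)"
proof
  show "psd_on \<D> (dBR_kernel b)" unfolding psd_on_def
  proof (intro conjI ballI allI impI)
    fix z l :: complex
    show "dBR_kernel b z l = cnj (dBR_kernel b l z)" by (simp add: dBR_kernel_def mult.commute)
  next
    fix S :: "complex set" and c :: "complex \<Rightarrow> complex"
    assume S: "finite S" "S \<subseteq> \<D>"
    show "0 \<le> Re (\<Sum>z\<in>S. \<Sum>l\<in>S. cnj (c z) * dBR_kernel b z l * c l)"
      using dBR_form[of S "\<lambda>z. z" c b] szego_coeff_contraction[OF b, of S "\<lambda>z. z" c] S by simp
  qed
  show "(\<lambda>z. dBR_kernel b z l) holomorphic_on \<D>" if "l \<in> \<D>" for l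
    unfolding dBR_kernel_def by (intro holomorphic_intros b) (use disc_denom that in auto)
  fix r :: real assume r: "r < 1"
  have "Re (dBR_kernel b z z) \<le> 2 / (1 - r)" if z: "z \<in> cball 0 r" for z
  proof -
    have z1: "cmod z < 1" using z r by simp
    have bz: "cmod (b z) \<le> 1" using b(2) z1 by (auto simp: image_subset_iff less_imp_le)
    have "cmod z * cmod z \<le> 1 * cmod z" using z1 by (intro mult_right_mono) auto
    moreover have "cmod (1 - cnj z * z) \<ge> 1 - cmod z * cmod z"
      using norm_triangle_ineq2[of 1 "cnj z * z"] by (simp add: norm_mult)
    ultimately have d: "cmod (1 - cnj z * z) \<ge> 1 - r" using z by simp
    have n: "cmod (1 - cnj (b z) * b z) \<le> 2"
      using norm_triangle_ineq4[of 1 "cnj (b z) * b z"] mult_mono[OF bz bz] by (simp add: norm_mult)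
    have "Re (dBR_kernel b z z) \<le> cmod (1 - cnj (b z) * b z) / cmod (1 - cnj z * z)"
      using complex_Re_le_cmod[of "dBR_kernel b z z"] unfolding dBR_kernel_def norm_divide .
    also have "\<dots> \<le> 2 / (1 - r)" by (rule frac_le) (use n d r in auto)
    finally show ?thesis .
  qed
  then show "\<exists>M. \<forall>z\<in>cball 0 r. Re (dBR_kernel b z z) \<le> M" by blast
qed

theorem dBR_rkhs:
  assumes "b holomorphic_on \<D>" "b ` \<D> \<subseteq> \<D>"
  obtains ip where "disc_rkhs (dBR_kernel b) (dBR b) ip"
  using disc_kernel.rkhs_the[OF dBR_disc_kernel[OF assms]] unfolding dBR_def[symmetric] by blast

section \<open>The pairing inequality in H(b)\<close>

lemma roots_orth:
  assumes "m < n" "k < n"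
  shows "(\<Sum>j<n. cis (2 * pi * real j / real n) ^ m * cnj (cis (2 * pi * real j / real n)) ^ k) = (if m = k then of_nat n else 0)"
proof -
  define w where "w = cis (2 * pi * (real m - real k) / real n)"
  have n: "n > 0" using assms by simp
  have tm: "cis (2 * pi * real j / real n) ^ m * cnj (cis (2 * pi * real j / real n)) ^ k = w ^ j" for j
    unfolding w_def cis_cnj Complex.DeMoivre cis_mult by (rule arg_cong[of _ _ cis]) (use n in \<open>simp add: field_simps\<close>)
  show ?thesis
  proof (cases "m = k")
    case True
    then show ?thesis unfolding tm by (simp add: w_def)
  next
    case False
    have wn: "w ^ n = 1"
    proof -
      have "w ^ n = cis (2 * pi * of_int (int m - int k))" unfolding w_def Complex.DeMoivre using n by simp
      also have "\<dots> = 1" by (simp add: cis_multiple_2pi)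
      finally show ?thesis .
    qed
    have w1: "w \<noteq> 1"
    proof
      assume "w = 1"
      then have "cos (2 * pi * (real m - real k) / real n) = 1" unfolding w_def by (metis cis.sel(1) one_complex.sel(1))
      then obtain x :: int where x: "2 * pi * (real m - real k) / real n = of_int x * 2 * pi"
        unfolding cos_one_2pi_int by blast
      then have "2 * pi * (real m - real k) = 2 * pi * (of_int x * real n)" using n by (simp add: field_simps)
      then have "real m - real k = of_int x * real n" by (simp only: mult_cancel_left) simp
      then have "real_of_int (int m - int k) = of_int (x * int n)" by simp
      then have eq: "int m - int k = x * int n" by (simp only: of_int_eq_iff)
      have "\<bar>int m - int k\<bar> < int n" using assms by linarith
      then have "\<bar>x\<bar> * int n < 1 * int n" unfolding eq by (simp add: abs_mult)
      then have "x = 0" using n by (simp only: mult_less_cancel_right) auto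
      then show False using eq False by simp
    qed
    show ?thesis unfolding tm using False w1 wn by (simp add: geometric_sum)
  qed
qed

text \<open>A polynomial is not a finite combination of Szegoe kernels, so the argument runs for
  combinations g of \<open>n\<close> kernels whose coefficients agree with \<open>q\<close> below
  index \<open>n\<close>; all quantities then converge by Tannery's theorem.\<close>

lemma dBR_pairing:
  assumes b: "b holomorphic_on \<D>" "b ` \<D> \<subseteq> \<D>" and rk: "disc_rkhs (dBR_kernel b) H ip" and f: "f \<in> H"
    and q: "\<And>m. d \<le> m \<Longrightarrow> q m = 0" and p: "p holomorphic_on \<D>" "square_summable (taylor_coeff p)"
    and bp: "\<And>z. z \<in> \<D> \<Longrightarrow> b z * p z = (\<Sum>m<d. q m * z ^ m)"
  shows "(cmod (\<Sum>m<d. taylor_coeff f m * cnj (q m)))\<^sup>2 \<le> Re (ip f f) * ((\<Sum>m. (cmod (taylor_coeff p m))\<^sup>2) - (\<Sum>m<d. (cmod (q m))\<^sup>2))"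
proof -
  interpret disc_rkhs "dBR_kernel b" H ip by (rule rk)
  have fhol: "f holomorphic_on \<D>" using holomorphic f by (auto simp: hol_disc_def)
  define P where "P = (\<Sum>m. (cmod (taylor_coeff p m))\<^sup>2)"
  define R where "R = (\<Sum>m<d. (cmod (q m))\<^sup>2)"
  define F where "F = Re (ip f f)"
  define om where "om n j = cis (2 * pi * real j / real n)" for n j :: nat
  define Q where "Q z = (\<Sum>m<d. q m * z ^ m)" for z
  \<comment> \<open>Roots of unity scaled to radius 1/2. The weights \<open>c\<close> evaluate Q at
    radius 2, which compensates the scaling, so the discrete Fourier transform returns
    \<open>q\<close> exactly below index \<open>n\<close>; the radius supplies the factor (1/2)^k
    that dominates the limits.\<close>
  define pt where "pt n j = om n j / 2" for n j
  define c where "c n j = Q (2 * om n j) / of_nat n" for n j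
  define x where "x n = szego_coeff {..<n} (pt n) (c n)" for n
  define C where "C = (\<Sum>m<d. cmod (q m) * 2 ^ m)"
  have C0: "0 \<le> C" unfolding C_def by (intro sum_nonneg) auto
  have I: "finite {..<n}" "pt n ` {..<n} \<subseteq> \<D>" for n by (auto simp: pt_def om_def norm_divide)
  have om1: "cmod (om n j) = 1" for n j by (simp add: om_def)
  have Qb: "cmod (Q (2 * om n j)) \<le> C" for n j
    unfolding Q_def C_def by (rule order_trans[OF norm_sum]) (simp add: norm_mult norm_power om1)
  have xb: "cmod (x n k) \<le> C * (1/2) ^ k" for n k
  proof (cases "n = 0")
    case True then show ?thesis using C0 by (simp add: x_def szego_coeff_def)
  next
    case False
    have "cmod (x n k) \<le> (\<Sum>j<n. C / n * (1/2) ^ k)"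
      unfolding x_def szego_coeff_def
    proof (rule sum_norm_le)
      fix j
      have "cmod (c n j * cnj (pt n j) ^ k) = cmod (Q (2 * om n j)) / n * (1/2) ^ k"
        by (simp add: c_def pt_def norm_mult norm_divide norm_power om1 power_divide)
      also have "\<dots> \<le> C / n * (1/2) ^ k" by (intro mult_right_mono divide_right_mono Qb) auto
      finally show "cmod (c n j * cnj (pt n j) ^ k) \<le> C / n * (1/2) ^ k" .
    qed
    then show ?thesis using False by simp
  qed
  have xe: "x n k = q k" if "k < n" "d \<le> n" for n k
  proof -
    have n: "n > 0" using that by simp
    have "x n k = (\<Sum>j<n. \<Sum>m<d. q m * 2 ^ m / 2 ^ k / of_nat n * (om n j ^ m * cnj (om n j) ^ k))"
      unfolding x_def szego_coeff_def c_def Q_def pt_def sum_divide_distrib sum_distrib_right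
      by (intro sum.cong refl) (simp add: power_mult_distrib power_divide mult_ac)
    also have "\<dots> = (\<Sum>m<d. \<Sum>j<n. q m * 2 ^ m / 2 ^ k / of_nat n * (om n j ^ m * cnj (om n j) ^ k))"
      by (rule sum.swap)
    also have "\<dots> = (\<Sum>m<d. q m * 2 ^ m / 2 ^ k / of_nat n * (if m = k then of_nat n else 0))"
      unfolding sum_distrib_left[symmetric] om_def
      by (intro sum.cong refl arg_cong2[of _ _ _ _ "(*)"] roots_orth) (use that in auto)
    also have "\<dots> = (\<Sum>m<d. if m = k then q k else 0)" using n by (intro sum.cong refl) auto
    also have "\<dots> = q k" using q[of k] by (auto simp: not_less)
    finally show ?thesis .
  qed
  have xlim: "(\<lambda>n. x n k) \<longlonglongrightarrow> q k" for k
    by (rule tendsto_eventually) (use xe in \<open>auto simp: eventually_sequentially intro!: exI[of _ "Suc (max k d)"]\<close>)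
  have tann: "(\<lambda>n. \<Sum>m. a m * cnj (x n m)) \<longlonglongrightarrow> (\<Sum>m<d. a m * cnj (q m))"
    if a: "summable (\<lambda>m. cmod (a m) * (1/2) ^ m)" for a
  proof -
    have "(\<lambda>n. \<Sum>m. a m * cnj (x n m)) \<longlonglongrightarrow> (\<Sum>m. a m * cnj (q m))"
    proof (rule tannerys_theorem[THEN conjunct2, THEN conjunct2])
      show "(\<lambda>n. a k * cnj (x n k)) \<longlonglongrightarrow> a k * cnj (q k)" for k by (intro tendsto_intros xlim)
      show "\<forall>\<^sub>F (k, n) in sequentially \<times>\<^sub>F sequentially. norm (a k * cnj (x n k)) \<le> C * (cmod (a k) * (1/2) ^ k)"
      proof (rule always_eventually, clarify)
        fix k n
        have "cmod (a k) * cmod (x n k) \<le> cmod (a k) * (C * (1/2) ^ k)" by (intro mult_left_mono xb) auto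
        then show "norm (a k * cnj (x n k)) \<le> C * (cmod (a k) * (1/2) ^ k)" by (simp add: norm_mult mult_ac)
      qed
      show "summable (\<lambda>k. C * (cmod (a k) * (1/2) ^ k))" by (rule summable_mult[OF a])
    qed simp
    also have "(\<Sum>m. a m * cnj (q m)) = (\<Sum>m<d. a m * cnj (q m))"
      by (rule suminf_finite) (use q in auto)
    finally show ?thesis .
  qed
  define X where "X n = (\<Sum>m. (cmod (x n m))\<^sup>2)" for n
  define A where "A n = (cmod (\<Sum>m. taylor_coeff f m * cnj (x n m)))\<^sup>2" for n
  define B where "B n = (cmod (\<Sum>m. q m * cnj (x n m)))\<^sup>2" for n
  have Alim: "A \<longlonglongrightarrow> (cmod (\<Sum>m<d. taylor_coeff f m * cnj (q m)))\<^sup>2"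
    unfolding A_def by (intro tendsto_intros tann taylor_coeff_summable[OF fhol]) auto
  have Blim: "B \<longlonglongrightarrow> R\<^sup>2"
  proof -
    have "summable (\<lambda>m. cmod (q m) * (1/2) ^ m)" by (rule summable_finite[of "{..<d}"]) (use q in auto)
    from tann[OF this] have "B \<longlonglongrightarrow> (cmod (\<Sum>m<d. q m * cnj (q m)))\<^sup>2"
      unfolding B_def by (intro tendsto_intros)
    also have "(\<Sum>m<d. q m * cnj (q m)) = of_real R"
      unfolding R_def of_real_sum complex_norm_square ..
    finally show ?thesis by simp
  qed
  have Xlim: "X \<longlonglongrightarrow> R"
  proof -
    have "X \<longlonglongrightarrow> (\<Sum>m. (cmod (q m))\<^sup>2)" unfolding X_def
    proof (rule tannerys_theorem[THEN conjunct2, THEN conjunct2])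
      show "(\<lambda>n. (cmod (x n k))\<^sup>2) \<longlonglongrightarrow> (cmod (q k))\<^sup>2" for k by (intro tendsto_intros xlim)
      show "\<forall>\<^sub>F (k, n) in sequentially \<times>\<^sub>F sequentially. norm ((cmod (x n k))\<^sup>2) \<le> C\<^sup>2 * (1/4) ^ k"
      proof (rule always_eventually, clarify)
        fix k n
        have "(cmod (x n k))\<^sup>2 \<le> (C * (1/2) ^ k)\<^sup>2" by (intro power_mono xb) auto
        also have "\<dots> = C\<^sup>2 * (1/4) ^ k"
          by (simp add: power_mult_distrib power_mult[symmetric] mult.commute[of _ 2]) (simp add: power_mult power_divide)
        finally show "norm ((cmod (x n k))\<^sup>2) \<le> C\<^sup>2 * (1/4) ^ k" by simp
      qed
      show "summable (\<lambda>k. C\<^sup>2 * (1/4::real) ^ k)" by (intro summable_mult summable_geometric) auto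
    qed simp
    also have "(\<Sum>m. (cmod (q m))\<^sup>2) = R" unfolding R_def by (rule suminf_finite) (use q in auto)
    finally show ?thesis .
  qed
  \<comment> \<open>With Y = ||T g||^2, the squared norm of g in H(b) is X - Y, and testing T g
    against \<open>p\<close> gives B <= P Y. The second bound is multiplied by P to avoid a
    division.\<close>
  have main: "A n \<le> F * X n" "A n * P \<le> F * (X n * P - B n)" for n
  proof -
    define y where "y = szego_coeff {..<n} (pt n) (\<lambda>i. c n i * cnj (b (pt n i)))"
    define Y where "Y = (\<Sum>m. (cmod (y m))\<^sup>2)"
    have l2y: "square_summable y" unfolding y_def by (rule szego_coeff_l2[OF I])
    have Y0: "0 \<le> Y" unfolding Y_def using l2y unfolding square_summable_def by (intro suminf_nonneg) auto
    define g where "g = (\<lambda>z. \<Sum>j<n. c n j * kfun (pt n j) z)"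
    have kH: "kfun (pt n j) \<in> H" if "j \<in> {..<n}" for j by (rule kernel) (use I(2)[of n] that in auto)
    have gH: "g \<in> H" unfolding g_def by (rule sum_mem[of "{..<n}" "\<lambda>j. kfun (pt n j)", OF I(1) kH])
    have ipf: "ip f g = (\<Sum>j<n. cnj (c n j) * f (pt n j))"
    proof -
      have "ip f g = (\<Sum>j<n. cnj (c n j) * ip f (kfun (pt n j)))"
        unfolding g_def by (rule ip_sum_right[of "{..<n}" "\<lambda>j. kfun (pt n j)", OF I(1) kH f])
      also have "\<dots> = (\<Sum>j<n. cnj (c n j) * f (pt n j))"
      proof (intro sum.cong refl arg_cong2[of _ _ _ _ "(*)"])
        fix j assume "j \<in> {..<n}"
        then show "ip f (kfun (pt n j)) = f (pt n j)" using I(2)[of n] by (intro reproducing[OF f, symmetric]) auto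
      qed
      finally show ?thesis .
    qed
    have "ip f g = (\<Sum>m. taylor_coeff f m * cnj (x n m))"
      unfolding ipf x_def by (rule sums_unique[OF szego_coeff_eval[OF I taylor_coeff_sums[OF fhol]]])
    then have A: "A n = (cmod (ip f g))\<^sup>2" by (simp add: A_def)
    have gg: "Re (ip g g) = X n - Y"
    proof -
      have "ip g g = (\<Sum>i<n. cnj (c n i) * ip g (kfun (pt n i)))"
        
        using ip_sum_right[of "{..<n}" "\<lambda>j. kfun (pt n j)" g "c n", OF I(1) kH gH] by (simp only: g_def[symmetric])
      also have "\<dots> = (\<Sum>i<n. \<Sum>j<n. cnj (c n i) * dBR_kernel b (pt n i) (pt n j) * c n j)"
      proof (intro sum.cong refl)
        fix i assume "i \<in> {..<n}"
        then have i: "pt n i \<in> \<D>" using I(2)[of n] by auto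
        have "ip g (kfun (pt n i)) = g (pt n i)" by (rule reproducing[OF gH i, symmetric])
        also have "\<dots> = (\<Sum>j<n. c n j * dBR_kernel b (pt n i) (pt n j))" unfolding g_def using i by simp
        finally show "cnj (c n i) * ip g (kfun (pt n i)) = (\<Sum>j<n. cnj (c n i) * dBR_kernel b (pt n i) (pt n j) * c n j)"
          by (simp add: sum_distrib_left mult_ac)
      qed
      also have "\<dots> = of_real (X n - Y)" unfolding dBR_form[OF I] X_def Y_def x_def y_def ..
      finally show ?thesis by simp
    qed
    have AF: "A n \<le> F * (X n - Y)" using cauchy_schwarz[OF f gH] unfolding A gg F_def .
    have F0: "0 \<le> F" unfolding F_def by (rule ip_ge_zero[OF f])
    have P0: "0 \<le> P" unfolding P_def using p(2) unfolding square_summable_def by (intro suminf_nonneg) auto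
    have BY: "B n \<le> P * Y"
    proof -
      have bpQ: "b z * p z = Q z" if "z \<in> \<D>" for z using bp[OF that] by (simp add: Q_def)
      have Qs: "(\<lambda>m. q m * z ^ m) sums Q z" for z
        unfolding Q_def by (rule sums_finite) (use q in auto)
      have "(\<Sum>m. q m * cnj (x n m)) = (\<Sum>j<n. cnj (c n j) * Q (pt n j))"
        unfolding x_def by (rule sums_unique[OF szego_coeff_eval[OF I Qs], symmetric])
      also have "\<dots> = (\<Sum>j<n. cnj (c n j * cnj (b (pt n j))) * p (pt n j))"
      proof (intro sum.cong refl)
        fix j assume "j \<in> {..<n}"
        then have "pt n j \<in> \<D>" using I(2)[of n] by auto
        from bpQ[OF this] show "cnj (c n j) * Q (pt n j) = cnj (c n j * cnj (b (pt n j))) * p (pt n j)" by (simp add: mult.assoc)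
      qed
      also have "\<dots> = (\<Sum>m. taylor_coeff p m * cnj (y m))"
        unfolding y_def by (rule sums_unique[OF szego_coeff_eval[OF I taylor_coeff_sums[OF p(1)]]])
      finally have "B n = (cmod (\<Sum>m. taylor_coeff p m * cnj (y m)))\<^sup>2" by (simp add: B_def)
      also have "\<dots> \<le> P * Y" unfolding P_def Y_def by (rule square_summable_inner_le[OF p(2) l2y])
      finally show ?thesis .
    qed
    have "F * (X n - Y) \<le> F * X n" using F0 Y0 by (intro mult_left_mono) auto
    with AF show "A n \<le> F * X n" by linarith
    have "A n * P \<le> F * (X n - Y) * P" by (rule mult_right_mono[OF AF P0])
    also have "\<dots> = F * (X n * P - P * Y)" by (simp add: algebra_simps)
    also have "\<dots> \<le> F * (X n * P - B n)" using BY F0 by (intro mult_left_mono) auto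
    finally show "A n * P \<le> F * (X n * P - B n)" .
  qed
  define L where "L = (cmod (\<Sum>m<d. taylor_coeff f m * cnj (q m)))\<^sup>2"
  have L1: "L \<le> F * R"
    unfolding L_def by (rule LIMSEQ_le[OF Alim tendsto_mult[OF tendsto_const Xlim]]) (use main in auto)
  have L2: "L * P \<le> F * (R * P - R\<^sup>2)"
    unfolding L_def
    by (rule LIMSEQ_le[OF tendsto_mult[OF Alim tendsto_const]
         tendsto_mult[OF tendsto_const tendsto_diff[OF tendsto_mult[OF Xlim tendsto_const] Blim]]]) (use main in auto)
  have F0: "0 \<le> F" unfolding F_def by (rule ip_ge_zero[OF f])
  have P0: "0 \<le> P" unfolding P_def using p(2) unfolding square_summable_def by (intro suminf_nonneg) auto
  have R0: "0 \<le> R" unfolding R_def by (intro sum_nonneg) auto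
  have L0: "0 \<le> L" by (simp add: L_def)
  have "L \<le> F * (P - R)"
  proof (cases "P = 0")
    case True
    show ?thesis
    proof (cases "F = 0")
      case True then show ?thesis using L1 by simp
    next
      case False
      then have "R\<^sup>2 \<le> 0" using L2 \<open>P = 0\<close> F0 by (simp add: mult_le_0_iff)
      then show ?thesis using L1 \<open>P = 0\<close> by simp
    qed
  next
    case False
    \<comment> \<open>The difference of the two sides is (P - R)^2. The sharper factor R (P - R) / P
      is exchanged for the simpler P - R.\<close>
    have "R * P - R\<^sup>2 \<le> P * (P - R)"
      using zero_le_power2[of "P - R"] by (simp add: power2_eq_square algebra_simps)
    then have "L * P \<le> F * (P * (P - R))" using L2 F0 mult_left_mono by fastforce
    then have "L * P \<le> (F * (P - R)) * P" by (simp add: mult_ac)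
    then show ?thesis using False P0 by simp
  qed
  then show ?thesis by (simp add: L_def F_def P_def R_def)
qed


subsection \<open>Outer functions with two-valued modulus\<close>

definition herglotz :: "real \<Rightarrow> complex \<Rightarrow> complex" where
  "herglotz t z = (cis t + z) / (cis t - z)"

lemma cis_ne: "z \<in> \<D> \<Longrightarrow> cis t - z \<noteq> 0"
proof
  assume "z \<in> \<D>" "cis t - z = 0"
  then have "cmod z = 1" by (metis eq_iff_diff_eq_0 norm_cis)
  then show False using \<open>z \<in> \<D>\<close> by simp
qed

text \<open>Taylor coefficients of (1 + u) / (1 - u).\<close>

definition herglotz_coeff :: "nat \<Rightarrow> complex" where "herglotz_coeff n = (if n = 0 then 1 else 2)"

lemma herglotz_sums:
  assumes "z \<in> \<D>"
  shows "(\<lambda>n. herglotz_coeff n * cis (- (real n * t)) * z ^ n) sums herglotz t z"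
proof -
  define u where "u = cis (- t) * z"
  have u: "cmod u < 1" using assms by (simp add: u_def norm_mult)
  then have "(\<lambda>n. 2 * u ^ n) sums (2 * (1 / (1 - u)))" by (intro sums_mult geometric_sums)
  moreover have "(\<lambda>n. if n = 0 then 1 else 0 :: complex) sums (\<Sum>n\<in>{0::nat}. if n = 0 then 1 else 0)"
    by (rule sums_finite) auto
  ultimately have "(\<lambda>n. 2 * u ^ n - (if n = 0 then 1 else 0)) sums (2 * (1 / (1 - u)) - (\<Sum>n\<in>{0::nat}. if n = 0 then 1 else 0))"
    by (rule sums_diff)
  moreover have "2 * u ^ n - (if n = 0 then 1 else 0) = herglotz_coeff n * cis (- (real n * t)) * z ^ n" for n
  proof -
    have "u ^ n = cis (- (real n * t)) * z ^ n" by (simp add: u_def power_mult_distrib Complex.DeMoivre)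
    then show ?thesis by (simp add: herglotz_coeff_def)
  qed
  moreover have "2 * (1 / (1 - u)) - (\<Sum>n\<in>{0::nat}. if n = 0 then 1 else 0) = herglotz t z"
  proof -
    have u1: "1 - u \<noteq> 0" using u by auto
    have c: "cis t * u = z" by (simp add: u_def mult.assoc[symmetric] cis_mult)
    have "herglotz t z = (cis t * (1 + u)) / (cis t * (1 - u))"
      unfolding herglotz_def by (simp add: c distrib_left right_diff_distrib)
    also have "\<dots> = (1 + u) / (1 - u)" by simp
    also have "\<dots> = 2 * (1 / (1 - u)) - 1" using u1 by (simp add: field_simps)
    finally show ?thesis by simp
  qed
  ultimately show ?thesis by simp
qed

text \<open>The real part is the Poisson kernel (1 - |z|^2) / |cis t - z|^2, whose denominator is at
  most 4.\<close>

lemma Re_herglotz: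
  assumes "z \<in> \<D>"
  shows "(1 - (cmod z)\<^sup>2) / 4 \<le> Re (herglotz t z)"
proof -
  define D where "D = (cmod (cis t - z))\<^sup>2"
  have D0: "0 < D" using cis_ne[OF assms] by (simp add: D_def)
  have "cmod (cis t - z) \<le> 2" using norm_triangle_ineq4[of "cis t" z] assms by simp
  then have "D \<le> 2\<^sup>2" unfolding D_def by (intro power_mono) auto
  then have D4: "D \<le> 4" by simp
  have Re: "Re (herglotz t z) = (1 - (cmod z)\<^sup>2) / D"
    unfolding herglotz_def Re_divide D_def cmod_power2
    using sin_cos_squared_add[of t] by (simp add: power2_eq_square algebra_simps)
  have "0 \<le> 1 - (cmod z)\<^sup>2" using assms by (simp add: power_le_one)
  then show ?thesis unfolding Re using D0 D4 by (intro divide_left_mono) auto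
qed

lemma herglotz_cont: "z \<in> \<D> \<Longrightarrow> continuous_on A (\<lambda>t. herglotz t z)"
  unfolding herglotz_def using cis_ne by (intro continuous_intros) auto

locale circle_set =
  fixes E :: "real set"
  assumes E [measurable]: "E \<in> sets borel" and E_sub: "E \<subseteq> {0..2*pi}"
begin

abbreviation LE :: "(real \<Rightarrow> complex) \<Rightarrow> complex" where
  "LE f \<equiv> set_lebesgue_integral lborel E f"

lemma LE_integrable:
  fixes f :: "real \<Rightarrow> 'b::{banach,second_countable_topology}"
  assumes "continuous_on {0..2*pi} f" shows "set_integrable lborel E f"
  by (rule set_integrable_subset[OF borel_integrable_atLeastAtMost']) (use assms E_sub in auto)

lemma LE_sum:
  assumes "\<And>i. i \<in> I \<Longrightarrow> set_integrable lborel E (f i)"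
  shows "LE (\<lambda>t. \<Sum>i\<in>I. f i t) = (\<Sum>i\<in>I. LE (f i))"
  unfolding set_lebesgue_integral_def scaleR_sum_right
  by (rule Bochner_Integration.integral_sum) (use assms in \<open>simp add: set_integrable_def\<close>)

definition a :: "nat \<Rightarrow> complex" where
  "a n = herglotz_coeff n * LE (\<lambda>t. cis (- (real n * t))) / of_real (4 * pi)"

text \<open>The Herglotz integral of one half times the indicator of \<open>E\<close>: the usual
  normalisation 1 / (2 pi) appears halved. This half is the exponent in the modulus exp (-1/2) of
  exp (- A) on \<open>E\<close>.\<close>

definition A :: "complex \<Rightarrow> complex" where
  "A z = LE (\<lambda>t. herglotz t z) / of_real (4 * pi)"

lemma A_sums: assumes z: "z \<in> \<D>" shows "(\<lambda>n. a n * z ^ n) sums A z"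
proof -
  define f where "f n t = indicator E t *\<^sub>R (herglotz_coeff n * cis (- (real n * t)) * z ^ n)" for n t
  have fi: "integrable lborel (f n)" for n
    unfolding f_def by (rule LE_integrable[unfolded set_integrable_def]) (intro continuous_intros)
  have nf: "norm (f n t) \<le> indicator E t * (2 * cmod z ^ n)" for n t
    by (auto simp: f_def herglotz_coeff_def norm_mult norm_power indicator_def)
  have zg: "summable (\<lambda>n. 2 * cmod z ^ n)" using z by (intro summable_mult summable_geometric) auto
  have finE: "emeasure lborel E < \<infinity>"
    by (rule order_le_less_trans[OF emeasure_mono[OF E_sub]]) auto
  have intE: "integrable lborel (\<lambda>t. indicator E t * (2 * cmod z ^ n))" for n
    using finE by (intro integrable_mult_left integrable_real_indicator) auto
  have "(\<lambda>n. integral\<^sup>L lborel (f n)) sums (\<integral>t. (\<Sum>n. f n t) \<partial>lborel)"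
  proof (rule sums_integral[OF fi])
    show "AE t in lborel. summable (\<lambda>n. norm (f n t))"
    proof (intro AE_I2)
      fix t
      have "summable (\<lambda>n. indicator E t * (2 * cmod z ^ n))" by (rule summable_mult[OF zg])
      then show "summable (\<lambda>n. norm (f n t))" by (rule summable_comparison_test[rotated]) (use nf in auto)
    qed
    show "summable (\<lambda>n. \<integral>t. norm (f n t) \<partial>lborel)"
    proof (rule summable_comparison_test[of _ "\<lambda>n. measure lborel E * (2 * cmod z ^ n)"], intro exI allI impI)
      fix n
      have "(\<integral>t. norm (f n t) \<partial>lborel) \<le> (\<integral>t. indicator E t * (2 * cmod z ^ n) \<partial>lborel)"
        by (rule integral_mono[OF integrable_norm[OF fi] intE nf])
      also have "\<dots> = measure lborel E * (2 * cmod z ^ n)" using finE by simp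
      finally show "norm (\<integral>t. norm (f n t) \<partial>lborel) \<le> measure lborel E * (2 * cmod z ^ n)" by simp
    qed (rule summable_mult[OF zg])
  qed
  moreover have "integral\<^sup>L lborel (f n) = of_real (4 * pi) * (a n * z ^ n)" for n
  proof -
    have "integral\<^sup>L lborel (f n) = LE (\<lambda>t. herglotz_coeff n * (cis (- (real n * t)) * z ^ n))"
      unfolding f_def set_lebesgue_integral_def by (simp add: mult.assoc)
    also have "\<dots> = herglotz_coeff n * (LE (\<lambda>t. cis (- (real n * t))) * z ^ n)" by simp
    finally show ?thesis by (simp add: a_def)
  qed
  moreover have "(\<Sum>n. f n t) = indicator E t *\<^sub>R herglotz t z" for t
    using sums_scaleR_right[OF herglotz_sums[OF z, of t], of "indicator E t"] unfolding f_def by (simp add: sums_iff)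
  ultimately have "(\<lambda>n. of_real (4 * pi) * (a n * z ^ n)) sums LE (\<lambda>t. herglotz t z)"
    by (simp add: set_lebesgue_integral_def)
  from sums_divide[OF this, of "of_real (4 * pi)"] show ?thesis by (simp add: A_def)
qed

lemma A_hol: "A holomorphic_on \<D>"
  using power_series_holomorphic[of 0 1 a A] A_sums by simp

lemma A_taylor_coeff: "taylor_coeff A = a" by (rule taylor_coeff_unique[OF A_hol A_sums])

lemma Re_A: assumes "z \<in> \<D>" shows "Re (A z) = (LINT t:E|lborel. Re (herglotz t z)) / (4 * pi)"
proof -
  have "Re (LE (\<lambda>t. herglotz t z)) = (LINT t:E|lborel. Re (herglotz t z))"
    unfolding set_lebesgue_integral_def
    using integral_Re[OF LE_integrable[OF herglotz_cont[OF assms], unfolded set_integrable_def]] by simp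
  then show ?thesis unfolding A_def by (simp only: Re_divide_of_real)
qed

lemma Re_A_lower: assumes z: "z \<in> \<D>" shows "measure lborel E * ((1 - (cmod z)\<^sup>2) / (16 * pi)) \<le> Re (A z)"
proof -
  have finE: "emeasure lborel E < \<infinity>"
    by (rule order_le_less_trans[OF emeasure_mono[OF E_sub]]) auto
  have "(LINT t:E|lborel. (1 - (cmod z)\<^sup>2) / 4) \<le> (LINT t:E|lborel. Re (herglotz t z))"
    by (intro set_integral_mono LE_integrable continuous_intros herglotz_cont z Re_herglotz)
  moreover have "(LINT t:E|lborel. (1 - (cmod z)\<^sup>2) / 4) = measure lborel E * ((1 - (cmod z)\<^sup>2) / 4)"
    using finE by (simp add: set_lebesgue_integral_def)
  ultimately have "measure lborel E * ((1 - (cmod z)\<^sup>2) / 4) / (4 * pi) \<le> (LINT t:E|lborel. Re (herglotz t z)) / (4 * pi)"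
    by (intro divide_right_mono) auto
  then show ?thesis unfolding Re_A[OF z] by simp
qed

end

text \<open>The whole circle is the comparison set for an upper bound: enlarging \<open>E\<close>
  can only increase Re A, and for the full circle only the zeroth Fourier coefficient survives, so
  that A is constantly 1/2.\<close>

interpretation full: circle_set "{0..2*pi}" by unfold_locales auto

lemma full_A: assumes "z \<in> \<D>" shows "full.A z = 1/2"
proof -
  have int: "full.LE (\<lambda>t. cis (- (real n * t))) = (if n = 0 then of_real (2 * pi) else 0)" for n
  proof -
    have "full.LE (\<lambda>t. cis (- (real n * t))) = integral {0..2*pi} (\<lambda>t. cis (- (real n * t)))"
      by (intro set_borel_integral_eq_integral full.LE_integrable continuous_intros)
    also have "\<dots> = (if n = 0 then of_real (2 * pi) else 0)"
      using has_integral_cis[of "- int n"] by (simp add: integral_unique)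
    finally show ?thesis .
  qed
  have a: "full.a n = (if n = 0 then 1/2 else 0)" for n
    unfolding full.a_def int by (simp add: herglotz_coeff_def)
  have "(\<lambda>n. full.a n * z ^ n) sums (\<Sum>n\<in>{0}. full.a n * z ^ n)"
    by (rule sums_finite) (auto simp: a)
  then show ?thesis using sums_unique2[OF full.A_sums[OF assms]] by (simp add: a)
qed

context circle_set
begin

lemma Re_A_upper: assumes z: "z \<in> \<D>" shows "Re (A z) \<le> 1/2"
proof -
  have "(LINT t:E|lborel. Re (herglotz t z)) \<le> (LINT t:{0..2*pi}|lborel. Re (herglotz t z))"
    unfolding set_lebesgue_integral_def
  proof (rule integral_mono)
    show "integrable lborel (\<lambda>t. indicat_real E t *\<^sub>R Re (herglotz t z))"
      "integrable lborel (\<lambda>t. indicat_real {0..2*pi} t *\<^sub>R Re (herglotz t z))"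
      by (rule LE_integrable[unfolded set_integrable_def], intro continuous_intros herglotz_cont z,
          rule full.LE_integrable[unfolded set_integrable_def], intro continuous_intros herglotz_cont z)
    fix t
    have "0 \<le> (1 - (cmod z)\<^sup>2) / 4" using z by (simp add: power_le_one)
    then have "0 \<le> Re (herglotz t z)" using Re_herglotz[OF z, of t] by linarith
    then show "indicat_real E t *\<^sub>R Re (herglotz t z) \<le> indicat_real {0..2*pi} t *\<^sub>R Re (herglotz t z)"
      using E_sub by (auto simp: indicator_def)
  qed
  then have "Re (A z) \<le> Re (full.A z)" unfolding Re_A[OF z] full.Re_A[OF z] by (intro divide_right_mono) auto
  then show ?thesis by (simp add: full_A[OF z])
qed

definition b :: "complex \<Rightarrow> complex" where "b z = exp (- A z)"

lemma b_hol: "b holomorphic_on \<D>"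
  unfolding b_def[abs_def] by (intro holomorphic_intros A_hol)

text \<open>Positive measure of \<open>E\<close> makes Re A strictly positive through the lower
  bound for the Poisson kernel.\<close>

lemma b_disc: assumes "0 < measure lborel E" shows "b ` \<D> \<subseteq> \<D>"
proof clarify
  fix z assume z: "z \<in> \<D>"
  have "0 < measure lborel E * ((1 - (cmod z)\<^sup>2) / (16 * pi))"
    using assms z by (intro mult_pos_pos divide_pos_pos) (auto simp: power_less_one_iff abs_square_less_1)
  then have "0 < Re (A z)" using Re_A_lower[OF z] by linarith
  then show "b z \<in> \<D>" by (simp add: b_def)
qed

lemma b_outer: "outer_function b"
  unfolding outer_function_def
proof (intro exI[of _ 1] exI[of _ "\<lambda>t. exp (- (1/2) * indicator E t)"] conjI allI ballI)
  have ln: "ln (exp (- (1/2) * indicator E t)) = - (1/2) * indicat_real E t" for t by simp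
  have finE: "emeasure lborel E < \<infinity>"
    by (rule order_le_less_trans[OF emeasure_mono[OF E_sub]]) auto
  have "integrable lborel (\<lambda>t. - (1/2) * indicat_real E t)"
    using finE by (intro integrable_mult_right integrable_real_indicator) auto
  moreover have "indicat_real {0..2*pi} t *\<^sub>R (- (1/2) * indicat_real E t) = - (1/2) * indicat_real E t" for t
    using E_sub by (auto simp: indicator_def)
  ultimately show "set_integrable lborel {0..2*pi} (\<lambda>t. ln (exp (- (1/2) * indicat_real E t)))"
    unfolding set_integrable_def ln by (simp only:)
  fix z assume "z \<in> \<D>"
  have "(CLBINT t:{0..2*pi}. (cis t + z) / (cis t - z) * of_real (ln (exp (- (1/2) * indicat_real E t))))
     = (CLBINT t. (- 1/2) * (indicat_real E t *\<^sub>R herglotz t z))"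
    unfolding ln set_lebesgue_integral_def
    by (intro Bochner_Integration.integral_cong refl) (use E_sub in \<open>auto simp: indicator_def herglotz_def\<close>)
  also have "\<dots> = - 1/2 * LE (\<lambda>t. herglotz t z)" unfolding set_lebesgue_integral_def by (rule integral_mult_right_zero)
  finally have "1 / (2 * of_real pi) * (CLBINT t:{0..2*pi}. (cis t + z) / (cis t - z) * of_real (ln (exp (- (1/2) * indicat_real E t)))) = - A z"
    by (simp add: A_def field_simps)
  then show "b z = 1 * exp (1 / (2 * of_real pi) * (CLBINT t:{0..2*pi}. (cis t + z) / (cis t - z) * of_real (ln (exp (- (1/2) * indicat_real E t)))))"
    by (simp only: b_def mult_1_left)
qed auto

text \<open>The coefficient matrix is lower triangular with 1 on the diagonal and 2 below. Its
  Hermitian part is the all-ones matrix, whose form is the squared modulus of the sum.\<close>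

lemma quad_form:
  fixes x :: "nat \<Rightarrow> complex"
  shows "Re (\<Sum>m<d. cnj (x m) * (\<Sum>j\<le>m. herglotz_coeff (m - j) * x j)) = (cmod (\<Sum>j<d. x j))\<^sup>2"
proof (induction d)
  case (Suc d)
  define S where "S = (\<Sum>j<d. x j)"
  have "(\<Sum>j\<le>d. herglotz_coeff (d - j) * x j) = (\<Sum>j<d. herglotz_coeff (d - j) * x j) + x d"
    by (simp add: herglotz_coeff_def lessThan_Suc_atMost[symmetric])
  also have "(\<Sum>j<d. herglotz_coeff (d - j) * x j) = 2 * S"
    unfolding S_def sum_distrib_left by (intro sum.cong refl) (simp add: herglotz_coeff_def)
  finally have e: "(\<Sum>j\<le>d. herglotz_coeff (d - j) * x j) = 2 * S + x d" .
  have "Re (\<Sum>m<Suc d. cnj (x m) * (\<Sum>j\<le>m. herglotz_coeff (m - j) * x j)) = (cmod S)\<^sup>2 + Re (cnj (x d) * (2 * S + x d))"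
    using Suc by (simp add: e S_def)
  also have "\<dots> = (cmod (S + x d))\<^sup>2" unfolding cmod_power2 by (simp add: power2_eq_square algebra_simps)
  finally show ?case by (simp add: S_def)
qed simp

text \<open>For p = Q exp A one has |p|^2 <= |Q|^2 (1 + 4 Re A). Integrated over a circle, the
  correction is a finite sum in the coefficients of Q, continuous up to radius 1, so the limit needs
  no boundary values of A or p.\<close>

theorem quotient_norm:
  fixes q :: "nat \<Rightarrow> complex"
  assumes q: "\<And>m. d \<le> m \<Longrightarrow> q m = 0" and small: "\<And>t. t \<in> E \<Longrightarrow> cmod (\<Sum>m<d. q m * cis t ^ m) \<le> \<epsilon>"
  obtains p where "p holomorphic_on \<D>" "square_summable (taylor_coeff p)" "\<And>z. z \<in> \<D> \<Longrightarrow> b z * p z = (\<Sum>m<d. q m * z ^ m)"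
    "(\<Sum>m. (cmod (taylor_coeff p m))\<^sup>2) \<le> (\<Sum>m<d. (cmod (q m))\<^sup>2) + 2 * \<epsilon>\<^sup>2"
proof -
  define Q where "Q z = (\<Sum>m<d. q m * z ^ m)" for z
  define p where "p z = Q z * exp (A z)" for z
  have Q_hol: "Q holomorphic_on X" for X unfolding Q_def[abs_def] by (intro holomorphic_intros)
  have p_hol: "p holomorphic_on \<D>" unfolding p_def[abs_def] by (intro holomorphic_intros Q_hol A_hol)
  have QA_hol: "(\<lambda>z. Q z * A z) holomorphic_on \<D>" by (intro holomorphic_intros Q_hol A_hol)
  have Q_sums: "(\<lambda>m. q m * z ^ m) sums Q z" for z unfolding Q_def by (rule sums_finite) (use q in auto)
  have Q_tc: "taylor_coeff Q = q" by (rule taylor_coeff_unique[OF Q_hol Q_sums])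
  have QA_tc: "taylor_coeff (\<lambda>z. Q z * A z) = (\<lambda>m. \<Sum>j\<le>m. q j * a (m - j))"
  proof (rule taylor_coeff_unique[OF QA_hol])
    fix z assume z: "z \<in> \<D>"
    have r: "0 \<le> cmod z" "cmod z < 1" using z by auto
    have s1: "summable (\<lambda>m. norm (q m * z ^ m))" 
      using taylor_coeff_summable[OF Q_hol r] by (simp add: Q_tc norm_mult norm_power)
    have s2: "summable (\<lambda>m. norm (a m * z ^ m))"
      using taylor_coeff_summable[OF A_hol r] by (simp add: A_taylor_coeff norm_mult norm_power)
    have "(\<lambda>k. \<Sum>i\<le>k. (q i * z ^ i) * (a (k - i) * z ^ (k - i))) sums (Q z * A z)"
      using Cauchy_product_sums[OF s1 s2] Q_sums[of z] A_sums[OF z] by (simp add: sums_iff)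
    moreover have "(\<Sum>i\<le>k. (q i * z ^ i) * (a (k - i) * z ^ (k - i))) = (\<Sum>j\<le>k. q j * a (k - j)) * z ^ k" for k
      unfolding sum_distrib_right
    proof (intro sum.cong refl)
      fix i assume "i \<in> {..k}"
      then have "z ^ i * z ^ (k - i) = z ^ k" by (simp flip: power_add)
      then show "(q i * z ^ i) * (a (k - i) * z ^ (k - i)) = q i * a (k - i) * z ^ k"
        by (metis (no_types, opaque_lifting) mult.assoc mult.left_commute)
    qed
    ultimately show "(\<lambda>m. (\<Sum>j\<le>m. q j * a (m - j)) * z ^ m) sums (Q z * A z)" by simp
  qed
  define U where "U r = Re (\<Sum>m<d. (\<Sum>j\<le>m. q j * a (m - j)) * cnj (q m) * of_real (r ^ (2 * m)))" for r :: real
  define M where "M = (\<Sum>m<d. (cmod (q m))\<^sup>2)"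
  have bound: "(\<Sum>m<n. (cmod (taylor_coeff p m))\<^sup>2 * r ^ (2 * m)) \<le> M + 4 * U r" if r: "0 \<le> r" "r < 1" for n r
  proof -
    have in_D: "of_real r * cis t \<in> \<D>" for t using r by (simp add: norm_mult)
    note P1 = circle_parseval_norm[OF taylor_coeff_summable[OF p_hol r] r(1)]
    note P2 = circle_parseval_norm[OF taylor_coeff_summable[OF Q_hol r] r(1)]
    note P3 = circle_parseval(2)[OF taylor_coeff_summable[OF QA_hol r] taylor_coeff_summable[OF Q_hol r] r(1)]
    have S3: "(\<Sum>m. taylor_coeff (\<lambda>z. Q z * A z) m * cnj (taylor_coeff Q m) * of_real (r ^ (2 * m))) = (\<Sum>m<d. (\<Sum>j\<le>m. q j * a (m - j)) * cnj (q m) * of_real (r ^ (2 * m)))"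
      unfolding QA_tc Q_tc by (rule suminf_finite) (use q in auto)
    have I3: "((\<lambda>t. Re (Q (of_real r * cis t) * A (of_real r * cis t) * cnj (Q (of_real r * cis t)))) has_integral 2 * pi * U r) {0..2*pi}"
    proof -
      have "((\<lambda>t. Re (power_series (taylor_coeff (\<lambda>z. Q z * A z)) (of_real r * cis t) * cnj (power_series (taylor_coeff Q) (of_real r * cis t)))) has_integral
        Re (of_real (2 * pi) * (\<Sum>m<d. (\<Sum>j\<le>m. q j * a (m - j)) * cnj (q m) * of_real (r ^ (2 * m))))) {0..2*pi}"
        using has_integral_linear[OF P3 bounded_linear_Re] unfolding S3 o_def .
      then show ?thesis unfolding taylor_coeff_psum[OF QA_hol in_D] taylor_coeff_psum[OF Q_hol in_D] U_def by (simp del: Re_sum)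
    qed
    have S2: "(\<Sum>m. (cmod (taylor_coeff Q m))\<^sup>2 * r ^ (2 * m)) \<le> M"
    proof -
      have "(\<Sum>m. (cmod (taylor_coeff Q m))\<^sup>2 * r ^ (2 * m)) = (\<Sum>m<d. (cmod (q m))\<^sup>2 * r ^ (2 * m))"
        unfolding Q_tc by (rule suminf_finite) (use q in auto)
      also have "\<dots> \<le> M" unfolding M_def using r by (intro sum_mono mult_left_le power_le_one) auto
      finally show ?thesis .
    qed
    have "2 * pi * (\<Sum>m. (cmod (taylor_coeff p m))\<^sup>2 * r ^ (2 * m)) \<le> 2 * pi * (\<Sum>m. (cmod (taylor_coeff Q m))\<^sup>2 * r ^ (2 * m)) + 4 * (2 * pi * U r)"
    proof (rule has_integral_le[OF P1(2) has_integral_add[OF P2(2) has_integral_mult_right[OF I3]]])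
      fix t
      define z where "z = of_real r * cis t"
      have z: "z \<in> \<D>" unfolding z_def by (rule in_D)
      define u where "u = Re (A z)"
      have u: "0 \<le> u" "u \<le> 1/2"
      proof -
        have "0 \<le> measure lborel E * ((1 - (cmod z)\<^sup>2) / (16 * pi))"
          using z by (intro mult_nonneg_nonneg divide_nonneg_nonneg) (auto simp: power_le_one)
        then show "0 \<le> u" using Re_A_lower[OF z] by (simp add: u_def)
        show "u \<le> 1/2" unfolding u_def by (rule Re_A_upper[OF z])
      qed
      \<comment> \<open>With x = 2 u in [0, 1]: exp x <= 1 + x + x^2 <= 1 + 2 x. The bound
        \<open>u \<le> 1/2\<close>, hence the modulus chosen for \<open>b\<close>, is used
        here.\<close>
      have "exp (2 * u) \<le> 1 + 2 * u + (2 * u)\<^sup>2" by (rule exp_bound) (use u in auto)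
      also have "\<dots> \<le> 1 + 4 * u"
      proof -
        have "(2 * u) * (2 * u) \<le> 1 * (2 * u)" using u by (intro mult_right_mono) auto
        then show ?thesis by (simp add: power2_eq_square)
      qed
      finally have ex: "exp (2 * u) \<le> 1 + 4 * u" .
      have "(cmod (p z))\<^sup>2 = (cmod (Q z))\<^sup>2 * exp (2 * u)"
        by (simp add: p_def norm_mult power_mult_distrib u_def exp_double)
      also have "\<dots> \<le> (cmod (Q z))\<^sup>2 * (1 + 4 * u)" using ex by (intro mult_left_mono) auto
      also have "\<dots> = (cmod (Q z))\<^sup>2 + 4 * Re (Q z * A z * cnj (Q z))"
      proof -
        have "Q z * A z * cnj (Q z) = of_real ((cmod (Q z))\<^sup>2) * A z"
          by (simp only: complex_norm_square mult_ac)
        then have "Re (Q z * A z * cnj (Q z)) = (cmod (Q z))\<^sup>2 * u"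
          by (simp only: u_def Re_complex_of_real Im_complex_of_real times_complex.sel mult_zero_left diff_zero)
        then show ?thesis by (simp only: distrib_left mult_1_right mult_ac)
      qed
      finally show "(cmod (power_series (taylor_coeff p) (of_real r * cis t)))\<^sup>2 \<le> (cmod (power_series (taylor_coeff Q) (of_real r * cis t)))\<^sup>2
          + 4 * Re (Q (of_real r * cis t) * A (of_real r * cis t) * cnj (Q (of_real r * cis t)))"
        unfolding taylor_coeff_psum[OF p_hol in_D] taylor_coeff_psum[OF Q_hol in_D] z_def .
    qed
    then have "2 * pi * (\<Sum>m. (cmod (taylor_coeff p m))\<^sup>2 * r ^ (2 * m)) \<le> 2 * pi * ((\<Sum>m. (cmod (taylor_coeff Q m))\<^sup>2 * r ^ (2 * m)) + 4 * U r)"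
      by (simp add: algebra_simps)
    then have "(\<Sum>m. (cmod (taylor_coeff p m))\<^sup>2 * r ^ (2 * m)) \<le> (\<Sum>m. (cmod (taylor_coeff Q m))\<^sup>2 * r ^ (2 * m)) + 4 * U r"
      by (simp only: mult_le_cancel_left_pos[of "2 * pi"] pi_gt_zero zero_less_mult_iff zero_less_numeral simp_thms)
    moreover have "(\<Sum>m<n. (cmod (taylor_coeff p m))\<^sup>2 * r ^ (2 * m)) \<le> (\<Sum>m. (cmod (taylor_coeff p m))\<^sup>2 * r ^ (2 * m))"
      using r by (intro sum_le_suminf P1(1)) auto
    ultimately show ?thesis using S2 by linarith
  qed
  \<comment> \<open>At radius 1 the coefficients \<open>a\<close> unfold into integrals over
    \<open>E\<close>, and \<open>quad_form\<close> identifies the integrand as |Q|^2, at most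
    \<epsilon>^2 there. With the measure of \<open>E\<close> at most 2 pi and the divisor 4 pi this
    gives \<epsilon>^2 / 2, and the factor 4 in \<open>bound\<close> makes it 2
    \<epsilon>^2.\<close>
  have U1: "U 1 \<le> \<epsilon>\<^sup>2 / 2"
  proof -
    have fin: "(\<Sum>m<d. (\<Sum>j\<le>m. q j * a (m - j)) * cnj (q m) * of_real (1 ^ (2 * m)))
      = LE (\<lambda>t. \<Sum>m<d. cnj (q m * cis t ^ m) * (\<Sum>j\<le>m. herglotz_coeff (m - j) * (q j * cis t ^ j))) / of_real (4 * pi)"
    proof -
      have "(\<lambda>t. \<Sum>m<d. cnj (q m * cis t ^ m) * (\<Sum>j\<le>m. herglotz_coeff (m - j) * (q j * cis t ^ j)))
        = (\<lambda>t. \<Sum>m<d. \<Sum>j\<le>m. (cnj (q m) * q j * herglotz_coeff (m - j)) * cis (- (real (m - j) * t)))"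
      proof (rule ext, unfold sum_distrib_left, intro sum.cong refl)
        fix t :: real and m j :: nat assume "j \<in> {..m}"
        then have "cnj (cis t) ^ m * cis t ^ j = cis (- (real (m - j) * t))"
          unfolding cis_cnj Complex.DeMoivre cis_mult by (intro arg_cong[of _ _ cis]) (simp add: of_nat_diff algebra_simps)
        then show "cnj (q m * cis t ^ m) * (herglotz_coeff (m - j) * (q j * cis t ^ j)) = (cnj (q m) * q j * herglotz_coeff (m - j)) * cis (- (real (m - j) * t))"
          by (metis (no_types, opaque_lifting) complex_cnj_mult complex_cnj_power mult.assoc mult.left_commute)
      qed
      then have "LE (\<lambda>t. \<Sum>m<d. cnj (q m * cis t ^ m) * (\<Sum>j\<le>m. herglotz_coeff (m - j) * (q j * cis t ^ j)))
        = (\<Sum>m<d. \<Sum>j\<le>m. (cnj (q m) * q j * herglotz_coeff (m - j)) * LE (\<lambda>t. cis (- (real (m - j) * t))))"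
      proof -
        assume eq: "(\<lambda>t. \<Sum>m<d. cnj (q m * cis t ^ m) * (\<Sum>j\<le>m. herglotz_coeff (m - j) * (q j * cis t ^ j)))
        = (\<lambda>t. \<Sum>m<d. \<Sum>j\<le>m. (cnj (q m) * q j * herglotz_coeff (m - j)) * cis (- (real (m - j) * t)))"
        have i: "set_integrable lborel E (\<lambda>t. c * cis (- (real k * t)))" for c k
          by (intro LE_integrable continuous_intros)
        have i2: "set_integrable lborel E (\<lambda>t. \<Sum>j\<le>m. (cnj (q m) * q j * herglotz_coeff (m - j)) * cis (- (real (m - j) * t)))" for m
          by (intro LE_integrable continuous_intros)
        show ?thesis unfolding eq
          by (subst LE_sum[OF i2], intro sum.cong refl, subst LE_sum[OF i], intro sum.cong refl set_integral_mult_right)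
      qed
      then show ?thesis
        by (simp add: a_def sum_distrib_right sum_distrib_left sum_divide_distrib mult_ac)
    qed
    have contS: "continuous_on {0..2*pi} (\<lambda>t. \<Sum>m<d. cnj (q m * cis t ^ m) * (\<Sum>j\<le>m. herglotz_coeff (m - j) * (q j * cis t ^ j)))"
      by (intro continuous_intros)
    have "U 1 = Re (LE (\<lambda>t. \<Sum>m<d. cnj (q m * cis t ^ m) * (\<Sum>j\<le>m. herglotz_coeff (m - j) * (q j * cis t ^ j)))) / (4 * pi)"
      unfolding U_def fin by (rule Re_divide_of_real)
    also have "Re (LE (\<lambda>t. \<Sum>m<d. cnj (q m * cis t ^ m) * (\<Sum>j\<le>m. herglotz_coeff (m - j) * (q j * cis t ^ j))))
      = (LINT t:E|lborel. Re (\<Sum>m<d. cnj (q m * cis t ^ m) * (\<Sum>j\<le>m. herglotz_coeff (m - j) * (q j * cis t ^ j))))"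
      unfolding set_lebesgue_integral_def
      using integral_Re[OF LE_integrable[OF contS, unfolded set_integrable_def]] by (simp del: Re_sum)
    also have "\<dots> = (LINT t:E|lborel. (cmod (\<Sum>m<d. q m * cis t ^ m))\<^sup>2)"
      unfolding quad_form ..
    also have "\<dots> \<le> (LINT t:E|lborel. \<epsilon>\<^sup>2)"
      by (intro set_integral_mono LE_integrable continuous_intros power_mono small) auto
    also have "\<dots> = measure lborel E * \<epsilon>\<^sup>2"
    proof -
      have "emeasure lborel E < \<infinity>" by (rule order_le_less_trans[OF emeasure_mono[OF E_sub]]) auto
      then show ?thesis by (simp add: set_lebesgue_integral_def)
    qed
    also have "\<dots> \<le> (2 * pi) * \<epsilon>\<^sup>2"
    proof (rule mult_right_mono)
      have "measure lborel E \<le> measure lborel {0..2*pi}"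
        by (rule measure_mono_fmeasurable[OF E_sub]) (auto intro: fmeasurable_compact)
      then show "measure lborel E \<le> 2 * pi" by simp
    qed simp
    finally show ?thesis by (simp add: field_simps)
  qed
  have "(\<Sum>m<n. (cmod (taylor_coeff p m))\<^sup>2) \<le> M + 2 * \<epsilon>\<^sup>2" for n
  proof -
    have l1: "((\<lambda>r. \<Sum>m<n. (cmod (taylor_coeff p m))\<^sup>2 * r ^ (2 * m)) \<longlongrightarrow> (\<Sum>m<n. (cmod (taylor_coeff p m))\<^sup>2 * 1 ^ (2 * m))) (at_left (1::real))"
      by (intro tendsto_intros)
    have square_summable: "((\<lambda>r. M + 4 * U r) \<longlongrightarrow> M + 4 * U 1) (at_left 1)"
      unfolding U_def by (intro tendsto_intros)
    have l3: "\<forall>\<^sub>F r in at_left 1. (\<Sum>m<n. (cmod (taylor_coeff p m))\<^sup>2 * r ^ (2 * m)) \<le> M + 4 * U r"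
      using eventually_at_left_real[of 0 "1::real"] by (rule eventually_mono[OF _ bound]) auto
    have "(\<Sum>m<n. (cmod (taylor_coeff p m))\<^sup>2 * 1 ^ (2 * m)) \<le> M + 4 * U 1"
      by (rule tendsto_le[OF _ square_summable l1 l3]) simp
    then show ?thesis using U1 by simp
  qed
  then have "square_summable (taylor_coeff p)" "(\<Sum>m. (cmod (taylor_coeff p m))\<^sup>2) \<le> M + 2 * \<epsilon>\<^sup>2" by (rule square_summable_bounded_sums)+
  moreover have "b z * p z = (\<Sum>m<d. q m * z ^ m)" for z
    unfolding b_def p_def Q_def[symmetric] by (simp add: exp_minus)
  ultimately show ?thesis using that[OF p_hol] by (simp add: M_def)
qed

end


subsection \<open>Polar coordinates\<close>

lemma lborel_complex: "(lborel :: complex measure) = distr (lborel \<Otimes>\<^sub>M lborel) borel (\<lambda>(x, y). Complex x y)"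
proof (rule lborel_eqI)
  have C: "(\<lambda>(x, y). Complex x y) \<in> (lborel \<Otimes>\<^sub>M lborel) \<rightarrow>\<^sub>M borel"
    unfolding Complex_eq by measurable
  fix l u :: complex assume le: "\<And>b. b \<in> Basis \<Longrightarrow> l \<bullet> b \<le> u \<bullet> b"
  have le': "Re l \<le> Re u" "Im l \<le> Im u"
    using le[of 1] le[of \<i>] by (auto simp: Basis_complex_def inner_complex_def)
  have "(\<lambda>(x, y). Complex x y) -` box l u \<inter> space (lborel \<Otimes>\<^sub>M lborel) = {Re l<..<Re u} \<times> {Im l<..<Im u}"
    by (auto simp: box_def Basis_complex_def inner_complex_def space_pair_measure)
  then have "emeasure (distr (lborel \<Otimes>\<^sub>M lborel) borel (\<lambda>(x, y). Complex x y)) (box l u)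
    = emeasure (lborel \<Otimes>\<^sub>M lborel) ({Re l<..<Re u} \<times> {Im l<..<Im u})"
    by (subst emeasure_distr[OF C]) auto
  also have "\<dots> = emeasure lborel {Re l<..<Re u} * emeasure lborel {Im l<..<Im u}"
    by (rule lborel.emeasure_pair_measure_Times) auto
  also have "\<dots> = (\<Prod>b\<in>Basis. (u - l) \<bullet> b)"
    using le' by (simp add: Basis_complex_def inner_complex_def ennreal_mult)
  finally show "emeasure (distr (lborel \<Otimes>\<^sub>M lborel) borel (\<lambda>(x, y). Complex x y)) (box l u) = ennreal (\<Prod>b\<in>Basis. (u - l) \<bullet> b)" .
qed simp

lemma nn_integral_complex:
  assumes [measurable]: "f \<in> borel_measurable borel"
  shows "(\<integral>\<^sup>+z. f z \<partial>lborel) = (\<integral>\<^sup>+x. \<integral>\<^sup>+y. f (Complex x y) \<partial>lborel \<partial>lborel)"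
proof -
  have C: "(\<lambda>(x, y). Complex x y) \<in> (lborel \<Otimes>\<^sub>M lborel) \<rightarrow>\<^sub>M borel"
    unfolding Complex_eq by measurable
  have "(\<integral>\<^sup>+z. f z \<partial>lborel) = (\<integral>\<^sup>+p. f (case p of (x, y) \<Rightarrow> Complex x y) \<partial>(lborel \<Otimes>\<^sub>M lborel))"
    by (subst lborel_complex, rule nn_integral_distr[OF C]) simp
  also have "\<dots> = (\<integral>\<^sup>+x. \<integral>\<^sup>+y. f (Complex x y) \<partial>lborel \<partial>lborel)"
    using lborel.nn_integral_fst[of "\<lambda>p. f (case p of (x, y) \<Rightarrow> Complex x y)" lborel] measurable_compose[OF C assms]
    by simp
  finally show ?thesis .
qed

text \<open>Substitution on the compact intervals [-n, n]; both sides then pass to the limit by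
  monotone convergence.\<close>

lemma nn_integral_arctan:
  fixes F :: "real \<Rightarrow> ennreal"
  assumes [measurable]: "F \<in> borel_measurable borel"
  shows "(\<integral>\<^sup>+s. F (arctan s) * ennreal (1 / (1 + s\<^sup>2)) \<partial>lborel) = (\<integral>\<^sup>+t. F t * indicator {-pi/2<..<pi/2} t \<partial>lborel)"
proof -
  have "(\<integral>\<^sup>+t. F t * indicator {arctan (- real n)..arctan (real n)} t \<partial>lborel)
      = (\<integral>\<^sup>+s. F (arctan s) * ennreal (1 / (1 + s\<^sup>2)) * indicator {- real n..real n} s \<partial>lborel)" for n
  proof (cases "n = 0")
    case True
    have "AE t in lborel. t \<noteq> (0::real)" by (rule AE_lborel_singleton)
    then have "(\<integral>\<^sup>+t. F t * indicator {0..0} t \<partial>lborel) = (\<integral>\<^sup>+t. F (arctan t) * ennreal (1 / (1 + t\<^sup>2)) * indicator {0..0} t \<partial>lborel)"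
      by (intro nn_integral_cong_AE; eventually_elim; simp)
    then show ?thesis using True by simp
  next
    case False
    show ?thesis
    proof (rule nn_integral_substitution_aux)
      fix x :: real
      show "(arctan has_real_derivative 1 / (1 + x\<^sup>2)) (at x)"
        by (auto intro!: derivative_eq_intros simp: divide_inverse)
      show "0 \<le> 1 / (1 + x\<^sup>2)" by (simp add: add_nonneg_nonneg)
    next
      show "continuous_on {- real n..real n} (\<lambda>x. 1 / (1 + x\<^sup>2))"
        by (intro continuous_intros) (simp add: add_nonneg_eq_0_iff)
    qed (use False in auto)
  qed
  then have eq: "(SUP n. \<integral>\<^sup>+t. F t * indicator {arctan (- real n)..arctan (real n)} t \<partial>lborel)
      = (SUP n. \<integral>\<^sup>+s. F (arctan s) * ennreal (1 / (1 + s\<^sup>2)) * indicator {- real n..real n} s \<partial>lborel)" by simp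
  have "(SUP n. \<integral>\<^sup>+s. F (arctan s) * ennreal (1 / (1 + s\<^sup>2)) * indicator {- real n..real n} s \<partial>lborel)
     = (\<integral>\<^sup>+s. (SUP n. F (arctan s) * ennreal (1 / (1 + s\<^sup>2)) * indicator {- real n..real n} s) \<partial>lborel)"
    by (rule nn_integral_monotone_convergence_SUP[symmetric])
       (auto simp: incseq_def le_fun_def intro!: mult_left_mono indicator_leI)
  also have "\<dots> = (\<integral>\<^sup>+s. F (arctan s) * ennreal (1 / (1 + s\<^sup>2)) \<partial>lborel)"
  proof (intro nn_integral_cong)
    fix s :: real
    obtain n where "\<bar>s\<bar> \<le> real n" using real_arch_simple by blast
    then have "(SUP n. indicator {- real n..real n} s :: ennreal) = 1"
      by (intro antisym SUP_least SUP_upper2[of n]) (auto simp: indicator_def)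
    then show "(SUP n. F (arctan s) * ennreal (1 / (1 + s\<^sup>2)) * indicator {- real n..real n} s) = F (arctan s) * ennreal (1 / (1 + s\<^sup>2))"
      by (simp add: SUP_mult_left_ennreal[symmetric])
  qed
  finally have R: "(SUP n. \<integral>\<^sup>+s. F (arctan s) * ennreal (1 / (1 + s\<^sup>2)) * indicator {- real n..real n} s \<partial>lborel)
     = (\<integral>\<^sup>+s. F (arctan s) * ennreal (1 / (1 + s\<^sup>2)) \<partial>lborel)" .
  have mono: "{arctan (- real m)..arctan (real m)} \<subseteq> {arctan (- real n)..arctan (real n)}" if "m \<le> n" for m n
    using that by (auto simp: arctan_le_iff intro: order_trans arctan_monotone')
  have "(SUP n. \<integral>\<^sup>+t. F t * indicator {arctan (- real n)..arctan (real n)} t \<partial>lborel)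
     = (\<integral>\<^sup>+t. (SUP n. F t * indicator {arctan (- real n)..arctan (real n)} t) \<partial>lborel)"
    by (rule nn_integral_monotone_convergence_SUP[symmetric])
       (auto simp: incseq_def le_fun_def intro!: mult_left_mono indicator_leI dest: mono[THEN subsetD])
  also have "\<dots> = (\<integral>\<^sup>+t. F t * indicator {-pi/2<..<pi/2} t \<partial>lborel)"
  proof (intro nn_integral_cong)
    fix t :: real
    have "(SUP n. indicator {arctan (- real n)..arctan (real n)} t) = (indicator {-pi/2<..<pi/2} t :: ennreal)"
    proof (cases "t \<in> {-pi/2<..<pi/2}")
      case True
      obtain n where n: "\<bar>tan t\<bar> \<le> real n" using real_arch_simple by blast
      have "arctan (tan t) = t" using True by (intro arctan_tan) auto
      moreover have "arctan (- real n) \<le> arctan (tan t)" "arctan (tan t) \<le> arctan (real n)"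
        using n unfolding arctan_le_iff by linarith+
      ultimately have "t \<in> {arctan (- real n)..arctan (real n)}" by simp
      then show ?thesis using True
        by (intro antisym SUP_least SUP_upper2[of n]) (auto simp: indicator_def)
    next
      case False
      have "t \<notin> {arctan (- real n)..arctan (real n)}" for n
        using False arctan_bounded[of "real n"] arctan_bounded[of "- real n"] by auto
      then show ?thesis using False by simp
    qed
    then show "(SUP n. F t * indicator {arctan (- real n)..arctan (real n)} t) = F t * indicator {-pi/2<..<pi/2} t"
      by (simp add: SUP_mult_left_ennreal[symmetric])
  qed
  finally show ?thesis using eq R by simp
qed

definition radial :: "(complex \<Rightarrow> ennreal) \<Rightarrow> real \<Rightarrow> ennreal" where
  "radial f t = (\<integral>\<^sup>+r. ennreal r * f (of_real r * cis t) * indicator {0<..} r \<partial>lborel)"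

lemma radial_measurable [measurable]:
  assumes [measurable]: "f \<in> borel_measurable borel"
  shows "radial f \<in> borel_measurable borel"
  unfolding radial_def cis_conv_exp by measurable

text \<open>Polar coordinates as one-dimensional substitutions: y = x s at fixed x, then x = r /
  sqrt (1 + s^2) at fixed s, and finally t = arctan s. The two factors 1 / sqrt (1 + s^2) combine to
  the derivative of arctan.\<close>

lemma nn_integral_right_half_plane:
  assumes [measurable]: "f \<in> borel_measurable borel"
  shows "(\<integral>\<^sup>+x. \<integral>\<^sup>+y. f (Complex x y) * indicator {0<..} x \<partial>lborel \<partial>lborel)
     = (\<integral>\<^sup>+t. radial f t * indicator {-pi/2<..<pi/2} t \<partial>lborel)"
proof -
  have Cm: "(\<lambda>p. f (Complex (g p) (h p))) \<in> borel_measurable M" if [measurable]: "g \<in> borel_measurable M" "h \<in> borel_measurable M" for g h and M :: "'z measure"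
    unfolding Complex_eq by measurable
  have Cx [measurable, simp]: "(\<lambda>y. f (Complex x y)) \<in> borel_measurable borel" for x
    by (rule Cm) measurable
  have "(\<integral>\<^sup>+x. \<integral>\<^sup>+y. f (Complex x y) * indicator {0<..} x \<partial>lborel \<partial>lborel)
      = (\<integral>\<^sup>+x. \<integral>\<^sup>+s. ennreal x * f (Complex x (x * s)) * indicator {0<..} x \<partial>lborel \<partial>lborel)"
  proof (rule nn_integral_cong)
    fix x :: real
    show "(\<integral>\<^sup>+y. f (Complex x y) * indicator {0<..} x \<partial>lborel) = (\<integral>\<^sup>+s. ennreal x * f (Complex x (x * s)) * indicator {0<..} x \<partial>lborel)"
    proof (cases "x > 0")
      case True
      have "(\<integral>\<^sup>+y. f (Complex x y) \<partial>lborel) = ennreal \<bar>x\<bar> * (\<integral>\<^sup>+s. f (Complex x (0 + x * s)) \<partial>lborel)"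
        by (rule nn_integral_real_affine) (use True Cm in auto)
      then show ?thesis using True Cm by (simp add: nn_integral_cmult)
    qed simp
  qed
  also have "\<dots> = (\<integral>\<^sup>+s. \<integral>\<^sup>+x. ennreal x * f (Complex x (x * s)) * indicator {0<..} x \<partial>lborel \<partial>lborel)"
  proof (rule lborel_pair.Fubini')
    show "(\<lambda>(s, x). ennreal x * f (Complex x (x * s)) * indicator {0<..} x) \<in> borel_measurable (lborel \<Otimes>\<^sub>M lborel)"
      using Cm[of snd "lborel \<Otimes>\<^sub>M lborel" "\<lambda>p. snd p * fst p"] unfolding split_beta by measurable
  qed
  also have "\<dots> = (\<integral>\<^sup>+s. radial f (arctan s) * ennreal (1 / (1 + s\<^sup>2)) \<partial>lborel)"
  proof (intro nn_integral_cong)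
    fix s :: real
    define c where "c = 1 / sqrt (1 + s\<^sup>2)"
    have pos: "1 + s\<^sup>2 > 0" by (simp add: add_pos_nonneg)
    have [measurable]: "(\<lambda>x. f (Complex x (x * s))) \<in> borel_measurable borel" by (rule Cm) measurable
    have c: "c > 0" "c * c = 1 / (1 + s\<^sup>2)" using pos by (auto simp: c_def)
    have "(\<integral>\<^sup>+x. ennreal x * f (Complex x (x * s)) * indicator {0<..} x \<partial>lborel)
      = ennreal \<bar>c\<bar> * (\<integral>\<^sup>+r. ennreal (0 + c * r) * f (Complex (0 + c * r) ((0 + c * r) * s)) * indicator {0<..} (0 + c * r) \<partial>lborel)"
      by (rule nn_integral_real_affine) (use c in auto)
    also have "\<dots> = ennreal c * (\<integral>\<^sup>+r. ennreal c * (ennreal r * f (of_real r * cis (arctan s)) * indicator {0<..} r) \<partial>lborel)"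
    proof -
      have "ennreal (0 + c * r) * f (Complex (0 + c * r) ((0 + c * r) * s)) * indicator {0<..} (0 + c * r)
         = ennreal c * (ennreal r * f (of_real r * cis (arctan s)) * indicator {0<..} r)" for r
      proof -
        have "Complex (c * r) (c * r * s) = of_real r * cis (arctan s)"
          by (simp add: complex_eq_iff c_def cos_arctan sin_arctan)
        then show ?thesis using c(1) by (auto simp: indicator_def ennreal_mult' mult.assoc zero_less_mult_iff)
      qed
      then show ?thesis using c(1) by simp
    qed
    also have "\<dots> = ennreal c * (ennreal c * radial f (arctan s))"
      unfolding radial_def by (subst nn_integral_cmult) (auto simp: cis_conv_exp)
    also have "\<dots> = radial f (arctan s) * ennreal (1 / (1 + s\<^sup>2))"
      using c by (simp add: mult.assoc[symmetric] ennreal_mult'[symmetric] mult.commute)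
    finally show "(\<integral>\<^sup>+x. ennreal x * f (Complex x (x * s)) * indicator {0<..} x \<partial>lborel)
      = radial f (arctan s) * ennreal (1 / (1 + s\<^sup>2))" .
  qed
  also have "\<dots> = (\<integral>\<^sup>+t. radial f t * indicator {-pi/2<..<pi/2} t \<partial>lborel)"
    by (rule nn_integral_arctan) simp
  finally show ?thesis .
qed

lemma nn_integral_shift:
  fixes g :: "real \<Rightarrow> ennreal"
  assumes [measurable]: "g \<in> borel_measurable borel"
  shows "(\<integral>\<^sup>+t. g (t + c) * indicator {a<..<b} t \<partial>lborel) = (\<integral>\<^sup>+t. g t * indicator {a + c<..<b + c} t \<partial>lborel)"
proof -
  have "(\<integral>\<^sup>+t. g t * indicator {a + c<..<b + c} t \<partial>lborel) = ennreal \<bar>1\<bar> * (\<integral>\<^sup>+t. g (c + 1 * t) * indicator {a + c<..<b + c} (c + 1 * t) \<partial>lborel)"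
    by (rule nn_integral_real_affine) auto
  also have "\<dots> = (\<integral>\<^sup>+t. g (t + c) * indicator {a<..<b} t \<partial>lborel)"
    by (auto simp: add.commute indicator_def intro!: nn_integral_cong)
  finally show ?thesis by simp
qed

lemma nn_integral_split:
  fixes g :: "real \<Rightarrow> ennreal"
  assumes [measurable]: "g \<in> borel_measurable borel" and "a \<le> b" "b \<le> c"
  shows "(\<integral>\<^sup>+t. g t * indicator {a<..<c} t \<partial>lborel)
    = (\<integral>\<^sup>+t. g t * indicator {a<..<b} t \<partial>lborel) + (\<integral>\<^sup>+t. g t * indicator {b<..<c} t \<partial>lborel)"
proof -
  have "(\<integral>\<^sup>+t. g t * indicator {a<..<c} t \<partial>lborel)
    = (\<integral>\<^sup>+t. g t * indicator {a<..<b} t + g t * indicator {b<..<c} t \<partial>lborel)"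
  proof (rule nn_integral_cong_AE)
    have "AE t in lborel. t \<noteq> b" by (rule AE_lborel_singleton)
    then show "AE t in lborel. g t * indicator {a<..<c} t = g t * indicator {a<..<b} t + g t * indicator {b<..<c} t"
      by eventually_elim (use assms in \<open>auto simp: indicator_def\<close>)
  qed
  then show ?thesis by (simp add: nn_integral_add)
qed

text \<open>The left half plane is the right one under negation, an angle shift by pi. The angles in
  (-pi/2, 0) are moved by 2 pi to arrive at the interval (0, 2 pi).\<close>

theorem nn_integral_polar:
  assumes [measurable]: "f \<in> borel_measurable borel"
  shows "(\<integral>\<^sup>+z. f z \<partial>lborel) = (\<integral>\<^sup>+t. radial f t * indicator {0<..<2*pi} t \<partial>lborel)"
proof -
  have Cm: "(\<lambda>p. f (Complex (g p) (h p))) \<in> borel_measurable M" if [measurable]: "g \<in> borel_measurable M" "h \<in> borel_measurable M" for g h and M :: "'z measure"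
    unfolding Complex_eq by measurable
  have Cx [measurable, simp]: "(\<lambda>y. f (Complex x y)) \<in> borel_measurable borel" for x
    by (rule Cm) measurable
  define G where "G x = (\<integral>\<^sup>+y. f (Complex x y) \<partial>lborel)" for x
  have Gm [measurable]: "G \<in> borel_measurable borel"
  proof -
    have "(\<lambda>x. \<integral>\<^sup>+y. (\<lambda>(x, y). f (Complex x y)) (x, y) \<partial>lborel) \<in> borel_measurable (borel :: real measure)"
      by (rule lborel.borel_measurable_nn_integral) (use Cm[of fst "borel \<Otimes>\<^sub>M lborel" snd] in \<open>simp add: split_beta\<close>)
    then show ?thesis by (simp add: G_def[abs_def])
  qed
  have "(\<integral>\<^sup>+z. f z \<partial>lborel) = (\<integral>\<^sup>+x. G x \<partial>lborel)"
    unfolding G_def by (rule nn_integral_complex) simp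
  also have "\<dots> = (\<integral>\<^sup>+x. G x * indicator {0<..} x + G x * indicator {..<0} x \<partial>lborel)"
  proof (rule nn_integral_cong_AE)
    have "AE x in lborel. x \<noteq> (0::real)" by (rule AE_lborel_singleton)
    then show "AE x in lborel. G x = G x * indicator {0<..} x + G x * indicator {..<0} x"
      by eventually_elim (auto simp: indicator_def)
  qed
  also have "\<dots> = (\<integral>\<^sup>+x. G x * indicator {0<..} x \<partial>lborel) + (\<integral>\<^sup>+x. G x * indicator {..<0} x \<partial>lborel)"
    by (rule nn_integral_add) auto
  also have "(\<integral>\<^sup>+x. G x * indicator {0<..} x \<partial>lborel) = (\<integral>\<^sup>+t. radial f t * indicator {-pi/2<..<pi/2} t \<partial>lborel)"
    unfolding nn_integral_right_half_plane[OF assms, symmetric] G_def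
    by (intro nn_integral_cong nn_integral_multc[symmetric]) (rule Cm; measurable)
  also have "(\<integral>\<^sup>+x. G x * indicator {..<0} x \<partial>lborel) = (\<integral>\<^sup>+t. radial f t * indicator {-pi/2+pi<..<pi/2+pi} t \<partial>lborel)"
  proof -
    have fm [measurable]: "(\<lambda>z. f (- z)) \<in> borel_measurable borel" by measurable
    have "(\<integral>\<^sup>+x. G x * indicator {..<0} x \<partial>lborel) = ennreal \<bar>-1\<bar> * (\<integral>\<^sup>+x. G (0 + -1 * x) * indicator {..<0} (0 + -1 * x) \<partial>lborel)"
      by (rule nn_integral_real_affine) auto
    also have "\<dots> = (\<integral>\<^sup>+x. G (- x) * indicator {0<..} x \<partial>lborel)"
      by (auto simp: indicator_def intro!: nn_integral_cong)
    also have "\<dots> = (\<integral>\<^sup>+x. \<integral>\<^sup>+y. f (- Complex x y) * indicator {0<..} x \<partial>lborel \<partial>lborel)"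
    proof (rule nn_integral_cong)
      fix x :: real
      have [measurable]: "(\<lambda>y. f (- Complex x y)) \<in> borel_measurable borel" unfolding Complex_eq by measurable
      have "G (- x) = ennreal \<bar>-1\<bar> * (\<integral>\<^sup>+y. f (Complex (- x) (0 + -1 * y)) \<partial>lborel)"
        unfolding G_def by (rule nn_integral_real_affine) (use Cm in auto)
      also have "\<dots> = (\<integral>\<^sup>+y. f (- Complex x y) \<partial>lborel)"
      proof -
        have "Complex (- x) (0 + -1 * y) = - Complex x y" for y by (simp add: complex_eq_iff)
        then show ?thesis by simp
      qed
      finally show "G (- x) * indicator {0<..} x = (\<integral>\<^sup>+y. f (- Complex x y) * indicator {0<..} x \<partial>lborel)"
        by (simp add: nn_integral_multc)
    qed
    also have "\<dots> = (\<integral>\<^sup>+t. radial (\<lambda>z. f (- z)) t * indicator {-pi/2<..<pi/2} t \<partial>lborel)"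
      by (rule nn_integral_right_half_plane[OF fm])
    also have "radial (\<lambda>z. f (- z)) = (\<lambda>t. radial f (t + pi))"
      by (intro ext) (simp add: radial_def cis_mult[symmetric])
    also have "(\<integral>\<^sup>+t. radial f (t + pi) * indicator {-pi/2<..<pi/2} t \<partial>lborel)
       = (\<integral>\<^sup>+t. radial f t * indicator {-pi/2+pi<..<pi/2+pi} t \<partial>lborel)"
      by (rule nn_integral_shift) simp
    finally show ?thesis .
  qed
  also have "(\<integral>\<^sup>+t. radial f t * indicator {-pi/2<..<pi/2} t \<partial>lborel)
     = (\<integral>\<^sup>+t. radial f t * indicator {-pi/2<..<0} t \<partial>lborel) + (\<integral>\<^sup>+t. radial f t * indicator {0<..<pi/2} t \<partial>lborel)"
    by (rule nn_integral_split) auto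
  also have "(\<integral>\<^sup>+t. radial f t * indicator {-pi/2<..<0} t \<partial>lborel) = (\<integral>\<^sup>+t. radial f t * indicator {-pi/2+2*pi<..<0+2*pi} t \<partial>lborel)"
  proof -
    have "radial f t = radial f (t + 2 * pi)" for t
      unfolding radial_def cis_mult[symmetric] by simp
    then have "(\<integral>\<^sup>+t. radial f t * indicator {-pi/2<..<0} t \<partial>lborel) = (\<integral>\<^sup>+t. radial f (t + 2 * pi) * indicator {-pi/2<..<0} t \<partial>lborel)"
      by (intro nn_integral_cong) metis
    also have "\<dots> = (\<integral>\<^sup>+t. radial f t * indicator {-pi/2+2*pi<..<0+2*pi} t \<partial>lborel)"
      by (rule nn_integral_shift) simp
    finally show ?thesis .
  qed
  finally have "(\<integral>\<^sup>+z. f z \<partial>lborel) = (\<integral>\<^sup>+t. radial f t * indicator {-pi/2+2*pi<..<0+2*pi} t \<partial>lborel)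
     + (\<integral>\<^sup>+t. radial f t * indicator {0<..<pi/2} t \<partial>lborel) + (\<integral>\<^sup>+t. radial f t * indicator {-pi/2+pi<..<pi/2+pi} t \<partial>lborel)" .
  moreover have "(\<integral>\<^sup>+t. radial f t * indicator {0<..<2*pi} t \<partial>lborel)
     = (\<integral>\<^sup>+t. radial f t * indicator {0<..<pi/2} t \<partial>lborel) + ((\<integral>\<^sup>+t. radial f t * indicator {-pi/2+pi<..<pi/2+pi} t \<partial>lborel)
     + (\<integral>\<^sup>+t. radial f t * indicator {-pi/2+2*pi<..<0+2*pi} t \<partial>lborel))"
  proof -
    have e: "-pi/2+pi = pi/2" "pi/2+pi = 3*pi/2" "-pi/2+2*pi = 3*pi/2" "0+2*pi = 2*pi" by simp_all
    show ?thesis unfolding e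
      by (subst nn_integral_split[of _ 0 "pi/2"], simp, simp, simp, subst nn_integral_split[of _ "pi/2" "3*pi/2" "2*pi"]) auto
  qed
  ultimately show ?thesis by (simp add: ac_simps)
qed


subsection \<open>Analytic Riesz products\<close>

lemma norm_power_diff_one:
  fixes u :: complex
  shows "cmod ((1 + u) ^ n - 1) \<le> (1 + cmod u) ^ n - 1"
proof (induction n)
  case (Suc n)
  have "(1 + u) ^ Suc n - 1 = (1 + u) * ((1 + u) ^ n - 1) + u" by (simp add: algebra_simps)
  also have "cmod \<dots> \<le> cmod (1 + u) * cmod ((1 + u) ^ n - 1) + cmod u"
    by (rule order_trans[OF norm_triangle_ineq]) (simp add: norm_mult)
  also have "\<dots> \<le> (1 + cmod u) * ((1 + cmod u) ^ n - 1) + cmod u"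
    using norm_triangle_ineq[of 1 u] Suc by (intro add_right_mono mult_mono) auto
  also have "\<dots> = (1 + cmod u) ^ Suc n - 1" by (simp add: algebra_simps)
  finally show ?case .
qed simp

lemma norm_power_diff_le:
  fixes u :: complex
  assumes "real n * cmod u \<le> x" "x \<le> 1"
  shows "cmod ((1 + u) ^ n - 1) \<le> 2 * x"
proof -
  have x0: "0 \<le> x" by (rule order_trans[OF _ assms(1)]) simp
  have "(1 + cmod u) ^ n \<le> exp (cmod u) ^ n" by (intro power_mono) auto
  also have "\<dots> = exp (real n * cmod u)" by (simp add: exp_of_nat_mult)
  also have "\<dots> \<le> exp x" using assms by simp
  also have "\<dots> \<le> 1 + x + x\<^sup>2" by (rule exp_bound[OF x0 assms(2)])
  also have "\<dots> \<le> 1 + 2 * x" using x0 assms(2) by (simp add: power2_eq_square mult_left_le)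
  finally show ?thesis using norm_power_diff_one[of u n] by linarith
qed

text \<open>\<open>b k\<close> is to be a small multiple of w at q^-k, and \<rho> bounds the ratio
  of neighbours. By \<open>4 * \<rho> \<le> real q\<close> the frequencies q^k outgrow the decay of
  \<open>b\<close> and also a factor 2 per level lost in the product, so sums over lower levels are
  geometric with ratio 1/2. \<open>8 \<le> q\<close> gives lacunarity, and 1/256 keeps the
  accumulated perturbation in \<open>H_estimate\<close> below a quarter.\<close>

locale riesz =
  fixes q :: nat and b :: "nat \<Rightarrow> real" and \<rho> :: real
  assumes q8: "8 \<le> q" and b_nonneg: "\<And>k. 0 \<le> b k" and b_dec: "\<And>k. b (Suc k) \<le> b k"
    and b0: "b 0 \<le> 1/256" and growth: "\<And>k. b k \<le> \<rho> * b (Suc k)" and rho: "0 \<le> \<rho>" "4 * \<rho> \<le> real q"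
begin

lemma b_anti: "i \<le> j \<Longrightarrow> b j \<le> b i"
  by (rule lift_Suc_antimono_le[of b]) (rule b_dec)

lemma b_small: "b k \<le> 1/256" using b_anti[of 0 k] b0 by simp

lemma growth_iter: "b k \<le> \<rho> ^ m * b (k + m)"
proof (induction m)
  case (Suc m)
  have "\<rho> ^ m * b (k + m) \<le> \<rho> ^ m * (\<rho> * b (Suc (k + m)))"
    using rho growth by (intro mult_left_mono) auto
  then show ?case using Suc by (simp add: mult_ac)
qed simp

definition N :: "nat \<Rightarrow> nat" where "N k = q ^ k"

lemma N_pos [simp]: "0 < N k" using q8 by (simp add: N_def)
lemma N_Suc: "N (Suc k) = q * N k" by (simp add: N_def)
lemma N_add: "N (k + m) = N k * q ^ m" by (simp add: N_def power_add)

text \<open>Consequently the exponent in \<open>T\<close> is positive, the truncated subtraction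
  there is a true one, and the exponent exceeds half of \<open>N j\<close>.\<close>

lemma N_sum: "7 * (\<Sum>i<k. N i) < N k"
proof (induction k)
  case 0 then show ?case by (simp add: N_def)
next
  case (Suc k)
  have "7 * (\<Sum>i<Suc k. N i) < N k + 7 * N k" using Suc by simp
  also have "\<dots> \<le> q * N k" using q8 by (simp add: mult_right_mono add_mult_distrib[symmetric] flip: mult_Suc)
  finally show ?case by (simp add: N_Suc)
qed

text \<open>The factor \<open>fac i\<close> multiplied by \<open>w ^ N i\<close>, which clears the
  negative power.\<close>

definition g :: "nat \<Rightarrow> complex \<Rightarrow> complex" where
  "g i w = w ^ N i + of_real (b i / 2) * (w ^ (2 * N i) + 1)"

text \<open>Holomorphic continuation of the Riesz factor 1 + b_i Re (w^(N i)) from the unit circle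
  to the punctured plane.\<close>

definition fac :: "nat \<Rightarrow> complex \<Rightarrow> complex" where
  "fac i w = 1 + of_real (b i / 2) * (w ^ N i + inverse w ^ N i)"

text \<open>Polynomial form of b_j w^(N j) times the product of the \<open>fac i\<close> with i < j.
  On the circle its real part is the increment of the Riesz product from \<open>j\<close> to
  \<open>Suc j\<close>, so the sums \<open>H\<close> telescope.\<close>

definition T :: "nat \<Rightarrow> complex \<Rightarrow> complex" where
  "T j w = of_real (b j) * w ^ (N j - (\<Sum>i<j. N i)) * (\<Prod>i<j. g i w)"

definition H :: "nat \<Rightarrow> complex \<Rightarrow> complex" where
  "H n w = 1 + (\<Sum>j<n. T j w)"

definition p :: "nat \<Rightarrow> complex \<Rightarrow> real" where
  "p k \<zeta> = (\<Prod>i<k. 1 + b i * Re (\<zeta> ^ N i))"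

lemma T_hol: "T j holomorphic_on A"
  unfolding T_def[abs_def] g_def[abs_def] by (intro holomorphic_intros)

lemma H_hol: "H n holomorphic_on A"
  unfolding H_def[abs_def] by (intro holomorphic_intros T_hol)

lemma g_fac: "w \<noteq> 0 \<Longrightarrow> g i w = w ^ N i * fac i w"
  by (simp add: g_def fac_def algebra_simps power_mult power2_eq_square mult_2 power_add power_inverse)

lemma prod_g_fac: "w \<noteq> 0 \<Longrightarrow> (\<Prod>i<k. g i w) = w ^ (\<Sum>i<k. N i) * (\<Prod>i<k. fac i w)"
  by (simp add: g_fac prod.distrib power_sum)

text \<open>At a scale \<open>k\<close> the lower factors are kept as \<open>fac\<close>, comparable
  with the Riesz product near the circle, and the higher ones as \<open>g\<close>, bounded on the
  disc.\<close>

lemma T_split: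
  assumes "k \<le> j" "w \<noteq> 0 \<or> k = 0"
  shows "T j w = of_real (b j) * w ^ (N j - (\<Sum>i\<in>{k..<j}. N i)) * (\<Prod>i\<in>{k..<j}. g i w) * (\<Prod>i<k. fac i w)"
proof -
  have s: "(\<Sum>i<j. N i) = (\<Sum>i<k. N i) + (\<Sum>i\<in>{k..<j}. N i)"
    using sum.atLeastLessThan_concat[of 0 k j N] assms by (simp add: atLeast0LessThan)
  have pr: "(\<Prod>i<j. g i w) = (\<Prod>i<k. g i w) * (\<Prod>i\<in>{k..<j}. g i w)"
    using prod.atLeastLessThan_concat[of 0 k j "\<lambda>i. g i w"] assms by (simp add: atLeast0LessThan)
  have pg: "(\<Prod>i<k. g i w) = w ^ (\<Sum>i<k. N i) * (\<Prod>i<k. fac i w)"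
    using assms(2) prod_g_fac[of w k] by auto
  have e: "N j - (\<Sum>i\<in>{k..<j}. N i) = (N j - (\<Sum>i<j. N i)) + (\<Sum>i<k. N i)"
    using N_sum[of j] s by linarith
  show ?thesis unfolding T_def pr pg e power_add by (simp add: mult_ac)
qed

lemma fac_circle: "cmod \<zeta> = 1 \<Longrightarrow> fac i \<zeta> = of_real (1 + b i * Re (\<zeta> ^ N i))"
proof -
  assume "cmod \<zeta> = 1"
  then have "\<zeta> * cnj \<zeta> = 1" using complex_norm_square[of \<zeta>] by simp
  then have "inverse \<zeta> = cnj \<zeta>" by (rule inverse_unique)
  then have "\<zeta> ^ N i + inverse \<zeta> ^ N i = of_real (2 * Re (\<zeta> ^ N i))"
    using complex_add_cnj[of "\<zeta> ^ N i"] by simp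
  then show ?thesis unfolding fac_def by simp
qed

lemma fac_pos: "cmod \<zeta> = 1 \<Longrightarrow> 1/2 \<le> 1 + b i * Re (\<zeta> ^ N i)" "cmod \<zeta> = 1 \<Longrightarrow> 1 - b i \<le> 1 + b i * Re (\<zeta> ^ N i)"
proof -
  assume z: "cmod \<zeta> = 1"
  have "- 1 \<le> Re (\<zeta> ^ N i)" using complex_Re_le_cmod[of "- (\<zeta> ^ N i)"] z by (simp add: norm_power)
  then have "b i * (- 1) \<le> b i * Re (\<zeta> ^ N i)" by (intro mult_left_mono b_nonneg)
  then show "1 - b i \<le> 1 + b i * Re (\<zeta> ^ N i)" by simp
  then show "1/2 \<le> 1 + b i * Re (\<zeta> ^ N i)" using b_small[of i] by simp
qed

lemma p_pos: "cmod \<zeta> = 1 \<Longrightarrow> 0 < p k \<zeta>"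
  unfolding p_def by (intro prod_pos) (use fac_pos(1) in \<open>force intro: less_le_trans[of 0 "1/2"]\<close>)

text \<open>Every factor of the Riesz product is at least 1/2.\<close>

lemma p_le: assumes "cmod \<zeta> = 1" "j \<le> k" shows "p j \<zeta> \<le> 2 ^ (k - j) * p k \<zeta>"
  using assms(2)
proof (induction k rule: dec_induct)
  case base then show ?case by simp
next
  case (step k)
  have "p k \<zeta> * (1/2) \<le> p k \<zeta> * (1 + b k * Re (\<zeta> ^ N k))"
    using fac_pos(1)[OF assms(1)] p_pos[OF assms(1)] by (intro mult_left_mono) (auto simp: less_imp_le)
  then have "p k \<zeta> \<le> 2 * p (Suc k) \<zeta>" by (simp add: p_def)
  then have "2 ^ (k - j) * p k \<zeta> \<le> 2 ^ (k - j) * (2 * p (Suc k) \<zeta>)" by (intro mult_left_mono) auto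
  moreover have "2 ^ (k - j) * (2 * p (Suc k) \<zeta>) = 2 ^ (Suc k - j) * p (Suc k) \<zeta>"
    using step by (simp add: Suc_diff_le)
  ultimately show ?case using step by linarith
qed

lemma H_circle: assumes "cmod \<zeta> = 1" shows "Re (H n \<zeta>) = p n \<zeta>"
proof (induction n)
  case 0 then show ?case by (simp add: H_def p_def)
next
  case (Suc n)
  have z: "\<zeta> \<noteq> 0" using assms by auto
  have "(\<Prod>i<n. fac i \<zeta>) = of_real (p n \<zeta>)" unfolding p_def using fac_circle[OF assms] by simp
  then have "T n \<zeta> = of_real (b n * p n \<zeta>) * \<zeta> ^ N n"
    using T_split[of n n \<zeta>] z by (simp add: mult_ac)
  then have "Re (T n \<zeta>) = b n * p n \<zeta> * Re (\<zeta> ^ N n)" by simp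
  then show ?case using Suc by (simp add: H_def p_def algebra_simps)
qed

text \<open>Put w = \<zeta> (1 + u) with |u| <= 2 / N k. Then N i |u| is small, so w^(N i) and its
  inverse stay close to their values at \<zeta>; the lower bound 1/2 for the factor on the circle
  turns the absolute error into a relative one.\<close>

lemma fac_near:
  assumes z: "cmod \<zeta> = 1" and w: "cmod (w - \<zeta>) \<le> 2 / N k" and i: "i < k"
  shows "cmod (fac i w) \<le> (1 + b i * Re (\<zeta> ^ N i)) * (1 + 12 * b i * (N i / N k))"
proof -
  define u where "u = (w - \<zeta>) / \<zeta>"
  define x where "x = 2 * (N i / N k)"
  have z0: "\<zeta> \<noteq> 0" using z by auto
  have w_eq: "w = \<zeta> * (1 + u)" using z0 by (simp add: u_def field_simps)
  have cu: "cmod u \<le> 2 / N k" using w z by (simp add: u_def norm_divide)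
  have "real (N i) * cmod u \<le> real (N i) * (2 / N k)" using cu by (intro mult_left_mono) auto
  then have xu: "real (N i) * cmod u \<le> x" by (simp add: x_def mult.commute)
  have "q * N i \<le> N k"
  proof -
    have "N (Suc i) \<le> N k" unfolding N_def using i q8 by (intro power_increasing) auto
    then show ?thesis by (simp add: N_Suc)
  qed
  then have "8 * N i \<le> N k" using q8 by (meson le_trans mult_le_mono1)
  then have "8 * real (N i) \<le> real (N k)" by (metis of_nat_le_iff of_nat_mult of_nat_numeral)
  then have x4: "x \<le> 1/4" by (simp add: x_def field_simps)
  define D where "D = cmod ((1 + u) ^ N i - 1)"
  have D: "D \<le> 2 * x" unfolding D_def by (rule norm_power_diff_le[OF xu]) (use x4 in simp)
  have lower: "1/2 \<le> cmod ((1 + u) ^ N i)"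
    using norm_triangle_ineq2[of 1 "1 - (1 + u) ^ N i"] D x4 unfolding D_def by (simp add: norm_minus_commute)
  have nz: "(1 + u) ^ N i \<noteq> 0"
  proof
    assume "(1 + u) ^ N i = 0"
    then show False using lower by (simp only: norm_zero)
  qed
  have "cmod (inverse (1 + u) ^ N i - 1) = D / cmod ((1 + u) ^ N i)"
  proof -
    have "inverse (1 + u) ^ N i - 1 = (1 - (1 + u) ^ N i) / (1 + u) ^ N i"
      using nz by (simp add: power_inverse field_simps)
    then show ?thesis unfolding D_def by (simp add: norm_divide norm_minus_commute)
  qed
  also have "\<dots> \<le> (2 * x) / (1/2)" by (rule frac_le) (use D lower in \<open>auto simp: D_def x_def\<close>)
  finally have D2: "cmod (inverse (1 + u) ^ N i - 1) \<le> 4 * x" by simp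
  have "fac i w - fac i \<zeta> = of_real (b i / 2) * (\<zeta> ^ N i * ((1 + u) ^ N i - 1) + inverse \<zeta> ^ N i * (inverse (1 + u) ^ N i - 1))"
    unfolding fac_def w_eq inverse_mult_distrib power_mult_distrib by (simp only: ring_distribs) simp
  also have "cmod \<dots> \<le> b i / 2 * (D + cmod (inverse (1 + u) ^ N i - 1))"
    unfolding norm_mult D_def using z b_nonneg[of i]
    by (intro mult_mono order_trans[OF norm_triangle_ineq]) (auto simp: norm_mult norm_power norm_inverse)
  also have "\<dots> \<le> b i / 2 * (6 * x)" using D D2 b_nonneg[of i] by (intro mult_left_mono) auto
  finally have "cmod (fac i w) \<le> cmod (fac i \<zeta>) + 3 * b i * x"
    using norm_triangle_ineq2[of "fac i w" "fac i \<zeta>"] by (simp add: algebra_simps)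
  also have "cmod (fac i \<zeta>) = 1 + b i * Re (\<zeta> ^ N i)"
    unfolding fac_circle[OF z] norm_of_real using fac_pos(1)[OF z, of i] by simp
  also have "3 * b i * x \<le> (1 + b i * Re (\<zeta> ^ N i)) * (12 * b i * (N i / N k))"
  proof -
    have "(1/2) * (12 * b i * (N i / N k)) \<le> (1 + b i * Re (\<zeta> ^ N i)) * (12 * b i * (N i / N k))"
      by (intro mult_right_mono fac_pos(1)[OF z]) (use b_nonneg[of i] in auto)
    then show ?thesis by (simp add: x_def)
  qed
  finally show ?thesis by (simp add: algebra_simps)
qed

text \<open>The relative errors add up to at most 12/256, because the frequencies below
  \<open>N k\<close> sum to less than \<open>N k\<close>.\<close>

lemma prod_fac_near:
  assumes z: "cmod \<zeta> = 1" and w: "cmod (w - \<zeta>) \<le> 2 / N k"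
  shows "(\<Prod>i<k. cmod (fac i w)) \<le> 2 * p k \<zeta>"
proof -
  have "(\<Prod>i<k. cmod (fac i w)) \<le> (\<Prod>i<k. (1 + b i * Re (\<zeta> ^ N i)) * (1 + 12 * b i * (N i / N k)))"
    by (rule prod_mono) (use fac_near[OF z w] in auto)
  also have "\<dots> = p k \<zeta> * (\<Prod>i<k. 1 + 12 * b i * (N i / N k))" by (simp add: prod.distrib p_def)
  also have "(\<Prod>i<k. 1 + 12 * b i * (N i / N k)) \<le> (\<Prod>i<k. exp (12 * b i * (N i / N k)))"
    by (rule prod_mono) (use b_nonneg in \<open>auto intro!: add_nonneg_nonneg mult_nonneg_nonneg\<close>)
  also have "\<dots> = exp (\<Sum>i<k. 12 * b i * (N i / N k))" by (simp add: exp_sum)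
  also have "(\<Sum>i<k. 12 * b i * (N i / N k)) \<le> (\<Sum>i<k. 12 / 256 * (N i / N k))"
  proof (intro sum_mono mult_right_mono)
    show "12 * b i \<le> 12 / 256" for i using b_small[of i] by simp
  qed auto
  also have "\<dots> = 12/256 * (real (\<Sum>i<k. N i) / N k)" by (simp add: sum_distrib_left sum_divide_distrib)
  also have "\<dots> \<le> 12/256 * 1"
  proof (intro mult_left_mono)
    have "(\<Sum>i<k. N i) \<le> N k" using N_sum[of k] by linarith
    then show "real (\<Sum>i<k. N i) / N k \<le> 1" by (simp only: of_nat_le_iff divide_le_eq_1_pos of_nat_0_less_iff N_pos)
  qed simp
  finally have "(\<Prod>i<k. cmod (fac i w)) \<le> p k \<zeta> * exp (12/256)"
    using p_pos[OF z, of k] by (simp add: mult_left_mono)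
  also have "\<dots> \<le> p k \<zeta> * 2"
  proof (intro mult_left_mono)
    have "exp (12/256 :: real) \<le> 1 + 12/256 + (12/256)\<^sup>2" by (rule exp_bound) auto
    then show "exp (12/256 :: real) \<le> 2" by (simp add: power2_eq_square)
  qed (use p_pos[OF z, of k] in simp)
  finally show ?thesis by simp
qed

lemma T_low:
  assumes z: "cmod \<zeta> = 1" and w: "cmod (w - \<zeta>) \<le> 2 / N j"
  shows "cmod (T j w) \<le> 16 * b j * p j \<zeta>"
proof -
  \<comment> \<open>The form with \<open>fac\<close> needs w nonzero. For j > 0 the disc of radius 2
    / N j about \<zeta> misses 0, since N j >= 8.\<close>
  have "w \<noteq> 0 \<or> j = 0"
  proof (rule ccontr)
    assume "\<not> (w \<noteq> 0 \<or> j = 0)"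
    then have "w = 0" "j > 0" by auto
    then have "1 \<le> 2 / N j" using w z by simp
    moreover have "8 \<le> N j"
      using self_le_power[of q j] q8 \<open>j > 0\<close> by (simp add: N_def)
    then have "2 / N j \<le> 2 / 8" by (intro divide_left_mono) auto
    ultimately show False by simp
  qed
  then have "T j w = of_real (b j) * w ^ N j * (\<Prod>i<j. fac i w)" using T_split[of j j w] by simp
  then have "cmod (T j w) = b j * cmod w ^ N j * (\<Prod>i<j. cmod (fac i w))"
    using b_nonneg[of j] by (simp add: norm_mult norm_power prod_norm)
  also have "\<dots> \<le> b j * 8 * (2 * p j \<zeta>)"
  proof (intro mult_mono prod_fac_near[OF z w])
    have "cmod w \<le> 1 + 2 / N j" using norm_triangle_ineq2[of w \<zeta>] w z by linarith
    then have "cmod w ^ N j \<le> (1 + 2 / N j) ^ N j" by (intro power_mono) auto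
    also have "\<dots> \<le> exp (2 / N j) ^ N j" by (intro power_mono) auto
    also have "\<dots> = exp (real (N j) * (2 / N j))" by (rule exp_of_nat_mult[symmetric])
    also have "\<dots> = exp 1 * exp 1" by (simp flip: exp_add)
    also have "\<dots> \<le> (2.8::real) * 2.8" using e_less_272 by (intro mult_mono) auto
    also have "\<dots> \<le> 8" by simp
    finally show "cmod w ^ N j \<le> 8" .
  qed (use b_nonneg p_pos[OF z, of j] in \<open>auto intro!: prod_nonneg mult_nonneg_nonneg\<close>)
  finally show ?thesis by simp
qed

lemma deriv_T_low:
  assumes z: "cmod \<zeta> = 1" and w: "cmod (w - \<zeta>) \<le> 1 / N j"
  shows "cmod (deriv (T j) w) \<le> 16 * b j * p j \<zeta> * N j"
proof -
  have "cmod ((deriv ^^ 1) (T j) w) \<le> fact 1 * (16 * b j * p j \<zeta>) / (1 / N j) ^ 1"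
  proof (rule Cauchy_inequality)
    fix x assume "cmod (w - x) = 1 / N j"
    then have "cmod (x - \<zeta>) \<le> 1 / N j + 1 / N j"
      using norm_triangle_ineq[of "x - w" "w - \<zeta>"] w by (simp add: norm_minus_commute)
    then show "cmod (T j x) \<le> 16 * b j * p j \<zeta>" by (intro T_low[OF z]) simp
  qed (auto intro!: T_hol holomorphic_on_imp_continuous_on)
  then show ?thesis by simp
qed

text \<open>At depth \<delta> >= 1 / N (Suc k) the power of w in the term j = k + 1 + m is at most
  exp (- 8^m / 4) <= 4 / 8^m, which beats the m + 1 factors \<open>g\<close>, each at most
  2.\<close>

lemma T_high:
  fixes \<delta> :: real
  assumes z: "cmod \<zeta> = 1" and w: "cmod (w - \<zeta>) \<le> 2 / N k" "cmod w \<le> 1 - \<delta> / 2"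
    and d: "0 < \<delta>" "\<delta> \<le> 1" "1 \<le> N (Suc k) * \<delta>" and k: "k < j"
  shows "cmod (T j w) \<le> 16 * b k * p k \<zeta> * (1/4) ^ (j - Suc k)"
proof -
  define m where "m = j - Suc k"
  have j: "j = Suc k + m" using k by (simp add: m_def)
  have w0: "w \<noteq> 0 \<or> k = 0"
  proof (rule ccontr)
    assume "\<not> (w \<noteq> 0 \<or> k = 0)"
    then have "w = 0" "k > 0" by auto
    then have "1 \<le> 2 / N k" using w z by simp
    moreover have "8 \<le> N k" using self_le_power[of q k] q8 \<open>k > 0\<close> by (simp add: N_def)
    then have "2 / N k \<le> 2 / 8" by (intro divide_left_mono) auto
    ultimately show False by simp
  qed
  have w1: "cmod w \<le> 1" using w(2) d(1) by simp
  have sub: "(\<Sum>i\<in>{k..<j}. N i) \<le> (\<Sum>i<j. N i)" by (intro sum_mono2) auto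
  define e where "e = N j - (\<Sum>i\<in>{k..<j}. N i)"
  have e: "N j \<le> 2 * e" using N_sum[of j] sub unfolding e_def by linarith
  have "(1 - \<delta> / 2) ^ e \<le> exp (- (\<delta> / 2)) ^ e"
    using exp_ge_add_one_self[of "- (\<delta> / 2)"] d by (intro power_mono) auto
  also have "\<dots> = exp (- (real e * \<delta> / 2))" by (simp add: exp_of_nat_mult[symmetric])
  also have "\<dots> \<le> exp (- (8 ^ m / 4))"
  proof -
    have "(8::real) ^ m \<le> real q ^ m" using q8 by (intro power_mono) auto
    also have "\<dots> = real q ^ m * 1" by simp
    also have "\<dots> \<le> real q ^ m * (N (Suc k) * \<delta>)" using d(3) by (intro mult_left_mono) auto
    also have "\<dots> = real (N j) * \<delta>" unfolding j N_add by simp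
    also have "\<dots> \<le> (2 * e) * \<delta>" using e d(1) by (intro mult_right_mono) (simp_all only: of_nat_le_iff less_imp_le)
    finally show ?thesis by simp
  qed
  also have "\<dots> \<le> 4 * (1/8) ^ m"
  proof -
    have "(8 ^ m / 4) * exp (- (8 ^ m / 4)) \<le> exp (8 ^ m / 4) * exp (- (8 ^ m / 4 :: real))"
      using exp_ge_add_one_self[of "8 ^ m / 4"] by (intro mult_right_mono) (linarith | simp)+
    then have "(8 ^ m / 4) * exp (- (8 ^ m / 4)) \<le> (1::real)" by (simp flip: exp_add)
    then show ?thesis by (simp add: field_simps)
  qed
  finally have ew: "(1 - \<delta> / 2) ^ e \<le> 4 * (1/8) ^ m" .
  have g2: "cmod (g i w) \<le> 2" for i
  proof -
    have "cmod (g i w) \<le> cmod w ^ N i + b i / 2 * (cmod w ^ (2 * N i) + 1)"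
      unfolding g_def using b_nonneg[of i]
      by (auto simp: norm_mult norm_power intro!: order_trans[OF norm_triangle_ineq] add_mono mult_left_mono)
    also have "\<dots> \<le> 1 + b i / 2 * (1 + 1)"
      using w1 b_nonneg[of i] by (intro add_mono mult_left_mono power_le_one) auto
    finally show ?thesis using b_small[of i] by simp
  qed
  have "cmod (T j w) = b j * cmod w ^ e * (\<Prod>i\<in>{k..<j}. cmod (g i w)) * (\<Prod>i<k. cmod (fac i w))"
    unfolding T_split[OF less_imp_le[OF k] w0] e_def using b_nonneg[of j] by (simp add: norm_mult norm_power prod_norm)
  also have "\<dots> \<le> b k * (4 * (1/8) ^ m) * (\<Prod>i\<in>{k..<j}. 2) * (2 * p k \<zeta>)"
  proof (intro mult_mono prod_fac_near[OF z w(1)] prod_mono conjI g2)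
    show "b j \<le> b k" using k by (intro b_anti) simp
    have "cmod w ^ e \<le> (1 - \<delta> / 2) ^ e" using w(2) by (intro power_mono) auto
    then show "cmod w ^ e \<le> 4 * (1/8) ^ m" using ew by linarith
  qed (use b_nonneg p_pos[OF z, of k] in \<open>auto intro!: prod_nonneg mult_nonneg_nonneg\<close>)
  also have "\<dots> = 16 * b k * p k \<zeta> * (1/4) ^ m"
  proof -
    have "(\<Prod>i\<in>{k..<j}. 2::real) = 2 * 2 ^ m" unfolding j by simp
    moreover have "(1/8::real) ^ m * 2 ^ m = (1/4) ^ m" by (simp flip: power_mult_distrib)
    ultimately show ?thesis by (simp add: mult_ac)
  qed
  finally show ?thesis by (simp add: m_def)
qed

lemma geom_sum_le: "0 \<le> x \<Longrightarrow> x < 1 \<Longrightarrow> (\<Sum>i<n. x ^ i) \<le> 1 / (1 - x)" for x :: real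
  using sum_le_suminf[of "\<lambda>i. x ^ i" "{..<n}"] suminf_geometric[of x] summable_geometric[of x] by simp

text \<open>The level \<open>k\<close> is tied to the depth 1 - r. Terms with j <= k vary little
  between \<zeta> and r \<zeta>, terms with j > k are damped there, and both effects are at most a
  multiple of \<open>b k * P\<close>. Thus H behaves like the Riesz product stopped at level
  \<open>k\<close>, or at \<open>n\<close> when there are fewer factors.\<close>

theorem H_estimate:
  fixes n :: nat and r :: real
  assumes r: "0 \<le> r" "r < 1" and z: "cmod \<zeta> = 1" and k: "N k * (1 - r) \<le> 1" "1 \<le> N (Suc k) * (1 - r)"
  defines "P \<equiv> p (min k n) \<zeta>"
  shows "0 < P" "(1 - r) * cmod (deriv (H n) (of_real r * \<zeta>)) \<le> 80 * b k * P" "P / 2 \<le> Re (H n (of_real r * \<zeta>))"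
proof -
  define \<delta> where "\<delta> = 1 - r"
  define w where "w = of_real r * \<zeta>"
  have d: "0 < \<delta>" "\<delta> \<le> 1" using r by (auto simp: \<delta>_def)
  have cw: "cmod w = 1 - \<delta>" using r z by (simp add: w_def norm_mult \<delta>_def)
  have wz: "cmod (w - \<zeta>) = \<delta>"
  proof -
    have "w - \<zeta> = of_real (r - 1) * \<zeta>" by (simp add: w_def algebra_simps)
    then show ?thesis using z r by (simp only: norm_mult norm_of_real \<delta>_def) simp
  qed
  have dk: "\<delta> \<le> 1 / N k" using k(1) by (simp add: \<delta>_def field_simps)
  show P0: "0 < P" unfolding P_def by (rule p_pos[OF z])
  have Pk: "p k \<zeta> = P" if "k < n" using that by (simp add: P_def min_def)
  \<comment> \<open>The indices below \<open>J\<close> are those with j <= k among the first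
    \<open>n\<close>.\<close>
  define J where "J = min (Suc k) n"
  \<comment> \<open>Going down m = k - j levels loses \<rho>^m in \<open>b\<close> and 2^m in
    \<open>p\<close>, and gains q^-m in \<open>N j\<close>; the net factor is (2 \<rho> / q)^m <=
    2^-m.\<close>
  have low: "16 * b j * p j \<zeta> * N j * \<delta> \<le> 16 * b k * P * (1/2) ^ (k - j)" if "j < J" for j
  proof -
    define m where "m = k - j"
    have km: "k = j + m" using that by (simp add: J_def m_def)
    have "p j \<zeta> \<le> 2 ^ (min k n - j) * P" unfolding P_def by (rule p_le[OF z]) (use that in \<open>auto simp: J_def\<close>)
    also have "\<dots> \<le> 2 ^ m * P" using P0 by (intro mult_right_mono power_increasing) (auto simp: m_def)
    finally have pj: "p j \<zeta> \<le> 2 ^ m * P" .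
    have bj: "b j \<le> \<rho> ^ m * b k" unfolding km by (rule growth_iter)
    have "real q ^ m * (N j * \<delta>) \<le> 1" using k(1) unfolding \<delta>_def km N_add by (simp add: mult_ac)
    then have Nj: "N j * \<delta> \<le> (1 / real q) ^ m" using q8 by (simp add: field_simps power_divide)
    have "(b j * p j \<zeta>) * (N j * \<delta>) \<le> ((\<rho> ^ m * b k) * (2 ^ m * P)) * (1 / real q) ^ m"
      using bj pj Nj b_nonneg p_pos[OF z, of j] P0 rho d by (intro mult_mono) (auto intro!: mult_nonneg_nonneg simp: less_imp_le)
    also have "\<dots> = b k * P * (2 * \<rho> / q) ^ m" by (simp add: power_mult_distrib power_divide)
    also have "\<dots> \<le> b k * P * (1/2) ^ m"
    proof (intro mult_left_mono power_mono)
      show "2 * \<rho> / q \<le> 1/2" using rho q8 by (simp add: field_simps)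
    qed (use rho b_nonneg[of k] P0 in auto)
    finally show ?thesis by (simp add: m_def mult_ac)
  qed
  have lowsum: "(\<Sum>j<J. 16 * b j * p j \<zeta> * N j * \<delta>) \<le> 32 * b k * P"
  proof -
    have "(\<Sum>j<J. 16 * b j * p j \<zeta> * N j * \<delta>) \<le> (\<Sum>j<J. 16 * b k * P * (1/2) ^ (k - j))"
      by (intro sum_mono low) auto
    also have "\<dots> \<le> (\<Sum>j<Suc k. 16 * b k * P * (1/2) ^ (k - j))"
      using b_nonneg[of k] P0 by (intro sum_mono2) (auto simp: J_def)
    also have "\<dots> = 16 * b k * P * (\<Sum>j<Suc k. (1/2) ^ (k - j))" by (rule sum_distrib_left[symmetric])
    also have "(\<Sum>j<Suc k. (1/2::real) ^ (k - j)) = (\<Sum>j<Suc k. (1/2) ^ j)"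
      using sum.nat_diff_reindex[of "\<lambda>j. (1/2::real) ^ j" "Suc k"] by simp
    also have "\<dots> \<le> 2" using geom_sum_le[of "1/2" "Suc k"] by simp
    finally show ?thesis using b_nonneg[of k] P0 by (simp add: mult_left_mono)
  qed
  have wlow: "cmod (w' - \<zeta>) \<le> 1 / N j" if "cmod (w' - \<zeta>) \<le> \<delta>" "j < J" for j w'
  proof -
    have "N j \<le> N k" unfolding N_def using that q8 by (intro power_increasing) (auto simp: J_def)
    then have "1 / real (N k) \<le> 1 / N j" by (intro divide_left_mono) auto
    then show ?thesis using that dk by linarith
  qed
  have dlow: "\<delta> * cmod (deriv (T j) w') \<le> 16 * b j * p j \<zeta> * N j * \<delta>" if "cmod (w' - \<zeta>) \<le> \<delta>" "j < J" for j w'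
    using deriv_T_low[OF z wlow[OF that]] d by (simp add: mult.commute[of \<delta>] mult_right_mono)
  have near: "cmod (x - \<zeta>) \<le> 2 / N k" "cmod x \<le> 1 - \<delta> / 2" if "cmod (w - x) \<le> \<delta> / 2" for x
  proof -
    have "cmod (x - \<zeta>) \<le> \<delta> / 2 + \<delta>"
      using norm_triangle_ineq[of "x - w" "w - \<zeta>"] wz that by (simp add: norm_minus_commute)
    then show "cmod (x - \<zeta>) \<le> 2 / N k" using dk d by simp
    show "cmod x \<le> 1 - \<delta> / 2"
      using norm_triangle_ineq[of "x - w" w] cw that by (simp add: norm_minus_commute)
  qed
  have high: "cmod (T j x) \<le> 16 * b k * P * (1/4) ^ (j - Suc k)" if "cmod (w - x) \<le> \<delta> / 2" "J \<le> j" "j < n" for j x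
  proof -
    have "k < j" "k < n" using that by (auto simp: J_def)
    have "1 \<le> N (Suc k) * \<delta>" using k(2) by (simp add: \<delta>_def)
    from T_high[OF z near[OF that(1)] d this \<open>k < j\<close>] show ?thesis using Pk[OF \<open>k < n\<close>] by simp
  qed
  have dhigh: "\<delta> * cmod (deriv (T j) w) \<le> 32 * b k * P * (1/4) ^ (j - Suc k)" if "J \<le> j" "j < n" for j
  proof -
    have "cmod ((deriv ^^ 1) (T j) w) \<le> fact 1 * (16 * b k * P * (1/4) ^ (j - Suc k)) / (\<delta> / 2) ^ 1"
      by (rule Cauchy_inequality) (use d high that in \<open>auto intro!: T_hol holomorphic_on_imp_continuous_on\<close>)
    then show ?thesis using d by (simp add: field_simps)
  qed
  have geo: "(\<Sum>j\<in>{J..<n}. c * (1/4::real) ^ (j - Suc k)) \<le> c * (4/3)" if "0 \<le> c" for c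
  proof (cases "Suc k \<le> n")
    case True
    then have "(\<Sum>j\<in>{J..<n}. (1/4::real) ^ (j - Suc k)) = (\<Sum>i\<in>{0..<n - Suc k}. (1/4) ^ i)"
      using sum.shift_bounds_nat_ivl[of "\<lambda>j. (1/4::real) ^ (j - Suc k)" 0 "Suc k" "n - Suc k"] by (simp add: J_def)
    also have "\<dots> \<le> 4/3" using geom_sum_le[of "1/4" "n - Suc k"] by (simp add: atLeast0LessThan)
    finally show ?thesis unfolding sum_distrib_left[symmetric] using that by (rule mult_left_mono)
  next
    case False
    then show ?thesis using that by (simp add: J_def)
  qed
  have split: "{..<n} = {..<J} \<union> {J..<n}" by (auto simp: J_def)
  have dH: "deriv (H n) w = (\<Sum>j<J. deriv (T j) w) + (\<Sum>j\<in>{J..<n}. deriv (T j) w)"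
  proof -
    have "(H n has_field_derivative (\<Sum>j<n. deriv (T j) w)) (at w)"
      unfolding H_def[abs_def]
      by (auto intro!: derivative_eq_intros holomorphic_derivI[OF T_hol[of _ UNIV]])
    then have "deriv (H n) w = (\<Sum>j<n. deriv (T j) w)" by (rule DERIV_imp_deriv)
    also have "\<dots> = (\<Sum>j<J. deriv (T j) w) + (\<Sum>j\<in>{J..<n}. deriv (T j) w)"
      unfolding split by (rule sum.union_disjoint) auto
    finally show ?thesis .
  qed
  have "\<delta> * cmod (deriv (H n) w) \<le> \<delta> * ((\<Sum>j<J. cmod (deriv (T j) w)) + (\<Sum>j\<in>{J..<n}. cmod (deriv (T j) w)))"
    unfolding dH using d by (intro mult_left_mono order_trans[OF norm_triangle_ineq] add_mono norm_sum) auto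
  also have "\<dots> = (\<Sum>j<J. \<delta> * cmod (deriv (T j) w)) + (\<Sum>j\<in>{J..<n}. \<delta> * cmod (deriv (T j) w))"
    by (simp add: distrib_left sum_distrib_left)
  also have "\<dots> \<le> (\<Sum>j<J. 16 * b j * p j \<zeta> * N j * \<delta>) + (\<Sum>j\<in>{J..<n}. 32 * b k * P * (1/4) ^ (j - Suc k))"
    by (intro add_mono sum_mono dlow dhigh) (auto simp: wz)
  also have "\<dots> \<le> 32 * b k * P + 32 * b k * P * (4/3)"
    using b_nonneg[of k] P0 by (intro add_mono lowsum geo) auto
  also have "\<dots> \<le> 80 * b k * P" using b_nonneg[of k] P0 by simp
  finally show "(1 - r) * cmod (deriv (H n) (of_real r * \<zeta>)) \<le> 80 * b k * P" by (simp add: \<delta>_def w_def)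
  have diffT: "cmod (T j w - T j \<zeta>) \<le> 16 * b j * p j \<zeta> * N j * \<delta>" if "j < J" for j
  proof -
    have "cmod (T j w - T j \<zeta>) \<le> (16 * b j * p j \<zeta> * N j) * cmod (w - \<zeta>)"
    proof (rule field_differentiable_bound[of "cball \<zeta> \<delta>"])
      fix x assume "x \<in> cball \<zeta> \<delta>"
      then have "cmod (x - \<zeta>) \<le> \<delta>" by (simp add: dist_norm norm_minus_commute)
      then show "cmod (deriv (T j) x) \<le> 16 * b j * p j \<zeta> * N j" by (rule deriv_T_low[OF z wlow[OF _ that]])
      show "(T j has_field_derivative deriv (T j) x) (at x within cball \<zeta> \<delta>)"
        by (rule has_field_derivative_at_within[OF holomorphic_derivI[OF T_hol[of _ UNIV]]]) auto
    qed (use d wz in \<open>auto simp: dist_norm norm_minus_commute\<close>)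
    then show ?thesis unfolding wz .
  qed
  \<comment> \<open>The reference value is the truncated sum \<open>H J\<close> at the boundary
    point, whose real part is exactly \<open>p J \<zeta>\<close>; at most one factor, close to 1,
    separates it from \<open>P\<close>.\<close>
  have Hsplit: "H n w = H J \<zeta> + (\<Sum>j<J. T j w - T j \<zeta>) + (\<Sum>j\<in>{J..<n}. T j w)"
  proof -
    have "(\<Sum>j<n. T j w) = (\<Sum>j<J. T j w) + (\<Sum>j\<in>{J..<n}. T j w)"
      unfolding split by (rule sum.union_disjoint) auto
    then show ?thesis by (simp add: H_def sum_subtractf)
  qed
  have "cmod (H n w - H J \<zeta>) \<le> (\<Sum>j<J. 16 * b j * p j \<zeta> * N j * \<delta>) + (\<Sum>j\<in>{J..<n}. 16 * b k * P * (1/4) ^ (j - Suc k))"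
    unfolding Hsplit using high[of w] d
    by (auto intro!: order_trans[OF norm_triangle_ineq] add_mono order_trans[OF norm_sum] sum_mono diffT)
  also have "\<dots> \<le> 32 * b k * P + 16 * b k * P * (4/3)"
    using b_nonneg[of k] P0 by (intro add_mono lowsum geo) auto
  also have "\<dots> \<le> 60 * b k * P" using b_nonneg[of k] P0 by simp
  also have "\<dots> \<le> 60 * (1/256) * P" using b_small[of k] P0 by (intro mult_right_mono mult_left_mono) auto
  finally have close: "cmod (H n w - H J \<zeta>) \<le> P / 4" using P0 by simp
  have "3/4 * P \<le> p J \<zeta>"
  proof (cases "k < n")
    case True
    have "P * (3/4) \<le> P * (1 + b k * Re (\<zeta> ^ N k))"
      using fac_pos(2)[OF z, of k] b_small[of k] P0 by (intro mult_left_mono) auto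
    also have "\<dots> = p J \<zeta>" using True by (simp add: J_def P_def p_def min_def)
    finally show ?thesis by simp
  next
    case False
    then have "J = n" "min k n = n" by (auto simp: J_def)
    then show ?thesis using P0 by (simp add: P_def)
  qed
  then have "3/4 * P \<le> Re (H J \<zeta>)" unfolding H_circle[OF z] .
  moreover have "Re (H J \<zeta>) - Re (H n w) \<le> P / 4"
    using complex_Re_le_cmod[of "H J \<zeta> - H n w"] close by (simp add: norm_minus_commute)
  ultimately show "P / 2 \<le> Re (H n (of_real r * \<zeta>))" by (simp add: w_def)
qed

end


section \<open>Smallness in measure of Riesz products, and a weak-type bound for H\<close>

lemma sqrt_one_plus_le:
  fixes x :: real
  assumes "\<bar>x\<bar> \<le> 1"
  shows "sqrt (1 + x) \<le> 1 + x / 2 - x\<^sup>2 / 16"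
proof (rule real_le_lsqrt)
  have x2: "x\<^sup>2 \<le> 1" using assms by (simp add: abs_square_le_1)
  show "0 \<le> 1 + x / 2 - x\<^sup>2 / 16" using assms x2 by (simp add: abs_le_iff)
  have "x * x\<^sup>2 \<le> 1 * x\<^sup>2" using assms by (intro mult_right_mono) auto
  moreover have "0 \<le> (x\<^sup>2 / 16)\<^sup>2" "0 \<le> x * x" by simp_all
  \<comment> \<open>The Taylor coefficient -1/8 of the square root is weakened to -1/16; the
    resulting margin x^2 / 8 absorbs the cubic term on the whole interval [-1, 1].\<close>
  moreover have "(1 + x / 2 - x\<^sup>2 / 16)\<^sup>2 = 1 + x + (x * x) / 8 - (x * x\<^sup>2) / 16 + (x\<^sup>2 / 16)\<^sup>2"
    by (simp add: power2_eq_square algebra_simps)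
  ultimately show "1 + x \<le> (1 + x / 2 - x\<^sup>2 / 16)\<^sup>2" unfolding power2_eq_square[of x] by linarith
qed

lemma closed_superlevel:
  fixes f :: "real \<Rightarrow> real"
  assumes "continuous_on {a..b} f"
  shows "closed {t \<in> {a..b}. c \<le> f t}"
proof -
  have "closed ({a..b} \<inter> f -` {c..})"
    by (rule continuous_closed_preimage[OF assms closed_atLeastAtMost closed_atLeast])
  also have "{a..b} \<inter> f -` {c..} = {t \<in> {a..b}. c \<le> f t}" by auto
  finally show ?thesis .
qed

lemma fmeasurable_superlevel:
  fixes f :: "real \<Rightarrow> real"
  assumes "continuous_on {a..b} f"
  shows "{t \<in> {a..b}. c \<le> f t} \<in> fmeasurable lborel"
proof (rule fmeasurable_compact)
  have "bounded {t \<in> {a..b}. c \<le> f t}" by (rule bounded_subset[OF bounded_closed_interval[of a b]]) auto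
  then show "compact {t \<in> {a..b}. c \<le> f t}"
    using closed_superlevel[OF assms, of c] by (simp only: compact_eq_bounded_closed)
qed

lemma markov_measure:
  fixes f :: "real \<Rightarrow> real"
  assumes cont: "continuous_on {0..2*pi} f" and nn: "\<And>t. t \<in> {0..2*pi} \<Longrightarrow> 0 \<le> f t" and c: "0 < c"
    and I: "(f has_integral I) {0..2*pi}"
  shows "measure lborel {t \<in> {0..2*pi}. c \<le> f t} \<le> I / c"
proof -
  define A where "A = {t \<in> {0..2*pi}. c \<le> f t}"
  have "closed A" unfolding A_def by (rule closed_superlevel[OF cont])
  then have A: "A \<in> sets borel" by simp
  have "emeasure lborel A \<le> emeasure lborel {0..2*pi}" by (rule emeasure_mono) (auto simp: A_def)
  also have "\<dots> < \<infinity>" by simp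
  finally have "emeasure lborel A < \<infinity>" .
  then have "((\<lambda>t. 1) has_integral measure lborel A) A"
    by (rule has_integral_measure_lborel[OF A])
  then have "((\<lambda>t. if t \<in> A then 1 else 0) has_integral measure lborel A) {0..2*pi}"
    by (subst has_integral_restrict) (auto simp: A_def)
  then have "((\<lambda>t. c * (if t \<in> A then 1 else 0)) has_integral c * measure lborel A) {0..2*pi}"
    by (rule has_integral_mult_right)
  then have "c * measure lborel A \<le> I"
    by (rule has_integral_le[OF _ I]) (use nn c in \<open>auto simp: A_def\<close>)
  then show ?thesis unfolding A_def[symmetric] using c by (simp add: field_simps)
qed

text \<open>Rescaling by a number between 1 and R moves the unit circle inside the disc, where
  Parseval against the constant 1 applies.\<close>

lemma circle_mean_value:
  assumes F: "F holomorphic_on ball 0 R" and R: "1 < R"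
  shows "((\<lambda>t. F (cis t)) has_integral of_real (2 * pi) * F 0) {0..2*pi}"
proof -
  define s where "s = (1 + R) / 2"
  have s: "1 < s" "s < R" using R by (auto simp: s_def)
  define F' where "F' = (\<lambda>z. F (of_real s * z))"
  have hol: "F' holomorphic_on \<D>" unfolding F'_def
  proof (rule holomorphic_on_compose_gen[OF _ F, unfolded o_def])
    show "(\<lambda>z. of_real s * z) holomorphic_on \<D>" by (intro holomorphic_intros)
    show "(\<lambda>z. of_real s * z) ` \<D> \<subseteq> ball 0 R"
    proof clarify
      fix z :: complex assume "z \<in> \<D>"
      then have "s * cmod z \<le> s * 1" using s by (intro mult_left_mono) auto
      then have "cmod (of_real s * z) < R" using s unfolding norm_mult norm_of_real by linarith
      then show "of_real s * z \<in> ball 0 R" by (simp only: mem_ball_0)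
    qed
  qed
  define h where "h = (\<lambda>m::nat. if m = 0 then 1 else 0 :: complex)"
  have r: "0 \<le> 1 / s" "1 / s < 1" using s by auto
  have hs: "summable (\<lambda>m. cmod (h m) * (1 / s) ^ m)" by (rule summable_finite[of "{0}"]) (auto simp: h_def)
  have ph: "power_series h z = 1" for z
    unfolding power_series_def by (subst suminf_finite[of "{0}"]) (auto simp: h_def)
  have in_D: "of_real (1 / s) * cis t \<in> \<D>" for t using s by (simp add: norm_mult norm_divide)
  have "(\<Sum>m. taylor_coeff F' m * cnj (h m) * of_real ((1 / s) ^ (2 * m))) = taylor_coeff F' 0"
    by (subst suminf_finite[of "{0}"]) (auto simp: h_def)
  also have "\<dots> = F 0" by (simp add: taylor_coeff_def F'_def)
  finally have eq: "(\<Sum>m. taylor_coeff F' m * cnj (h m) * of_real ((1 / s) ^ (2 * m))) = F 0" .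
  show ?thesis
    using circle_parseval(2)[OF taylor_coeff_summable[OF hol r] hs r(1)]
    unfolding eq taylor_coeff_psum[OF hol in_D] ph using s by (simp add: F'_def mult.assoc[symmetric])
qed

context riesz
begin

text \<open>A majorant of sqrt (p n), factor by factor from \<open>sqrt_one_plus_le\<close>. Unlike
  the square root it is a trigonometric polynomial, so its mean can be computed.\<close>

definition h :: "nat \<Rightarrow> real \<Rightarrow> complex" where
  "h n t = (\<Prod>k<n. 1 + of_real (b k / 2 * cos (real (N k) * t) - (b k)\<^sup>2 / 16 * (cos (real (N k) * t))\<^sup>2))"

lemma h_cont: "continuous_on A (h n)"
  unfolding h_def[abs_def] by (intro continuous_intros)

definition fc :: "nat \<Rightarrow> int \<Rightarrow> complex" where
  "fc n m = integral {0..2*pi} (\<lambda>t. h n t * cis (of_int m * t))"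

lemma fc_has: "((\<lambda>t. h n t * cis (of_int m * t)) has_integral fc n m) {0..2*pi}"
  unfolding fc_def by (intro integrable_integral integrable_continuous_real continuous_intros h_cont)

lemma fc_Suc:
  "fc (Suc n) m = of_real (1 - (b n)\<^sup>2 / 32) * fc n m + of_real (b n / 4) * (fc n (m + int (N n)) + fc n (m - int (N n)))
     - of_real ((b n)\<^sup>2 / 64) * (fc n (m + 2 * int (N n)) + fc n (m - 2 * int (N n)))"
proof (rule has_integral_unique[OF fc_has])
  have "h (Suc n) t * cis (of_int m * t) =
     of_real (1 - (b n)\<^sup>2 / 32) * (h n t * cis (of_int m * t))
   + of_real (b n / 4) * (h n t * cis (of_int (m + int (N n)) * t) + h n t * cis (of_int (m - int (N n)) * t))
   - of_real ((b n)\<^sup>2 / 64) * (h n t * cis (of_int (m + 2 * int (N n)) * t) + h n t * cis (of_int (m - 2 * int (N n)) * t))" for t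
  proof -
    define E where "E = cis (real (N n) * t)"
    define F where "F = cis (- (real (N n) * t))"
    have EF: "E * F = 1" by (simp add: E_def F_def cis_mult)
    have c: "complex_of_real (cos (real (N n) * t)) = (E + F) / 2"
      by (simp add: E_def F_def complex_eq_iff)
    have s1: "cis (of_int (m + int (N n)) * t) = cis (of_int m * t) * E"
      "cis (of_int (m - int (N n)) * t) = cis (of_int m * t) * F"
      unfolding E_def F_def cis_mult by (rule arg_cong[of _ _ cis], simp add: algebra_simps)+
    have s2: "cis (of_int (m + 2 * int (N n)) * t) = cis (of_int m * t) * (E * E)"
      "cis (of_int (m - 2 * int (N n)) * t) = cis (of_int m * t) * (F * F)"
      unfolding E_def F_def cis_mult by (rule arg_cong[of _ _ cis], simp add: algebra_simps)+
    have "complex_of_real (b n / 2 * cos (real (N n) * t) - (b n)\<^sup>2 / 16 * (cos (real (N n) * t))\<^sup>2)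
      = of_real (b n / 2) * ((E + F) / 2) - of_real ((b n)\<^sup>2 / 16) * ((E + F) / 2)\<^sup>2"
      by (simp add: c)
    also have "((E + F) / 2)\<^sup>2 = (E * E + F * F) / 4 + 1 / 2"
      using EF by (simp add: power2_eq_square field_simps)
    finally have hs: "h (Suc n) t = h n t * (1 + (of_real (b n / 2) * ((E + F) / 2) - of_real ((b n)\<^sup>2 / 16) * ((E * E + F * F) / 4 + 1 / 2)))"
      by (simp add: h_def)
    show ?thesis unfolding s1 s2 hs by (simp add: algebra_simps add_divide_distrib)
  qed
  then have eq: "(\<lambda>t. h (Suc n) t * cis (of_int m * t)) = (\<lambda>t. of_real (1 - (b n)\<^sup>2 / 32) * (h n t * cis (of_int m * t))
   + of_real (b n / 4) * (h n t * cis (of_int (m + int (N n)) * t) + h n t * cis (of_int (m - int (N n)) * t))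
   - of_real ((b n)\<^sup>2 / 64) * (h n t * cis (of_int (m + 2 * int (N n)) * t) + h n t * cis (of_int (m - 2 * int (N n)) * t)))"
    by (rule ext)
  show "((\<lambda>t. h (Suc n) t * cis (of_int m * t)) has_integral
    of_real (1 - (b n)\<^sup>2 / 32) * fc n m + of_real (b n / 4) * (fc n (m + int (N n)) + fc n (m - int (N n)))
     - of_real ((b n)\<^sup>2 / 64) * (fc n (m + 2 * int (N n)) + fc n (m - 2 * int (N n)))) {0..2*pi}"
    unfolding eq by (intro has_integral_add has_integral_diff has_integral_mult_right fc_has)
qed

text \<open>The spectrum of \<open>h n\<close> lies strictly below \<open>N n\<close> in modulus.
  The next factor has frequencies 0, N n and 2 N n only, so the mean changes just through its
  constant term, and the new spectrum still lies below 8 N n.\<close>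

lemma fc_values:
  "(\<forall>m. int (N n) \<le> \<bar>m\<bar> \<longrightarrow> fc n m = 0) \<and> fc n 0 = of_real (2 * pi * (\<Prod>k<n. 1 - (b k)\<^sup>2 / 32))"
proof (induction n)
  case 0
  have "fc 0 m = (if m = 0 then of_real (2 * pi) else 0)" for m
    unfolding fc_def h_def using has_integral_cis[of m] by (simp add: integral_unique)
  then show ?case by (auto simp: N_def)
next
  case (Suc n)
  have N0: "0 < int (N n)" by simp
  have NS: "int (N (Suc n)) \<ge> 8 * int (N n)" using q8 by (simp add: N_Suc)
  have van: "fc n m = 0" if "int (N n) \<le> \<bar>m\<bar>" for m using Suc that by blast
  have "fc (Suc n) m = 0" if "int (N (Suc n)) \<le> \<bar>m\<bar>" for m
  proof -
    have "int (N n) \<le> \<bar>m\<bar>" "int (N n) \<le> \<bar>m + int (N n)\<bar>" "int (N n) \<le> \<bar>m - int (N n)\<bar>"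
      "int (N n) \<le> \<bar>m + 2 * int (N n)\<bar>" "int (N n) \<le> \<bar>m - 2 * int (N n)\<bar>"
      using that NS N0 by linarith+
    then show ?thesis unfolding fc_Suc by (simp only: van mult_zero_right add_0 diff_self)
  qed
  moreover have "fc (Suc n) 0 = of_real (1 - (b n)\<^sup>2 / 32) * fc n 0"
    unfolding fc_Suc by (simp add: van)
  ultimately show ?case using Suc by (simp add: mult_ac)
qed

lemma p_cis: "p n (cis t) = (\<Prod>k<n. 1 + b k * cos (real (N k) * t))"
  by (simp add: p_def Complex.DeMoivre)

lemma p_cont: "continuous_on A (\<lambda>t. p n (cis t))"
  unfolding p_cis by (intro continuous_intros)

text \<open>Each factor loses b_k^2 / 32 in mean, the average of the quadratic term. Taking square
  roots is what produces a loss: the Riesz product itself has mean 1.\<close>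

lemma sqrt_p_integral:
  obtains I where "((\<lambda>t. sqrt (p n (cis t))) has_integral I) {0..2*pi}" "I \<le> 2 * pi * (\<Prod>k<n. 1 - (b k)\<^sup>2 / 32)"
proof -
  define I where "I = integral {0..2*pi} (\<lambda>t. sqrt (p n (cis t)))"
  have I: "((\<lambda>t. sqrt (p n (cis t))) has_integral I) {0..2*pi}"
    unfolding I_def by (intro integrable_integral integrable_continuous_real continuous_intros p_cont)
  have "((\<lambda>t. h n t * cis (of_int 0 * t)) has_integral fc n 0) {0..2*pi}" by (rule fc_has)
  from has_integral_linear[OF this bounded_linear_Re]
  have "((\<lambda>t. Re (h n t)) has_integral Re (fc n 0)) {0..2*pi}"
    by (simp add: o_def)
  then have J: "((\<lambda>t. Re (h n t)) has_integral 2 * pi * (\<Prod>k<n. 1 - (b k)\<^sup>2 / 32)) {0..2*pi}"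
    using fc_values[of n] by (simp del: of_real_mult of_real_prod)
  have "I \<le> 2 * pi * (\<Prod>k<n. 1 - (b k)\<^sup>2 / 32)"
  proof (rule has_integral_le[OF I J])
    fix t
    have x1: "\<bar>b k * cos (real (N k) * t)\<bar> \<le> 1" for k
    proof -
      have "\<bar>b k\<bar> * \<bar>cos (real (N k) * t)\<bar> \<le> 1 * 1" using b_small[of k] b_nonneg[of k] by (intro mult_mono) auto
      then show ?thesis by (simp add: abs_mult)
    qed
    have "sqrt (p n (cis t)) = (\<Prod>k<n. sqrt (1 + b k * cos (real (N k) * t)))"
      unfolding p_cis by (induction n) (simp_all add: real_sqrt_mult)
    also have "\<dots> \<le> (\<Prod>k<n. 1 + b k * cos (real (N k) * t) / 2 - (b k * cos (real (N k) * t))\<^sup>2 / 16)"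
    proof (intro prod_mono conjI)
      fix k
      show "0 \<le> sqrt (1 + b k * cos (real (N k) * t))" using x1[of k] by simp
      show "sqrt (1 + b k * cos (real (N k) * t)) \<le> 1 + b k * cos (real (N k) * t) / 2 - (b k * cos (real (N k) * t))\<^sup>2 / 16"
        by (rule sqrt_one_plus_le[OF x1])
    qed
    also have "\<dots> = Re (h n t)"
    proof -
      have "h n t = of_real (\<Prod>k<n. 1 + b k * cos (real (N k) * t) / 2 - (b k * cos (real (N k) * t))\<^sup>2 / 16)"
        unfolding h_def of_real_prod by (intro prod.cong refl) (simp add: power_mult_distrib)
      then show ?thesis by (simp only: Re_complex_of_real)
    qed
    finally show "sqrt (p n (cis t)) \<le> Re (h n t)" .
  qed
  then show ?thesis using that I by blast
qed

lemma level_exists: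
  fixes \<delta> :: real
  assumes d: "0 < \<delta>" "\<delta> \<le> (1::real)"
  obtains k where "N k * \<delta> \<le> 1" "1 \<le> N (Suc k) * \<delta>"
proof -
  obtain m where "1 / \<delta> < real q ^ m" using real_arch_pow[of "real q" "1 / \<delta>"] q8 by auto
  then have m: "1 < N m * \<delta>" using d by (simp add: N_def field_simps)
  define l where "l = (LEAST m. 1 < N m * \<delta>)"
  have l: "1 < N l * \<delta>" unfolding l_def by (rule LeastI[of "\<lambda>m. 1 < N m * \<delta>", OF m])
  have "l \<noteq> 0"
  proof
    assume "l = 0" then show False using l d by (simp add: N_def)
  qed
  then obtain k where k: "l = Suc k" by (cases l) auto
  have "\<not> 1 < N k * \<delta>" by (rule not_less_Least) (use k in \<open>simp add: l_def[symmetric]\<close>)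
  then show ?thesis using that[of k] l k by simp
qed

lemma disc_polar:
  assumes "z \<in> \<D>"
  obtains \<zeta> where "cmod \<zeta> = 1" "z = of_real (cmod z) * \<zeta>"
proof (cases "z = 0")
  case True then show ?thesis using that[of 1] by simp
next
  case False
  then show ?thesis using that[of "z / of_real (cmod z)"] by (simp add: norm_divide)
qed

lemma Re_H_pos: assumes "cmod z \<le> 1" shows "0 < Re (H n z)"
proof (cases "cmod z = 1")
  case True then show ?thesis using H_circle p_pos by simp
next
  case False
  then have z: "cmod z < 1" using assms by simp
  obtain k where k: "N k * (1 - cmod z) \<le> 1" "1 \<le> N (Suc k) * (1 - cmod z)"
    using level_exists[of "1 - cmod z"] z by auto
  obtain \<zeta> where \<zeta>: "cmod \<zeta> = 1" "z = of_real (cmod z) * \<zeta>" using disc_polar[of z] z by auto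
  from H_estimate(1,3)[OF norm_ge_zero z \<zeta>(1) k, of n] show ?thesis unfolding \<zeta>(2)[symmetric] by linarith
qed

lemma one_plus_sH: assumes "0 < s" "cmod z \<le> 1" shows "1 \<le> cmod (1 + of_real s * H n z)" "cmod (of_real s * H n z) \<le> cmod (1 + of_real s * H n z)"
proof -
  define x where "x = of_real s * H n z"
  have x: "0 \<le> Re x" using Re_H_pos[OF assms(2), of n] assms(1) by (simp add: x_def)
  show "1 \<le> cmod (1 + of_real s * H n z)"
    using complex_Re_le_cmod[of "1 + x"] x unfolding x_def[symmetric] by simp
  have "(cmod x)\<^sup>2 \<le> (cmod (1 + x))\<^sup>2"
    using x unfolding cmod_power2 by (simp add: power2_eq_square algebra_simps)
  then show "cmod (of_real s * H n z) \<le> cmod (1 + of_real s * H n z)"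
    unfolding x_def[symmetric] by (rule power2_le_imp_le) simp
qed

lemma H_zero: "H n 0 = 1"
proof -
  have "T j 0 = 0" for j using N_sum[of j] by (simp add: T_def power_0_left)
  then show ?thesis by (simp add: H_def)
qed

text \<open>Positivity of Re H on the closed disc persists on a neighbourhood by compactness, so
  quotients by 1 + s H are holomorphic across the circle.\<close>

lemma nonvanish_radius:
  assumes s: "0 < s"
  obtains R where "1 < R" "\<And>z. z \<in> ball 0 R \<Longrightarrow> 1 + of_real s * H n z \<noteq> 0"
proof -
  have cont: "continuous_on UNIV (\<lambda>z. Re (H n z))"
    by (intro continuous_intros holomorphic_on_imp_continuous_on H_hol)
  have op: "open ((\<lambda>z. Re (H n z)) -` {0<..})" by (rule open_vimage[OF _ cont]) auto
  have sub: "cball 0 1 \<subseteq> (\<lambda>z. Re (H n z)) -` {0<..}" using Re_H_pos by auto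
  obtain e where e: "e > 0" "(\<Union>x\<in>cball 0 1. ball x e) \<subseteq> (\<lambda>z. Re (H n z)) -` {0<..}"
    by (rule compact_subset_open_imp_ball_epsilon_subset[OF compact_cball op sub])
  have "0 < Re (H n z)" if z: "z \<in> ball 0 (1 + e)" for z
  proof (cases "cmod z \<le> 1")
    case True then show ?thesis by (rule Re_H_pos)
  next
    case False
    define x where "x = z / of_real (cmod z)"
    have "complex_of_real (cmod z) \<noteq> 0" unfolding of_real_eq_0_iff using False by linarith
    then have "z = of_real (cmod z) * x" by (simp add: x_def)
    then have "z - x = of_real (cmod z - 1) * x" by (simp only: of_real_diff left_diff_distrib of_real_1 mult_1_left)
    moreover have x1: "cmod x = 1" using False by (auto simp: x_def norm_divide)
    ultimately have "cmod (z - x) = cmod z - 1" using False by (simp only: norm_mult norm_of_real) simp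
    then have "z \<in> ball x e" using z by (simp add: dist_norm norm_minus_commute)
    then have "z \<in> (\<Union>x\<in>cball 0 1. ball x e)" using x1 by (intro UN_I[of x]) auto
    then have "z \<in> (\<lambda>z. Re (H n z)) -` {0<..}" using e(2) by (rule subsetD[rotated])
    then show ?thesis by simp
  qed
  then have "1 + of_real s * H n z \<noteq> 0" if "z \<in> ball 0 (1 + e)" for z
  proof -
    have "0 < Re (1 + of_real s * H n z)" using \<open>\<And>z. z \<in> ball 0 (1 + e) \<Longrightarrow> 0 < Re (H n z)\<close>[OF that] s by (simp add: add_pos_pos)
    then show ?thesis by (metis less_irrefl zero_complex.sel(1))
  qed
  then show ?thesis using that[of "1 + e"] e(1) by simp
qed

text \<open>Kolmogorov's weak-type argument: the real part of s H / (1 + s H) is nonnegative with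
  mean s / (1 + s), because H takes the value 1 at 0, and it is at least 1/4 wherever |s H| >=
  1.\<close>

lemma H_large_measure:
  assumes s: "0 < s"
  shows "measure lborel {t \<in> {0..2*pi}. 1 / s \<le> cmod (H n (cis t))} \<le> 8 * pi * s"
proof -
  obtain R where R: "1 < R" "\<And>z. z \<in> ball 0 R \<Longrightarrow> 1 + of_real s * H n z \<noteq> 0"
    using nonvanish_radius[OF s] by blast
  define x where "x = (\<lambda>z. of_real s * H n z)"
  have x_hol: "x holomorphic_on A" for A unfolding x_def by (intro holomorphic_intros H_hol)
  have R': "1 + x z \<noteq> 0" if "z \<in> ball 0 R" for z using R(2)[OF that] by (simp add: x_def)
  have "((\<lambda>t. (\<lambda>z. x z / (1 + x z)) (cis t)) has_integral of_real (2 * pi) * (x 0 / (1 + x 0))) {0..2*pi}"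
    by (rule circle_mean_value[OF _ R(1)]) (intro holomorphic_intros x_hol R')
  from has_integral_linear[OF this bounded_linear_Re]
  have I: "((\<lambda>t. Re (x (cis t) / (1 + x (cis t)))) has_integral Re (of_real (2 * pi) * (x 0 / (1 + x 0)))) {0..2*pi}"
    unfolding o_def .
  have "x 0 / (1 + x 0) = of_real (s / (1 + s))" by (simp add: x_def H_zero)
  then have x0: "Re (of_real (2 * pi) * (x 0 / (1 + x 0))) = 2 * pi * (s / (1 + s))"
    by (simp only: of_real_mult[symmetric] Re_complex_of_real)
  have Re_ge: "(cmod (x (cis t)))\<^sup>2 / (cmod (1 + x (cis t)))\<^sup>2 \<le> Re (x (cis t) / (1 + x (cis t)))" for t
  proof -
    have "0 < Re (x (cis t))" using Re_H_pos[of "cis t" n] s by (simp add: x_def)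
    moreover have "Re (x (cis t) / (1 + x (cis t))) = (Re (x (cis t)) + (cmod (x (cis t)))\<^sup>2) / (cmod (1 + x (cis t)))\<^sup>2"
      unfolding Re_divide cmod_power2 by (simp add: power2_eq_square algebra_simps)
    ultimately show ?thesis by (simp add: divide_right_mono)
  qed
  have cont: "continuous_on {0..2*pi} (\<lambda>t. Re (x (cis t) / (1 + x (cis t))))"
  proof -
    have c: "continuous_on UNIV x" by (rule holomorphic_on_imp_continuous_on[OF x_hol])
    have "continuous_on {0..2*pi} (\<lambda>t. x (cis t))"
      by (rule continuous_on_compose2[OF c]) (auto intro!: continuous_intros)
    then show ?thesis using R' R(1) by (intro continuous_intros) auto
  qed
  have "measure lborel {t \<in> {0..2*pi}. 1 / 4 \<le> Re (x (cis t) / (1 + x (cis t)))} \<le> 2 * pi * (s / (1 + s)) / (1/4)"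
    using I unfolding x0 by (intro markov_measure[OF cont]) (auto intro: order_trans[OF _ Re_ge])
  also have "\<dots> \<le> 8 * pi * s" using s by (simp add: field_simps)
  finally have m: "measure lborel {t \<in> {0..2*pi}. 1 / 4 \<le> Re (x (cis t) / (1 + x (cis t)))} \<le> 8 * pi * s" .
  have sub: "{t \<in> {0..2*pi}. 1 / s \<le> cmod (H n (cis t))} \<subseteq> {t \<in> {0..2*pi}. 1 / 4 \<le> Re (x (cis t) / (1 + x (cis t)))}"
  proof clarify
    fix t assume "1 / s \<le> cmod (H n (cis t))"
    then have x1: "1 \<le> cmod (x (cis t))" using s by (simp add: x_def norm_mult field_simps)
    have nz: "0 < cmod (1 + x (cis t))" using R'[of "cis t"] R(1) by simp
    have "cmod (1 + x (cis t)) \<le> 2 * cmod (x (cis t))" using norm_triangle_ineq[of 1 "x (cis t)"] x1 by simp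
    then have "(cmod (1 + x (cis t)))\<^sup>2 \<le> (2 * cmod (x (cis t)))\<^sup>2" by (intro power_mono) auto
    then have "1 / 4 \<le> (cmod (x (cis t)))\<^sup>2 / (cmod (1 + x (cis t)))\<^sup>2"
      using nz by (simp add: power_mult_distrib field_simps)
    then show "1 / 4 \<le> Re (x (cis t) / (1 + x (cis t)))" using Re_ge[of t] by linarith
  qed
  have "measure lborel {t \<in> {0..2*pi}. 1 / s \<le> cmod (H n (cis t))} \<le> measure lborel {t \<in> {0..2*pi}. 1 / 4 \<le> Re (x (cis t) / (1 + x (cis t)))}"
  proof (rule measure_mono_fmeasurable[OF sub])
    have "continuous_on {0..2*pi} (\<lambda>t. H n (cis t))"
      by (rule continuous_on_compose2[OF holomorphic_on_imp_continuous_on[OF H_hol[of n UNIV]]]) (auto intro!: continuous_intros)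
    then show "{t \<in> {0..2*pi}. 1 / s \<le> cmod (H n (cis t))} \<in> sets lborel"
      by (rule fmeasurableD[OF fmeasurable_superlevel[OF continuous_on_norm]])
    show "{t \<in> {0..2*pi}. 1 / 4 \<le> Re (x (cis t) / (1 + x (cis t)))} \<in> fmeasurable lborel"
      by (rule fmeasurable_superlevel[OF cont])
  qed
  then show ?thesis using m by linarith
qed

end


section \<open>The exponential of the truncated transform\<close>

context riesz
begin

text \<open>The map x / (1 + s x) is bounded by 1 / s on the right half plane and hardly changes x
  where s |x| is small.\<close>

definition Kf :: "real \<Rightarrow> nat \<Rightarrow> complex \<Rightarrow> complex" where
  "Kf s n z = H n z / (1 + of_real s * H n z)"

text \<open>The constant subtracted is the value of \<open>Kf s n\<close> at 0; it normalises the
  value of the exponential there to 1.\<close>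

definition Gf :: "real \<Rightarrow> real \<Rightarrow> nat \<Rightarrow> complex \<Rightarrow> complex" where
  "Gf B s n z = exp (of_real B * (Kf s n z - of_real (1 / (1 + s))))"

lemma Gf_hol:
  assumes "0 < s"
  obtains R where "1 < R" "Gf B s n holomorphic_on ball 0 R"
proof -
  obtain R where R: "1 < R" "\<And>z. z \<in> ball 0 R \<Longrightarrow> 1 + of_real s * H n z \<noteq> 0"
    using nonvanish_radius[OF assms] by blast
  have "Gf B s n holomorphic_on ball 0 R"
    unfolding Gf_def[abs_def] Kf_def by (intro holomorphic_intros H_hol R(2))
  then show ?thesis using that R(1) by blast
qed

lemma Gf_zero: "0 < s \<Longrightarrow> Gf B s n 0 = 1"
  by (simp add: Gf_def Kf_def H_zero)

text \<open>The derivative of \<open>Kf\<close> is H' / (1 + s H)^2. The bound for H' carries the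
  factor P, and |1 + s H|^2 >= 2 s P, so the uncontrolled P cancels: 80 b_k P / (2 s P) = 40 b_k /
  s.\<close>

lemma Gf_deriv:
  assumes s: "0 < s" and B: "0 \<le> B" and z: "z \<in> \<D>"
  obtains k where "N k * (1 - cmod z) \<le> 1" "1 \<le> N (Suc k) * (1 - cmod z)"
    "(1 - cmod z) * cmod (deriv (Gf B s n) z) \<le> B * exp (B / s) * (40 / s) * b k"
proof -
  have z1: "cmod z < 1" "cmod z \<le> 1" using z by auto
  obtain k where k: "N k * (1 - cmod z) \<le> 1" "1 \<le> N (Suc k) * (1 - cmod z)"
    using level_exists[of "1 - cmod z"] z1 by auto
  obtain \<zeta> where \<zeta>: "cmod \<zeta> = 1" "z = of_real (cmod z) * \<zeta>" using disc_polar[of z] z by auto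
  define P where "P = p (min k n) \<zeta>"
  have est: "0 < P" "(1 - cmod z) * cmod (deriv (H n) z) \<le> 80 * b k * P" "P / 2 \<le> Re (H n z)"
    using H_estimate[OF norm_ge_zero z1(1) \<zeta>(1) k, of n] unfolding \<zeta>(2)[symmetric] P_def by auto
  define D where "D = 1 + of_real s * H n z"
  have D1: "1 \<le> cmod D" "cmod (of_real s * H n z) \<le> cmod D"
    unfolding D_def by (rule one_plus_sH[OF s z1(2)])+
  have D0: "D \<noteq> 0" using D1(1) by auto
  \<comment> \<open>From (1 + x)^2 >= 4 x with x = s P / 2.\<close>
  have DP: "2 * s * P \<le> (cmod D)\<^sup>2"
  proof -
    have "1 + s * (P / 2) \<le> 1 + s * Re (H n z)" using est(3) s by simp
    also have "\<dots> = Re D" by (simp add: D_def)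
    also have "\<dots> \<le> cmod D" by (rule complex_Re_le_cmod)
    finally have "(1 + s * (P / 2))\<^sup>2 \<le> (cmod D)\<^sup>2" using s est(1) by (intro power_mono) auto
    moreover have "2 * s * P \<le> (1 + s * (P / 2))\<^sup>2"
      using zero_le_power2[of "1 - s * (P / 2)"] by (simp add: power2_eq_square algebra_simps)
    ultimately show ?thesis by linarith
  qed
  have derH: "(H n has_field_derivative deriv (H n) z) (at z)"
    by (rule holomorphic_derivI[OF H_hol[of n UNIV]]) auto
  have "(Gf B s n has_field_derivative Gf B s n z * (of_real B * (deriv (H n) z / D\<^sup>2))) (at z)"
    unfolding Gf_def[abs_def] Kf_def using D0 unfolding D_def
    by (auto intro!: derivative_eq_intros derH simp: power2_eq_square field_simps)
  then have dG: "deriv (Gf B s n) z = Gf B s n z * (of_real B * (deriv (H n) z / D\<^sup>2))" by (rule DERIV_imp_deriv)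
  have G: "cmod (Gf B s n z) \<le> exp (B / s)"
  proof -
    have "Re (Kf s n z) \<le> cmod (Kf s n z)" by (rule complex_Re_le_cmod)
    also have "\<dots> \<le> 1 / s"
      using D1(2) D0 s unfolding Kf_def D_def[symmetric] by (simp add: norm_divide norm_mult field_simps)
    finally have "Re (Kf s n z) \<le> 1 / s" .
    moreover have "0 \<le> 1 / (1 + s)" using s by simp
    ultimately have "Re (Kf s n z) - 1 / (1 + s) \<le> 1 / s" by linarith
    then have "B * (Re (Kf s n z) - 1 / (1 + s)) \<le> B * (1 / s)" using B by (rule mult_left_mono)
    then show ?thesis by (simp add: Gf_def)
  qed
  have "(1 - cmod z) * cmod (deriv (Gf B s n) z) = cmod (Gf B s n z) * B * (((1 - cmod z) * cmod (deriv (H n) z)) / (cmod D)\<^sup>2)"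
    unfolding dG using B by (simp add: norm_mult norm_divide norm_power)
  also have "\<dots> \<le> exp (B / s) * B * (40 / s * b k)"
  proof (intro mult_mono G order_refl)
    have "((1 - cmod z) * cmod (deriv (H n) z)) / (cmod D)\<^sup>2 \<le> (80 * b k * P) / (2 * s * P)"
      by (rule frac_le) (use est DP s b_nonneg in auto)
    also have "\<dots> = 40 / s * b k" using est(1) s by simp
    finally show "((1 - cmod z) * cmod (deriv (H n) z)) / (cmod D)\<^sup>2 \<le> 40 / s * b k" .
  qed (use B z1 in auto)
  also have "\<dots> = B * exp (B / s) * (40 / s) * b k" by simp
  finally show ?thesis using that k by blast
qed

text \<open>As |1 + s H| >= 1, the real part of \<open>Kf\<close> is at most Re H + s |H|^2 <= 1/4,
  while the subtracted constant is at least 3/4.\<close>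

lemma Gf_small:
  assumes s: "0 < s" "s \<le> 1/3" and B: "0 \<le> B" and z: "cmod \<zeta> = 1"
    and P: "p n \<zeta> \<le> 1/8" and H: "s * (cmod (H n \<zeta>))\<^sup>2 \<le> 1/8"
  shows "cmod (Gf B s n \<zeta>) \<le> exp (- B / 2)"
proof -
  define D where "D = 1 + of_real s * H n \<zeta>"
  have D1: "1 \<le> cmod D" unfolding D_def by (rule one_plus_sH[OF s(1)]) (use z in simp)
  then have D2: "1 \<le> (cmod D)\<^sup>2" by simp
  have "Re (Kf s n \<zeta>) = (Re (H n \<zeta>) + s * (cmod (H n \<zeta>))\<^sup>2) / (cmod D)\<^sup>2"
    unfolding Kf_def D_def Re_divide cmod_power2 by (simp add: power2_eq_square algebra_simps)
  also have "\<dots> \<le> (1/4) / 1"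
    by (rule frac_le) (use P H D2 H_circle[OF z, of n] in auto)
  finally have "Re (Kf s n \<zeta>) \<le> 1/4" by simp
  moreover have "3/4 \<le> 1 / (1 + s)" using s by (simp add: field_simps)
  ultimately have "B * (Re (Kf s n \<zeta>) - 1 / (1 + s)) \<le> B * (-1/2)" using B by (intro mult_left_mono) auto
  then show ?thesis by (simp add: Gf_def)
qed

text \<open>Two exceptional sets: \<open>A1\<close>, where Re H = p is not small, has measure at
  most 6 pi s' by Markov's inequality for sqrt p, and \<open>A2\<close>, where |H| is large, at most
  8 pi s' by the weak-type bound. The cube in s = s'^3 makes s |H|^2 <= s' off
  \<open>A2\<close>.\<close>

lemma bad_measure:
  assumes s': "0 < s'" "s' \<le> 1/8" and B: "0 \<le> B" and pr: "(\<Prod>k<n. 1 - (b k)\<^sup>2 / 32) \<le> s'"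
    and e: "exp (- B / 2) \<le> \<epsilon>"
  defines "s \<equiv> s' ^ 3"
  shows "measure lborel {t \<in> {0..2*pi}. \<epsilon> < cmod (Gf B s n (cis t))} \<le> 14 * pi * s'"
proof -
  have s: "0 < s" "s \<le> 1/3"
  proof -
    show "0 < s" using s' by (simp add: s_def)
    have "s' ^ 3 \<le> s' ^ 1" using s' by (intro power_decreasing) auto
    then show "s \<le> 1/3" using s' by (simp add: s_def)
  qed
  \<comment> \<open>The level 1/3 is chosen since (1/3)^2 <= 1/8, the bound for \<open>p\<close>
    that \<open>Gf_small\<close> asks for.\<close>
  define A1 where "A1 = {t \<in> {0..2*pi}. 1/3 \<le> sqrt (p n (cis t))}"
  define A2 where "A2 = {t \<in> {0..2*pi}. 1 / s' \<le> cmod (H n (cis t))}"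
  obtain I where I: "((\<lambda>t. sqrt (p n (cis t))) has_integral I) {0..2*pi}" "I \<le> 2 * pi * (\<Prod>k<n. 1 - (b k)\<^sup>2 / 32)"
    using sqrt_p_integral by blast
  have c1: "continuous_on {0..2*pi} (\<lambda>t. sqrt (p n (cis t)))" by (intro continuous_intros p_cont)
  have "measure lborel A1 \<le> I / (1/3)" unfolding A1_def
    by (rule markov_measure[OF c1 _ _ I(1)]) (use p_pos[of "cis _" n] in \<open>auto simp: less_imp_le\<close>)
  also have "\<dots> \<le> 6 * pi * s'"
  proof -
    have "2 * pi * (\<Prod>k<n. 1 - (b k)\<^sup>2 / 32) \<le> 2 * pi * s'" by (rule mult_left_mono[OF pr]) simp
    then have "I \<le> 2 * pi * s'" using I(2) by linarith
    then show ?thesis by simp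
  qed
  finally have m1: "measure lborel A1 \<le> 6 * pi * s'" .
  have m2: "measure lborel A2 \<le> 8 * pi * s'" unfolding A2_def by (rule H_large_measure[OF s'(1)])
  have sub: "{t \<in> {0..2*pi}. \<epsilon> < cmod (Gf B s n (cis t))} \<subseteq> A1 \<union> A2"
  proof (rule subsetI, rule ccontr)
    fix t assume t: "t \<in> {t \<in> {0..2*pi}. \<epsilon> < cmod (Gf B s n (cis t))}" and nt: "t \<notin> A1 \<union> A2"
    then have p1: "sqrt (p n (cis t)) < 1/3" and h1: "cmod (H n (cis t)) < 1 / s'" by (auto simp: A1_def A2_def)
    have "(sqrt (p n (cis t)))\<^sup>2 < (1/3)\<^sup>2" using p1 p_pos[of "cis t" n] by (intro power_strict_mono) auto
    then have "p n (cis t) < (1/3)\<^sup>2" using p_pos[of "cis t" n] by simp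
    then have P: "p n (cis t) \<le> 1/8" by (simp add: power2_eq_square)
    have "(cmod (H n (cis t)))\<^sup>2 \<le> (1 / s')\<^sup>2" using h1 by (intro power_mono) auto
    then have "s * (cmod (H n (cis t)))\<^sup>2 \<le> s * (1 / s')\<^sup>2" using s by (intro mult_left_mono) auto
    also have "\<dots> = s'" using s' by (simp add: s_def power2_eq_square power3_eq_cube)
    finally have "s * (cmod (H n (cis t)))\<^sup>2 \<le> 1/8" using s' by simp
    from Gf_small[OF s B _ P this] e t show False by auto
  qed
  have cH: "continuous_on {0..2*pi} (\<lambda>t. H n (cis t))"
    by (rule continuous_on_compose2[OF holomorphic_on_imp_continuous_on[OF H_hol[of n UNIV]]]) (auto intro!: continuous_intros)
  have fm: "A1 \<in> fmeasurable lborel" "A2 \<in> fmeasurable lborel"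
    unfolding A1_def A2_def
    by (rule fmeasurable_superlevel[OF c1], rule fmeasurable_superlevel[OF continuous_on_norm[OF cH]])
  obtain R where R: "1 < R" "Gf B s n holomorphic_on ball 0 R" using Gf_hol[OF s(1)] by blast
  have cG: "continuous_on {0..2*pi} (\<lambda>t. cmod (Gf B s n (cis t)))"
    by (rule continuous_on_norm[OF continuous_on_compose2[OF holomorphic_on_imp_continuous_on[OF R(2)]]])
       (use R(1) in \<open>auto intro!: continuous_intros\<close>)
  have meas: "{t \<in> {0..2*pi}. \<epsilon> < cmod (Gf B s n (cis t))} \<in> sets lborel"
  proof -
    have "closed {t \<in> {0..2*pi}. - \<epsilon> \<le> - cmod (Gf B s n (cis t))}"
      by (intro closed_superlevel continuous_intros cG)
    then have "{0..2*pi} - {t \<in> {0..2*pi}. - \<epsilon> \<le> - cmod (Gf B s n (cis t))} \<in> sets lborel" by simp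
    also have "{0..2*pi} - {t \<in> {0..2*pi}. - \<epsilon> \<le> - cmod (Gf B s n (cis t))} = {t \<in> {0..2*pi}. \<epsilon> < cmod (Gf B s n (cis t))}" by auto
    finally show ?thesis .
  qed
  have "measure lborel {t \<in> {0..2*pi}. \<epsilon> < cmod (Gf B s n (cis t))} \<le> measure lborel (A1 \<union> A2)"
    by (rule measure_mono_fmeasurable[OF sub meas]) (use fm in auto)
  also have "\<dots> \<le> measure lborel A1 + measure lborel A2" using fm by (intro measure_Un_le) auto
  finally show ?thesis using m1 m2 by linarith
qed

end


subsection \<open>Bloch-type polynomials\<close>

locale regular_majorant =
  fixes w :: "real \<Rightarrow> real" and \<alpha> :: real
  assumes cont: "continuous_on {0..1} w" and mono: "mono_on {0..1} w" and pos: "\<And>t. 0 < t \<Longrightarrow> t \<le> 1 \<Longrightarrow> 0 < w t"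
    and \<alpha>: "0 < \<alpha>" "\<alpha> < 1" and anti: "antimono_on {0<..1} (\<lambda>t. w t / t powr \<alpha>)"
begin

lemma w_mono: "0 \<le> s \<Longrightarrow> s \<le> t \<Longrightarrow> t \<le> 1 \<Longrightarrow> w s \<le> w t"
  using mono by (auto simp: mono_on_def)

lemma w_growth:
  assumes "0 < s" "s \<le> t" "t \<le> 1"
  shows "w t \<le> w s * (t / s) powr \<alpha>"
proof -
  have "w t / t powr \<alpha> \<le> w s / s powr \<alpha>"
    using anti assms by (auto simp: monotone_on_def)
  then have "w t \<le> w s / s powr \<alpha> * t powr \<alpha>" using assms by (simp add: pos_divide_le_eq)
  also have "\<dots> = w s * (t / s) powr \<alpha>" using assms by (simp add: powr_divide)
  finally show ?thesis .
qed

lemma w_linear: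
  assumes "0 < s" "s \<le> t" "t \<le> 1"
  shows "w t \<le> w s * (t / s)"
proof -
  have "(t / s) powr \<alpha> \<le> (t / s) powr 1" using assms \<alpha> by (intro powr_mono) auto
  then have "w s * (t / s) powr \<alpha> \<le> w s * (t / s)" using assms pos[of s] by (intro mult_left_mono) auto
  then show ?thesis using w_growth[OF assms] by linarith
qed

text \<open>On the interval (q^-(k+1), q^-k] the integrand is at most \<open>c k\<close>, and
  \<open>c k\<close> times the length is below q w(q^-k)^2. Bounded partial sums would therefore
  bound the integral.\<close>

lemma divergent_sums:
  fixes q :: nat
  assumes q: "2 \<le> q" and inf: "(\<integral>\<^sup>+t\<in>{0<..1}. ennreal ((w t)\<^sup>2 / t) \<partial>lborel) = \<infinity>"
  shows "\<exists>n. M < (\<Sum>k<n. (w (1 / real q ^ k))\<^sup>2)"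
proof (rule ccontr)
  assume "\<not> ?thesis"
  then have M: "(\<Sum>k<n. (w (1 / real q ^ k))\<^sup>2) \<le> M" for n by (simp add: not_less)
  define I where "I k = {1 / real q ^ Suc k<..1 / real q ^ k}" for k
  define c where "c k = real q ^ Suc k * (w (1 / real q ^ k))\<^sup>2" for k
  have "(\<integral>\<^sup>+t\<in>{0<..1}. ennreal ((w t)\<^sup>2 / t) \<partial>lborel) \<le> (\<integral>\<^sup>+t. (\<Sum>k. ennreal (c k) * indicator (I k) t) \<partial>lborel)"
  proof (rule nn_integral_mono)
    fix t :: real
    show "ennreal ((w t)\<^sup>2 / t) * indicator {0<..1} t \<le> (\<Sum>k. ennreal (c k) * indicator (I k) t)"
    proof (cases "t \<in> {0<..1}")
      case True
      obtain m where "1 / t < real q ^ m" using real_arch_pow[of "real q" "1 / t"] q by auto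
      then have m: "1 / real q ^ m < t" using True q by (simp add: field_simps)
      define l where "l = (LEAST m. 1 / real q ^ m < t)"
      have l: "1 / real q ^ l < t" unfolding l_def by (rule LeastI[of "\<lambda>m. 1 / real q ^ m < t", OF m])
      have "l \<noteq> 0"
      proof
        assume "l = 0" then show False using l True by simp
      qed
      then obtain k where k: "l = Suc k" by (cases l) auto
      have "\<not> 1 / real q ^ k < t" by (rule not_less_Least) (use k in \<open>simp add: l_def[symmetric]\<close>)
      then have tk: "1 / real q ^ Suc k < t" "t \<le> 1 / real q ^ k" using l k by auto
      have qk: "1 / real q ^ k \<le> 1" using q by simp
      have "(w t)\<^sup>2 \<le> (w (1 / real q ^ k))\<^sup>2"
        using w_mono[of t "1 / real q ^ k"] pos[of t] True tk qk by (intro power_mono) auto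
      moreover have "1 / t \<le> real q ^ Suc k" using tk True q by (simp add: field_simps)
      ultimately have "(w t)\<^sup>2 * (1 / t) \<le> (w (1 / real q ^ k))\<^sup>2 * real q ^ Suc k" using True by (intro mult_mono) auto
      then have "ennreal ((w t)\<^sup>2 / t) \<le> ennreal (c k) * indicator (I k) t"
        using tk by (simp add: c_def I_def mult.commute ennreal_leI)
      also have "\<dots> \<le> (\<Sum>k. ennreal (c k) * indicator (I k) t)"
      proof -
        define f where "f = (\<lambda>k. ennreal (c k) * indicator (I k) t)"
        have "f k \<le> suminf f" using sum_le_suminf[of f "{k}"] by simp
        then show ?thesis by (simp only: f_def)
      qed
      finally show ?thesis using True by simp
    qed simp
  qed
  also have "\<dots> = (\<Sum>k. \<integral>\<^sup>+t. ennreal (c k) * indicator (I k) t \<partial>lborel)"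
    by (rule nn_integral_suminf) (simp add: I_def)
  also have "\<dots> \<le> (\<Sum>k. ennreal (real q * (w (1 / real q ^ k))\<^sup>2))"
  proof (intro suminf_le allI)
    fix k
    have le: "1 / real q ^ Suc k \<le> 1 / real q ^ k" using q by (intro divide_left_mono power_increasing) auto
    have "(\<integral>\<^sup>+t. ennreal (c k) * indicator (I k) t \<partial>lborel) = ennreal (c k) * ennreal (1 / real q ^ k - 1 / real q ^ Suc k)"
      by (subst nn_integral_cmult_indicator) (use le in \<open>auto simp: I_def\<close>)
    also have "\<dots> = ennreal (c k * (1 / real q ^ k - 1 / real q ^ Suc k))"
      using le by (intro ennreal_mult[symmetric]) (auto simp: c_def)
    also have "\<dots> \<le> ennreal (c k * (1 / real q ^ k))"
      by (intro ennreal_leI mult_left_mono) (auto simp: c_def)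
    also have "c k * (1 / real q ^ k) = real q * (w (1 / real q ^ k))\<^sup>2" using q by (simp add: c_def)
    finally show "(\<integral>\<^sup>+t. ennreal (c k) * indicator (I k) t \<partial>lborel) \<le> ennreal (real q * (w (1 / real q ^ k))\<^sup>2)" .
  qed auto
  also have "\<dots> \<le> ennreal (real q * M)"
  proof (rule suminf_le_const)
    fix n
    have "(\<Sum>k<n. ennreal (real q * (w (1 / real q ^ k))\<^sup>2)) = ennreal (\<Sum>k<n. real q * (w (1 / real q ^ k))\<^sup>2)"
      by (rule sum_ennreal) auto
    also have "\<dots> \<le> ennreal (real q * M)"
      unfolding sum_distrib_left[symmetric] by (intro ennreal_leI mult_left_mono M) auto
    finally show "(\<Sum>k<n. ennreal (real q * (w (1 / real q ^ k))\<^sup>2)) \<le> ennreal (real q * M)" .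
  qed auto
  finally show False unfolding inf by (simp add: top_unique)
qed

text \<open>q^(1 - \<alpha>) exceeds 4 for large q, because \<alpha> < 1.\<close>

lemma q_exists: obtains q :: nat where "8 \<le> q" "4 * real q powr \<alpha> \<le> real q"
proof -
  obtain q :: nat where q: "max 8 (4 powr (1 / (1 - \<alpha>))) \<le> real q" using real_arch_simple by blast
  then have q8: "8 \<le> q" by simp
  have "4 = (4 powr (1 / (1 - \<alpha>))) powr (1 - \<alpha>)" using \<alpha> by (simp add: powr_powr)
  also have "\<dots> \<le> real q powr (1 - \<alpha>)" using q \<alpha> by (intro powr_mono2) auto
  finally have "4 * real q powr \<alpha> \<le> real q powr (1 - \<alpha>) * real q powr \<alpha>" by (intro mult_right_mono) auto
  also have "\<dots> = real q" using q8 by (simp flip: powr_add)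
  finally show ?thesis using that q8 by blast
qed

text \<open>The order of choices matters: s' from the measure bound and B from the required size on
  the circle, then \<eta> small against the resulting constant L, and the number \<open>n\<close> of
  factors last. Divergence of the sum of w(q^-k)^2 permits this for every \<eta>.\<close>

theorem bloch_function:
  assumes inf: "(\<integral>\<^sup>+t\<in>{0<..1}. ennreal ((w t)\<^sup>2 / t) \<partial>lborel) = \<infinity>" and e: "0 < \<epsilon>"
  obtains G R where "1 < R" "G holomorphic_on ball 0 R" "G 0 = 1"
    "\<And>z. z \<in> \<D> \<Longrightarrow> (1 - cmod z) * cmod (deriv G z) \<le> \<epsilon> * w (1 - cmod z)"
    "measure lborel {t \<in> {0..2*pi}. \<epsilon> < cmod (G (cis t))} \<le> \<epsilon>"
proof -
  obtain q :: nat where q: "8 \<le> q" "4 * real q powr \<alpha> \<le> real q" using q_exists by blast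
  define \<rho> where "\<rho> = real q powr \<alpha>"
  define B where "B = max 0 (- 2 * ln \<epsilon>)"
  define s' where "s' = min (1/8) (\<epsilon> / (14 * pi))"
  define s where "s = s' ^ 3"
  define L where "L = B * exp (B / s) * (40 / s)"
  \<comment> \<open>The first bound ensures \<open>b 0 \<le> 1/256\<close>; the second absorbs L
    together with the factor \<rho> lost between neighbouring levels. L + 1 avoids a division by
    zero.\<close>
  define \<eta> where "\<eta> = min (1 / (256 * w 1)) (\<epsilon> / (\<rho> * (L + 1)))"
  have w1: "0 < w 1" using pos by simp
  have B: "0 \<le> B" "exp (- B / 2) \<le> \<epsilon>"
  proof -
    show "0 \<le> B" by (simp add: B_def)
    have "- B / 2 \<le> ln \<epsilon>" by (simp add: B_def)
    then have "exp (- B / 2) \<le> exp (ln \<epsilon>)" by (simp only: exp_le_cancel_iff)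
    then show "exp (- B / 2) \<le> \<epsilon>" using e by simp
  qed
  have s': "0 < s'" "s' \<le> 1/8" "14 * pi * s' \<le> \<epsilon>"
  proof -
    show "0 < s'" "s' \<le> 1/8" using e by (auto simp: s'_def)
    have "s' \<le> \<epsilon> / (14 * pi)" by (simp add: s'_def)
    then show "14 * pi * s' \<le> \<epsilon>" by (simp add: field_simps)
  qed
  have s: "0 < s" using s' by (simp add: s_def)
  have L: "0 \<le> L" using B s by (simp add: L_def)
  have rho: "0 < \<rho>" using q by (simp add: \<rho>_def)
  have eta: "0 < \<eta>" "\<eta> * w 1 \<le> 1/256" "L * (\<eta> * \<rho>) \<le> \<epsilon>"
  proof -
    show "0 < \<eta>" using w1 e rho L by (auto simp: \<eta>_def)
    have "\<eta> \<le> 1 / (256 * w 1)" by (simp add: \<eta>_def)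
    then show "\<eta> * w 1 \<le> 1/256" using w1 by (simp add: field_simps)
    have "\<eta> \<le> \<epsilon> / (\<rho> * (L + 1))" by (simp add: \<eta>_def)
    then have "\<eta> * (\<rho> * (L + 1)) \<le> \<epsilon>" using rho L by (simp add: pos_le_divide_eq)
    moreover have "L * (\<eta> * \<rho>) \<le> \<eta> * (\<rho> * (L + 1))" using \<open>0 < \<eta>\<close> rho by (simp add: algebra_simps)
    ultimately show "L * (\<eta> * \<rho>) \<le> \<epsilon>" by linarith
  qed
  define b where "b = (\<lambda>k. \<eta> * w (1 / real q ^ k))"
  have qk: "0 < 1 / real q ^ k" "1 / real q ^ k \<le> 1" for k using q(1) by auto
  have qs: "1 / real q ^ Suc k \<le> 1 / real q ^ k" for k using q(1) by (intro divide_left_mono power_increasing) auto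
  interpret riesz q b \<rho>
  proof
    show "8 \<le> q" by (rule q(1))
    show "0 \<le> b k" for k using eta(1) pos[OF qk] by (simp add: b_def less_imp_le)
    show "b (Suc k) \<le> b k" for k
      unfolding b_def using eta(1) w_mono[OF less_imp_le[OF qk(1)] qs qk(2)] by (intro mult_left_mono) auto
    show "b 0 \<le> 1/256" using eta(2) by (simp add: b_def)
    show "b k \<le> \<rho> * b (Suc k)" for k
    proof -
      have "w (1 / real q ^ k) \<le> w (1 / real q ^ Suc k) * ((1 / real q ^ k) / (1 / real q ^ Suc k)) powr \<alpha>"
        by (rule w_growth[OF qk(1) qs qk(2)])
      also have "(1 / real q ^ k) / (1 / real q ^ Suc k) = real q" using q(1) by simp
      finally have "\<eta> * w (1 / real q ^ k) \<le> \<eta> * (w (1 / real q ^ Suc k) * \<rho>)"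
        unfolding \<rho>_def using eta(1) by (intro mult_left_mono) auto
      then show ?thesis by (simp add: b_def mult_ac)
    qed
    show "0 \<le> \<rho>" "4 * \<rho> \<le> real q" using rho q(2) by (auto simp: \<rho>_def)
  qed
  \<comment> \<open>The threshold is the one for which exp (- \<eta>^2 / 32 times the sum) falls
    below s'.\<close>
  obtain n where n: "- 32 * ln s' / \<eta>\<^sup>2 < (\<Sum>k<n. (w (1 / real q ^ k))\<^sup>2)"
    using divergent_sums[OF _ inf, of q] q(1) by auto
  have pr: "(\<Prod>k<n. 1 - (b k)\<^sup>2 / 32) \<le> s'"
  proof -
    have "(\<Prod>k<n. 1 - (b k)\<^sup>2 / 32) \<le> (\<Prod>k<n. exp (- ((b k)\<^sup>2 / 32)))"
    proof (intro prod_mono conjI)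
      fix k
      have "(b k)\<^sup>2 \<le> 1" using b_small[of k] b_nonneg[of k] by (intro power_le_one) auto
      then show "0 \<le> 1 - (b k)\<^sup>2 / 32" by simp
      show "1 - (b k)\<^sup>2 / 32 \<le> exp (- ((b k)\<^sup>2 / 32))" using exp_ge_add_one_self[of "- ((b k)\<^sup>2 / 32)"] by simp
    qed
    also have "\<dots> = exp (- (\<eta>\<^sup>2 / 32 * (\<Sum>k<n. (w (1 / real q ^ k))\<^sup>2)))"
      by (simp add: exp_sum[symmetric] b_def power_mult_distrib sum_distrib_left sum_negf)
    also have "\<dots> \<le> exp (ln s')"
    proof -
      have "- 32 * ln s' \<le> \<eta>\<^sup>2 * (\<Sum>k<n. (w (1 / real q ^ k))\<^sup>2)"
        using n eta(1) by (simp add: field_simps)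
      then show ?thesis by simp
    qed
    finally show ?thesis using s' by simp
  qed
  obtain R where R: "1 < R" "Gf B s n holomorphic_on ball 0 R" using Gf_hol[OF s] by blast
  show ?thesis
  proof (rule that[OF R])
    show "Gf B s n 0 = 1" by (rule Gf_zero[OF s])
    have "measure lborel {t \<in> {0..2*pi}. \<epsilon> < cmod (Gf B s n (cis t))} \<le> 14 * pi * s'"
      unfolding s_def by (rule bad_measure[OF s'(1,2) B(1) pr B(2)])
    then show "measure lborel {t \<in> {0..2*pi}. \<epsilon> < cmod (Gf B s n (cis t))} \<le> \<epsilon>" using s'(3) by linarith
    fix z assume z: "z \<in> \<D>"
    obtain k where k: "N k * (1 - cmod z) \<le> 1" "1 \<le> N (Suc k) * (1 - cmod z)"
      "(1 - cmod z) * cmod (deriv (Gf B s n) z) \<le> B * exp (B / s) * (40 / s) * b k"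
      using Gf_deriv[OF s B(1) z] by blast
    have dpos: "0 < 1 - cmod z" "1 - cmod z \<le> 1" using z by auto
    \<comment> \<open>The depth is known to be at least q^-(k+1), so the comparison of
      \<open>b k\<close> with w at that depth costs one factor \<rho>.\<close>
    have "1 / real q ^ Suc k \<le> 1 - cmod z" using k(2) q(1) by (simp add: N_def field_simps)
    then have "w (1 / real q ^ Suc k) \<le> w (1 - cmod z)" by (intro w_mono less_imp_le[OF qk(1)] dpos)
    moreover have "b k \<le> \<rho> * (\<eta> * w (1 / real q ^ Suc k))" using growth[of k] by (simp add: b_def)
    moreover have "\<rho> * (\<eta> * w (1 / real q ^ Suc k)) \<le> \<rho> * (\<eta> * w (1 - cmod z))"
      using calculation(1) rho eta(1) by (intro mult_left_mono) auto
    ultimately have "b k \<le> \<rho> * (\<eta> * w (1 - cmod z))" by linarith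
    then have "L * b k \<le> L * (\<rho> * (\<eta> * w (1 - cmod z)))" using L by (rule mult_left_mono)
    also have "\<dots> = L * (\<eta> * \<rho>) * w (1 - cmod z)" by simp
    also have "\<dots> \<le> \<epsilon> * w (1 - cmod z)" using eta(3) pos[OF dpos] by (intro mult_right_mono) auto
    finally show "(1 - cmod z) * cmod (deriv (Gf B s n) z) \<le> \<epsilon> * w (1 - cmod z)" using k(3) by (simp add: L_def)
  qed
qed

text \<open>Truncation of the Taylor series. G is holomorphic beyond the closed disc, so the
  coefficient tails of G and G' are uniformly small on the disc. A uniform error in the derivative
  is admissible, since (1 - |z|) w(1) <= w(1 - |z|).\<close>

theorem bloch_polynomial:
  assumes inf: "(\<integral>\<^sup>+t\<in>{0<..1}. ennreal ((w t)\<^sup>2 / t) \<partial>lborel) = \<infinity>" and e: "0 < \<epsilon>"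
  obtains d and g :: "nat \<Rightarrow> complex" where "g 0 = 1" "\<And>m. d \<le> m \<Longrightarrow> g m = 0"
    "\<And>z. z \<in> \<D> \<Longrightarrow> (1 - cmod z) * cmod (deriv (\<lambda>z. \<Sum>m<d. g m * z ^ m) z) \<le> \<epsilon> * w (1 - cmod z)"
    "measure lborel {t \<in> {0..2*pi}. \<epsilon> < cmod (\<Sum>m<d. g m * cis t ^ m)} \<le> \<epsilon>"
proof -
  have e2: "0 < \<epsilon> / 2" using e by simp
  obtain G R where R: "1 < R" and G: "G holomorphic_on ball 0 R" "G 0 = 1"
    and Gd: "\<And>z. z \<in> \<D> \<Longrightarrow> (1 - cmod z) * cmod (deriv G z) \<le> \<epsilon> / 2 * w (1 - cmod z)"
    and Gm: "measure lborel {t \<in> {0..2*pi}. \<epsilon> / 2 < cmod (G (cis t))} \<le> \<epsilon> / 2"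
    by (rule bloch_function[OF inf e2], rule that)
  define a where "a = (\<lambda>m. (deriv ^^ m) G 0 / fact m)"
  have sums: "(\<lambda>m. a m * z ^ m) sums G z" if "z \<in> ball 0 R" for z
    using holomorphic_power_series[OF G(1) that] by (simp add: a_def)
  define K where "K = (1 + R) / 2"
  have K: "1 < K" "K < R" using R by (auto simp: K_def)
  have sumK: "summable (\<lambda>m. a m * (of_real K) ^ m)" using sums[of "of_real K"] K by (auto simp: sums_iff)
  have sumR: "summable (\<lambda>m. a m * z ^ m)" if "cmod z < R" for z using sums[of z] that by (auto simp: sums_iff)
  have abs_a: "summable (\<lambda>m. cmod (a m))"
    using powser_insidea[OF sumK, of 1] K by simp
  have abs_d: "summable (\<lambda>m. cmod (diffs a m))"
  proof -
    have "summable (\<lambda>m. diffs a m * (of_real K) ^ m)"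
      by (rule termdiff_converges[of "of_real K :: complex" R]) (use K sumR in auto)
    from powser_insidea[OF this, of 1] K show ?thesis by simp
  qed
  have derG: "deriv G z = (\<Sum>m. diffs a m * z ^ m)" if "cmod z < 1" for z
  proof -
    have "((\<lambda>z. \<Sum>m. a m * z ^ m) has_field_derivative (\<Sum>m. diffs a m * z ^ m)) (at z)"
      by (rule termdiffs_strong[OF sumK]) (use that K in auto)
    then have "(G has_field_derivative (\<Sum>m. diffs a m * z ^ m)) (at z)"
    proof (rule has_field_derivative_transform_within_open[of _ _ _ "ball 0 R"])
      fix x :: complex assume "x \<in> ball 0 R"
      then show "(\<Sum>m. a m * x ^ m) = G x" using sums[of x] by (simp add: sums_iff)
    qed (use that K in auto)
    then show ?thesis by (rule DERIV_imp_deriv)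
  qed
  define \<delta> where "\<delta> = min (\<epsilon> / 2) (\<epsilon> / 2 * w 1)"
  have \<delta>: "0 < \<delta>" using e pos[of 1] by (simp add: \<delta>_def)
  have "(\<lambda>n. \<Sum>i. cmod (diffs a (i + n))) \<longlonglongrightarrow> 0" "(\<lambda>n. \<Sum>i. cmod (a (i + n))) \<longlonglongrightarrow> 0"
    by (rule suminf_exist_split2[OF abs_d], rule suminf_exist_split2[OF abs_a])
  then have "\<forall>\<^sub>F n in sequentially. (\<Sum>i. cmod (diffs a (i + n))) < \<delta>" "\<forall>\<^sub>F n in sequentially. (\<Sum>i. cmod (a (i + n))) < \<delta>"
    using \<delta> by (auto dest: order_tendstoD(2))
  then have ev: "\<forall>\<^sub>F n in sequentially. (\<Sum>i. cmod (diffs a (i + n))) < \<delta> \<and> (\<Sum>i. cmod (a (i + n))) < \<delta>"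
    by (rule eventually_conj)
  then obtain n0 where n0: "\<And>n. n \<ge> n0 \<Longrightarrow> (\<Sum>i. cmod (diffs a (i + n))) < \<delta> \<and> (\<Sum>i. cmod (a (i + n))) < \<delta>"
    unfolding eventually_sequentially by blast
  define D where "D = n0"
  \<comment> \<open>Differentiation lowers the degree: \<open>D\<close> terms of the derivative
    correspond to \<open>Suc D\<close> terms of the series.\<close>
  define d where "d = Suc D"
  define g where "g = (\<lambda>m. if m < d then a m else 0)"
  have Q: "(\<Sum>m<d. g m * z ^ m) = (\<Sum>m<d. a m * z ^ m)" for z by (simp add: g_def)
  have tail_d: "(\<Sum>i. cmod (diffs a (i + D))) < \<delta>" and tail_a: "(\<Sum>i. cmod (a (i + d))) < \<delta>"
    using n0[of D] n0[of d] by (auto simp: D_def d_def)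
  have derQ: "deriv (\<lambda>z. \<Sum>m<d. a m * z ^ m) z = (\<Sum>m<D. diffs a m * z ^ m)" for z
  proof (rule DERIV_imp_deriv)
    have "((\<lambda>z. \<Sum>m<d. a m * z ^ m) has_field_derivative (\<Sum>m<d. a m * (of_nat m * z ^ (m - 1)))) (at z)"
      by (auto intro!: derivative_eq_intros simp: mult_ac)
    also have "(\<Sum>m<d. a m * (of_nat m * z ^ (m - 1))) = (\<Sum>m<D. diffs a m * z ^ m)"
      unfolding d_def by (subst sum.lessThan_Suc_shift) (simp add: diffs_def mult_ac)
    finally show "((\<lambda>z. \<Sum>m<d. a m * z ^ m) has_field_derivative (\<Sum>m<D. diffs a m * z ^ m)) (at z)" .
  qed
  have tail: "cmod ((\<Sum>m. c m * z ^ m) - (\<Sum>m<n. c m * z ^ m)) \<le> (\<Sum>i. cmod (c (i + n)))"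
    if c: "summable (\<lambda>m. cmod (c m))" and z: "cmod z \<le> 1" for c :: "nat \<Rightarrow> complex" and z n
  proof -
    have le: "cmod (c m * z ^ m) \<le> cmod (c m)" for m
      using z by (simp add: norm_mult norm_power mult_left_le power_le_one)
    have "summable (\<lambda>m. c m * z ^ m)"
      by (rule summable_comparison_test[OF _ c]) (use le in blast)
    from suminf_split_initial_segment[OF this, of n]
    have "(\<Sum>m. c m * z ^ m) - (\<Sum>m<n. c m * z ^ m) = (\<Sum>i. c (i + n) * z ^ (i + n))" by simp
    also have "cmod \<dots> \<le> (\<Sum>i. cmod (c (i + n)))"
      by (rule norm_suminf_le[OF le summable_ignore_initial_segment[OF c]])
    finally show ?thesis .
  qed
  show ?thesis
  proof (rule that[of g d])
    show "g 0 = 1" using G(2) by (simp add: g_def d_def a_def)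
    show "g m = 0" if "d \<le> m" for m using that by (simp add: g_def)
    fix z assume z: "z \<in> \<D>"
    have z1: "cmod z < 1" "cmod z \<le> 1" using z by auto
    have "cmod (deriv G z - deriv (\<lambda>z. \<Sum>m<d. g m * z ^ m) z) \<le> (\<Sum>i. cmod (diffs a (i + D)))"
      unfolding Q derQ derG[OF z1(1)] by (rule tail[OF abs_d z1(2)])
    then have "cmod (deriv (\<lambda>z. \<Sum>m<d. g m * z ^ m) z) \<le> cmod (deriv G z) + \<delta>"
      using norm_triangle_ineq2[of "deriv (\<lambda>z. \<Sum>m<d. g m * z ^ m) z" "deriv G z"] tail_d
      by (simp add: norm_minus_commute)
    then have "(1 - cmod z) * cmod (deriv (\<lambda>z. \<Sum>m<d. g m * z ^ m) z) \<le> (1 - cmod z) * (cmod (deriv G z) + \<delta>)"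
      using z1 by (intro mult_left_mono) auto
    also have "\<dots> = (1 - cmod z) * cmod (deriv G z) + (1 - cmod z) * \<delta>" by (simp add: algebra_simps)
    also have "\<dots> \<le> \<epsilon> / 2 * w (1 - cmod z) + \<epsilon> / 2 * w (1 - cmod z)"
    proof (rule add_mono[OF Gd[OF z]])
      have "w 1 \<le> w (1 - cmod z) * (1 / (1 - cmod z))" by (rule w_linear) (use z1 in auto)
      then have "(1 - cmod z) * w 1 \<le> w (1 - cmod z)" using z1 by (simp add: field_simps)
      then have "\<epsilon> / 2 * ((1 - cmod z) * w 1) \<le> \<epsilon> / 2 * w (1 - cmod z)" using e by (intro mult_left_mono) auto
      moreover have "(1 - cmod z) * \<delta> \<le> (1 - cmod z) * (\<epsilon> / 2 * w 1)" using z1 by (intro mult_left_mono) (auto simp: \<delta>_def)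
      moreover have "(1 - cmod z) * (\<epsilon> / 2 * w 1) = \<epsilon> / 2 * ((1 - cmod z) * w 1)" by simp
      ultimately show "(1 - cmod z) * \<delta> \<le> \<epsilon> / 2 * w (1 - cmod z)" by linarith
    qed
    also have "\<dots> = \<epsilon> * w (1 - cmod z)" by simp
    finally show "(1 - cmod z) * cmod (deriv (\<lambda>z. \<Sum>m<d. g m * z ^ m) z) \<le> \<epsilon> * w (1 - cmod z)" .
  next
    have cG: "continuous_on {0..2*pi} (\<lambda>t. G (cis t))"
      by (rule continuous_on_compose2[OF holomorphic_on_imp_continuous_on[OF G(1)]])
         (use R in \<open>auto intro!: continuous_intros\<close>)
    have cQ: "continuous_on {0..2*pi} (\<lambda>t. \<Sum>m<d. g m * cis t ^ m)" by (intro continuous_intros)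
    have strict: "{t \<in> {0..2*pi}. c < cmod (f t)} \<in> fmeasurable lborel"
      if f: "continuous_on {0..2*pi} f" for c and f :: "real \<Rightarrow> complex"
    proof -
      have "{0..2*pi} - {t \<in> {0..2*pi}. - c \<le> - cmod (f t)} \<in> fmeasurable lborel"
        by (intro fmeasurable.Diff fmeasurable_superlevel continuous_intros f fmeasurable_compact compact_Icc)
      also have "{0..2*pi} - {t \<in> {0..2*pi}. - c \<le> - cmod (f t)} = {t \<in> {0..2*pi}. c < cmod (f t)}" by auto
      finally show ?thesis .
    qed
    have sub: "{t \<in> {0..2*pi}. \<epsilon> < cmod (\<Sum>m<d. g m * cis t ^ m)} \<subseteq> {t \<in> {0..2*pi}. \<epsilon> / 2 < cmod (G (cis t))}"
    proof clarify
      fix t assume t: "\<epsilon> < cmod (\<Sum>m<d. g m * cis t ^ m)"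
      have "G (cis t) = (\<Sum>m. a m * cis t ^ m)" using sums[of "cis t"] R by (simp add: sums_iff)
      then have "cmod (G (cis t) - (\<Sum>m<d. g m * cis t ^ m)) \<le> (\<Sum>i. cmod (a (i + d)))"
        unfolding Q by (simp only:) (rule tail[OF abs_a], simp)
      then have "cmod (\<Sum>m<d. g m * cis t ^ m) \<le> cmod (G (cis t)) + \<delta>"
        using norm_triangle_ineq2[of "\<Sum>m<d. g m * cis t ^ m" "G (cis t)"] tail_a by (simp add: norm_minus_commute)
      moreover have "\<delta> \<le> \<epsilon> / 2" by (simp add: \<delta>_def)
      ultimately show "\<epsilon> / 2 < cmod (G (cis t))" using t by simp
    qed
    have "measure lborel {t \<in> {0..2*pi}. \<epsilon> < cmod (\<Sum>m<d. g m * cis t ^ m)} \<le> measure lborel {t \<in> {0..2*pi}. \<epsilon> / 2 < cmod (G (cis t))}"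
      by (rule measure_mono_fmeasurable[OF sub fmeasurableD[OF strict[OF cQ]] strict[OF cG]])
    then show "measure lborel {t \<in> {0..2*pi}. \<epsilon> < cmod (\<Sum>m<d. g m * cis t ^ m)} \<le> \<epsilon>" using Gm e by linarith
  qed
qed

end


subsection \<open>Duality\<close>

lemma nn_integral_polar':
  fixes f :: "complex \<Rightarrow> ennreal"
  assumes [measurable]: "f \<in> borel_measurable borel"
  shows "(\<integral>\<^sup>+z. f z \<partial>lborel) =
    (\<integral>\<^sup>+r. ennreal r * indicator {0<..} r * (\<integral>\<^sup>+t. f (of_real r * cis t) * indicator {0<..<2*pi} t \<partial>lborel) \<partial>lborel)"
proof -
  have m [measurable]: "(\<lambda>p. f (of_real (fst p) * cis (snd p))) \<in> borel_measurable (borel \<Otimes>\<^sub>M borel)"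
    unfolding cis_conv_exp by measurable
  have mt [measurable]: "(\<lambda>t. f (of_real r * cis t)) \<in> borel_measurable borel" for r
    unfolding cis_conv_exp by measurable
  have mr [measurable]: "(\<lambda>r. f (of_real r * cis t)) \<in> borel_measurable borel" for t
    unfolding cis_conv_exp by measurable
  have "(\<integral>\<^sup>+z. f z \<partial>lborel) = (\<integral>\<^sup>+t. (\<integral>\<^sup>+r. ennreal r * f (of_real r * cis t) * indicator {0<..} r * indicator {0<..<2*pi} t \<partial>lborel) \<partial>lborel)"
    unfolding nn_integral_polar[OF assms] radial_def
    by (intro nn_integral_cong nn_integral_multc[symmetric]) measurable
  also have "\<dots> = (\<integral>\<^sup>+r. (\<integral>\<^sup>+t. ennreal r * f (of_real r * cis t) * indicator {0<..} r * indicator {0<..<2*pi} t \<partial>lborel) \<partial>lborel)"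
  proof (rule lborel_pair.Fubini')
    show "(\<lambda>(r, t). ennreal r * f (of_real r * cis t) * indicator {0<..} r * indicator {0<..<2*pi} t) \<in> borel_measurable (lborel \<Otimes>\<^sub>M lborel)"
      using m unfolding split_beta by measurable
  qed
  also have "\<dots> = (\<integral>\<^sup>+r. ennreal r * indicator {0<..} r * (\<integral>\<^sup>+t. f (of_real r * cis t) * indicator {0<..<2*pi} t \<partial>lborel) \<partial>lborel)"
  proof (rule nn_integral_cong)
    fix r
    show "(\<integral>\<^sup>+t. ennreal r * f (of_real r * cis t) * indicator {0<..} r * indicator {0<..<2*pi} t \<partial>lborel)
      = ennreal r * indicator {0<..} r * (\<integral>\<^sup>+t. f (of_real r * cis t) * indicator {0<..<2*pi} t \<partial>lborel)"
    proof -
      have meas: "(\<lambda>t. f (of_real r * cis t) * indicator {0<..<2*pi} t) \<in> borel_measurable lborel" by measurable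
      show ?thesis unfolding nn_integral_cmult[OF meas, symmetric]
        by (intro nn_integral_cong) (simp only: mult_ac)
    qed
  qed
  finally show ?thesis .
qed

lemma nn_integral_polar_measurable:
  fixes f :: "complex \<Rightarrow> ennreal"
  assumes [measurable]: "f \<in> borel_measurable borel"
  shows "(\<lambda>r. ennreal r * indicator {0<..} r * (\<integral>\<^sup>+t. f (of_real r * cis t) * indicator {0<..<2*pi} t \<partial>lborel)) \<in> borel_measurable borel"
proof -
  have m: "(\<lambda>p. f (of_real (fst p) * cis (snd p))) \<in> borel_measurable (borel \<Otimes>\<^sub>M lborel)"
    unfolding cis_conv_exp by measurable
  have "(\<lambda>r. \<integral>\<^sup>+t. f (of_real r * cis t) * indicator {0<..<2*pi} t \<partial>lborel) \<in> borel_measurable borel"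
  proof (rule lborel.borel_measurable_nn_integral)
    show "(\<lambda>(r, t). f (of_real r * cis t) * indicator {0<..<2*pi} t) \<in> borel_measurable (borel \<Otimes>\<^sub>M lborel)"
      using m unfolding split_beta by measurable
  qed
  then show ?thesis by measurable
qed

lemma taylor_coeff_deriv: "taylor_coeff (deriv f) m = of_nat (Suc m) * taylor_coeff f (Suc m)"
  unfolding taylor_coeff_def funpow_Suc_right o_def by (simp add: field_simps del: of_nat_Suc)

text \<open>Monotonicity for t <= s and sublinear growth for t >= s in one inequality. Being affine
  in t, the bound integrates explicitly against powers of r.\<close>

lemma (in regular_majorant) w_le_affine:
  assumes "0 < s" "s \<le> 1" "0 < t" "t \<le> 1"
  shows "w t \<le> w s * (1 + t / s)"
proof (cases "t \<le> s")
  case True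
  have "w t \<le> w s" by (rule w_mono) (use assms True in auto)
  also have "\<dots> = w s * 1" by simp
  also have "\<dots> \<le> w s * (1 + t / s)" using pos[OF assms(1,2)] assms by (intro mult_left_mono) auto
  finally show ?thesis .
next
  case False
  then have "w t \<le> w s * (t / s)" using w_linear[of s t] assms by simp
  also have "\<dots> \<le> w s * (1 + t / s)" using pos[OF assms(1,2)] by (intro mult_left_mono) auto
  finally show ?thesis .
qed

text \<open>w(t) / t is nonincreasing, so on the disc of radius |z| the bound for Q' is worst at the
  boundary. The mean value inequality retains the factor |z|, which later permits division by
  z.\<close>

lemma (in regular_majorant) bloch_diff:
  assumes hol: "Q holomorphic_on \<D>" and C: "0 \<le> C"
    and dQ: "\<And>z. z \<in> \<D> \<Longrightarrow> (1 - cmod z) * cmod (deriv Q z) \<le> C * w (1 - cmod z)" and z: "z \<in> \<D>"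
  shows "(1 - cmod z) * cmod (Q z - Q 0) \<le> cmod z * (C * w (1 - cmod z))"
proof -
  define B where "B = C * (w (1 - cmod z) / (1 - cmod z))"
  have z1: "cmod z < 1" using z by simp
  have sub: "cball 0 (cmod z) \<subseteq> \<D>" using z1 by (auto simp: subset_iff)
  have "cmod (Q z - Q 0) \<le> B * cmod (z - 0)"
  proof (rule field_differentiable_bound[of "cball 0 (cmod z)"])
    fix x :: complex assume "x \<in> cball 0 (cmod z)"
    then have x: "cmod x \<le> cmod z" and xD: "x \<in> \<D>" using sub by auto
    have x1: "0 < 1 - cmod x" "0 < 1 - cmod z" using x z1 by auto
    have "w (1 - cmod x) \<le> w (1 - cmod z) * ((1 - cmod x) / (1 - cmod z))"
      by (rule w_linear) (use x x1 in auto)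
    then have "w (1 - cmod x) / (1 - cmod x) \<le> w (1 - cmod z) / (1 - cmod z)"
      using x1 by (simp add: field_simps)
    then have "C * (w (1 - cmod x) / (1 - cmod x)) \<le> B" unfolding B_def by (rule mult_left_mono[OF _ C])
    moreover have "cmod (deriv Q x) \<le> C * (w (1 - cmod x) / (1 - cmod x))"
      using dQ[OF xD] x1 by (simp add: field_simps)
    ultimately show "cmod (deriv Q x) \<le> B" by linarith
    show "(Q has_field_derivative deriv Q x) (at x within cball 0 (cmod z))"
      by (rule has_field_derivative_at_within[OF holomorphic_derivI[OF hol _ xD]]) auto
  qed auto
  then have "(1 - cmod z) * cmod (Q z - Q 0) \<le> (1 - cmod z) * (B * cmod (z - 0))"
    using z1 by (intro mult_left_mono) auto
  also have "\<dots> = cmod z * (C * w (1 - cmod z))" using z1 by (simp add: B_def)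
  finally show ?thesis .
qed

locale majorant_hol = regular_majorant w \<alpha> for w \<alpha> +
  fixes f :: "complex \<Rightarrow> complex"
  assumes f: "f holomorphic_on \<D>"
begin

definition N :: ennreal where
  "N = (\<integral>\<^sup>+z\<in>\<D>. ennreal (cmod (deriv f z) * w (1 - cmod z)) \<partial>lborel)"

lemma df: "deriv f holomorphic_on \<D>" by (rule holomorphic_deriv[OF f]) auto

lemma circle_in: "0 \<le> r \<Longrightarrow> r < 1 \<Longrightarrow> of_real r * cis t \<in> \<D>" by (simp add: norm_mult)

lemma df_circle_cont: "0 \<le> r \<Longrightarrow> r < 1 \<Longrightarrow> continuous_on X (\<lambda>t. deriv f (of_real r * cis t))"
  by (rule continuous_on_compose2[OF holomorphic_on_imp_continuous_on[OF df]], intro continuous_intros, intro image_subsetI circle_in)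

lemma df_circle_meas: "0 \<le> r \<Longrightarrow> r < 1 \<Longrightarrow> (\<lambda>t. deriv f (of_real r * cis t)) \<in> borel_measurable borel"
  by (intro borel_measurable_continuous_onI df_circle_cont)

definition J :: "real \<Rightarrow> ennreal" where
  "J r = (\<integral>\<^sup>+t. ennreal (cmod (deriv f (of_real r * cis t))) * indicator {0<..<2*pi} t \<partial>lborel)"

text \<open>Measurability in \<open>r\<close> is inherited from the polar formula for the whole
  integrand and not proved for \<open>J\<close> by itself.\<close>

lemma N_polar:
  "(\<lambda>r. ennreal (r * w (1 - r)) * indicator {0<..<1} r * J r) \<in> borel_measurable borel"
  "N = (\<integral>\<^sup>+r. ennreal (r * w (1 - r)) * indicator {0<..<1} r * J r \<partial>lborel)"
proof -
  define g where "g z = cmod (deriv f z) * w (1 - cmod z)" for z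
  have cg: "continuous_on \<D> g"
    unfolding g_def
    by (intro continuous_intros holomorphic_on_imp_continuous_on[OF df] continuous_on_compose2[OF cont]) auto
  have "(\<lambda>z. indicator \<D> z *\<^sub>R g z) \<in> borel_measurable borel"
    by (rule borel_measurable_continuous_on_indicator[OF _ cg]) auto
  then have m: "(\<lambda>z. ennreal (indicator \<D> z *\<^sub>R g z)) \<in> borel_measurable borel" by measurable
  have "N = (\<integral>\<^sup>+z. ennreal (indicator \<D> z *\<^sub>R g z) \<partial>lborel)"
    unfolding N_def g_def by (intro nn_integral_cong) (auto simp: indicator_def)
  also have "\<dots> = (\<integral>\<^sup>+r. ennreal r * indicator {0<..} r * (\<integral>\<^sup>+t. ennreal (indicator \<D> (of_real r * cis t) *\<^sub>R g (of_real r * cis t)) * indicator {0<..<2*pi} t \<partial>lborel) \<partial>lborel)"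
    by (rule nn_integral_polar'[OF m])
  finally have N: "N = \<dots>" .
  have eq: "(\<lambda>r. ennreal r * indicator {0<..} r * (\<integral>\<^sup>+t. ennreal (indicator \<D> (of_real r * cis t) *\<^sub>R g (of_real r * cis t)) * indicator {0<..<2*pi} t \<partial>lborel))
      = (\<lambda>r. ennreal (r * w (1 - r)) * indicator {0<..<1} r * J r)"
  proof (rule ext)
    fix r :: real
    show "ennreal r * indicator {0<..} r * (\<integral>\<^sup>+t. ennreal (indicator \<D> (of_real r * cis t) *\<^sub>R g (of_real r * cis t)) * indicator {0<..<2*pi} t \<partial>lborel)
      = ennreal (r * w (1 - r)) * indicator {0<..<1} r * J r"
    proof (cases "0 < r")
      case False
      then show ?thesis by (simp add: indicator_def)
    next
      case True
      show ?thesis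
      proof (cases "r < 1")
        case False
        have "indicator \<D> (of_real r * cis t) = (0::real)" for t
          using False True by (simp add: indicator_def norm_mult)
        then show ?thesis using False by (simp add: indicator_def)
      next
        case r1: True
        have w0: "0 \<le> w (1 - r)" using pos[of "1 - r"] True r1 by simp
        have "indicator \<D> (of_real r * cis t) *\<^sub>R g (of_real r * cis t) = w (1 - r) * cmod (deriv f (of_real r * cis t))" for t
          using True r1 by (simp add: indicator_def norm_mult g_def mult.commute)
        then have "(\<integral>\<^sup>+t. ennreal (indicator \<D> (of_real r * cis t) *\<^sub>R g (of_real r * cis t)) * indicator {0<..<2*pi} t \<partial>lborel)
          = (\<integral>\<^sup>+t. ennreal (w (1 - r)) * (ennreal (cmod (deriv f (of_real r * cis t))) * indicator {0<..<2*pi} t) \<partial>lborel)"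
          using w0 by (simp add: ennreal_mult mult.assoc)
        also have "\<dots> = ennreal (w (1 - r)) * J r"
          unfolding J_def using df_circle_meas[of r] True r1 by (subst nn_integral_cmult) auto
        finally show ?thesis using True r1 w0 by (simp add: ennreal_mult mult.assoc)
      qed
    qed
  qed
  show "(\<lambda>r. ennreal (r * w (1 - r)) * indicator {0<..<1} r * J r) \<in> borel_measurable borel"
    using nn_integral_polar_measurable[OF m] unfolding eq .
  show "N = (\<integral>\<^sup>+r. ennreal (r * w (1 - r)) * indicator {0<..<1} r * J r \<partial>lborel)"
    using N unfolding eq .
qed

text \<open>Pair f' with R = Q' + Q / z under the weight 2 r (1 - r^2). The coefficients of f' and R
  carry the factors m + 1 and m + 2, and the integral of 2 r (1 - r^2) r^(2 m) over [0, 1] is 1 /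
  ((m + 1) (m + 2)), so the result is exactly the coefficient sum. The weight 1 - r^2 cancels the 1
  / (1 - r) in the bound for R.\<close>

theorem pairing_bound:
  fixes q :: "nat \<Rightarrow> complex"
  assumes q: "\<And>m. d \<le> m \<Longrightarrow> q m = 0" "q 0 = 0" and C: "0 \<le> C"
    and dQ: "\<And>z. z \<in> \<D> \<Longrightarrow> (1 - cmod z) * cmod (deriv (\<lambda>z. \<Sum>m<d. q m * z ^ m) z) \<le> C * w (1 - cmod z)"
  shows "ennreal (cmod (\<Sum>m<d. taylor_coeff f m * cnj (q m))) \<le> ennreal (2 * C) * N"
proof -
  define Q where "Q z = (\<Sum>m<d. q m * z ^ m)" for z
  have Q_hol: "Q holomorphic_on X" for X unfolding Q_def[abs_def] by (intro holomorphic_intros)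
  have Q_sums: "(\<lambda>m. q m * z ^ m) sums Q z" for z unfolding Q_def by (rule sums_finite) (use q in auto)
  have Q_tc: "taylor_coeff Q = q" by (rule taylor_coeff_unique[OF Q_hol Q_sums])
  have dQ_hol: "deriv Q holomorphic_on \<D>" by (rule holomorphic_deriv[OF Q_hol]) auto
  have dQ': "(1 - cmod z) * cmod (deriv Q z) \<le> C * w (1 - cmod z)" if "z \<in> \<D>" for z
    using dQ[OF that] unfolding Q_def[abs_def] .
  \<comment> \<open>This is Q / z, a polynomial because \<open>q 0 = 0\<close>; the last summand
    contains \<open>q d = 0\<close>.\<close>
  define S where "S z = (\<Sum>m<d. q (Suc m) * z ^ m)" for z
  have S_hol: "S holomorphic_on X" for X unfolding S_def[abs_def] by (intro holomorphic_intros)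
  have QS: "Q z = z * S z" for z
  proof -
    have "(\<lambda>m. q (Suc m) * z ^ m) sums S z" unfolding S_def by (rule sums_finite) (use q in auto)
    then have "(\<lambda>m. z * (q (Suc m) * z ^ m)) sums (z * S z)" by (rule sums_mult)
    then have "(\<lambda>m. q (Suc m) * z ^ Suc m) sums (z * S z)" by (simp add: mult_ac)
    then have "(\<lambda>m. q m * z ^ m) sums (z * S z + q 0 * z ^ 0)" by (rule sums_Suc)
    then show ?thesis using sums_unique2[OF Q_sums] q(2) by simp
  qed
  have S_bound: "(1 - cmod z) * cmod (S z) \<le> C * w (1 - cmod z)" if z: "z \<in> \<D>" "z \<noteq> 0" for z
  proof -
    have "cmod z * ((1 - cmod z) * cmod (S z)) \<le> cmod z * (C * w (1 - cmod z))"
      using bloch_diff[OF Q_hol C dQ' z(1)] by (simp add: QS norm_mult mult_ac)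
    then show ?thesis using z by simp
  qed
  define R where "R z = deriv Q z + S z" for z
  have R_hol: "R holomorphic_on \<D>" unfolding R_def[abs_def] by (intro holomorphic_intros dQ_hol S_hol)
  have R_bound: "(1 - cmod z) * cmod (R z) \<le> 2 * C * w (1 - cmod z)" if "z \<in> \<D>" "z \<noteq> 0" for z
  proof -
    have "(1 - cmod z) * cmod (R z) \<le> (1 - cmod z) * (cmod (deriv Q z) + cmod (S z))"
      unfolding R_def using that by (intro mult_left_mono norm_triangle_ineq) auto
    also have "\<dots> = (1 - cmod z) * cmod (deriv Q z) + (1 - cmod z) * cmod (S z)" by (rule distrib_left)
    finally show ?thesis using dQ'[OF that(1)] S_bound[OF that] by simp
  qed
  have R_tc: "taylor_coeff R = (\<lambda>m. of_nat (m + 2) * q (Suc m))"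
  proof (rule taylor_coeff_unique[OF R_hol])
    fix z assume z: "z \<in> \<D>"
    have "(\<lambda>m. of_nat (Suc m) * q (Suc m) * z ^ m) sums deriv Q z"
      using taylor_coeff_sums[OF dQ_hol z] by (simp add: taylor_coeff_deriv Q_tc)
    moreover have "(\<lambda>m. q (Suc m) * z ^ m) sums S z" unfolding S_def by (rule sums_finite) (use q in auto)
    ultimately have "(\<lambda>m. of_nat (Suc m) * q (Suc m) * z ^ m + q (Suc m) * z ^ m) sums R z"
      unfolding R_def by (rule sums_add)
    then show "(\<lambda>m. of_nat (m + 2) * q (Suc m) * z ^ m) sums R z" by (simp add: algebra_simps)
  qed
  define c where "c m = of_nat (Suc m) * of_nat (m + 2) * (taylor_coeff f (Suc m) * cnj (q (Suc m)))" for m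
  \<comment> \<open>The mean of f' times the conjugate of R over the circle of radius
    \<open>r\<close>.\<close>
  define \<Phi> where "\<Phi> r = (\<Sum>m<d. c m * of_real (r ^ (2 * m)))" for r :: real
  have \<Phi>: "ennreal (2 * pi * cmod (\<Phi> r)) \<le> ennreal (2 * C * w (1 - r) / (1 - r)) * J r" if r: "0 < r" "r < 1" for r
  proof -
    have r': "0 \<le> r" using r by simp
    define k where "k t = deriv f (of_real r * cis t) * cnj (R (of_real r * cis t))" for t
    have kc: "continuous_on X k" for X
      unfolding k_def
      by (intro continuous_intros df_circle_cont[OF r' r(2)] continuous_on_compose2[OF holomorphic_on_imp_continuous_on[OF R_hol]]
          image_subsetI circle_in[OF r' r(2)])
    have "(\<Sum>m. taylor_coeff (deriv f) m * cnj (taylor_coeff R m) * of_real (r ^ (2 * m))) = \<Phi> r"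
    proof -
      have "taylor_coeff (deriv f) m * cnj (taylor_coeff R m) * of_real (r ^ (2 * m)) = c m * of_real (r ^ (2 * m))" for m
        by (simp add: R_tc taylor_coeff_deriv c_def)
      then have "(\<Sum>m. taylor_coeff (deriv f) m * cnj (taylor_coeff R m) * of_real (r ^ (2 * m))) = (\<Sum>m. c m * of_real (r ^ (2 * m)))" by (simp only:)
      also have "\<dots> = \<Phi> r" unfolding \<Phi>_def by (rule suminf_finite) (use q in \<open>auto simp: c_def\<close>)
      finally show ?thesis .
    qed
    then have hi: "(k has_integral of_real (2 * pi) * \<Phi> r) {0..2*pi}"
      using circle_parseval(2)[OF taylor_coeff_summable[OF df r' r(2)] taylor_coeff_summable[OF R_hol r' r(2)] r']
      unfolding taylor_coeff_psum[OF df circle_in[OF r' r(2)]] taylor_coeff_psum[OF R_hol circle_in[OF r' r(2)]] k_def by simp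
    have si: "set_integrable lborel {0..2*pi} k" by (rule borel_integrable_atLeastAtMost'[OF kc])
    have "of_real (2 * pi) * \<Phi> r = set_lebesgue_integral lborel {0..2*pi} k"
      using set_borel_integral_eq_integral(2)[OF si] hi by (simp add: integral_unique)
    then have "ennreal (2 * pi * cmod (\<Phi> r)) = ennreal (cmod (set_lebesgue_integral lborel {0..2*pi} k))"
      by (metis norm_mult norm_of_real abs_of_nonneg pi_ge_zero mult_nonneg_nonneg zero_le_numeral)
    also have "\<dots> \<le> (\<integral>\<^sup>+t. ennreal (cmod (indicator {0..2*pi} t *\<^sub>R k t)) \<partial>lborel)"
      unfolding set_lebesgue_integral_def by (rule integral_norm_bound_ennreal) (use si in \<open>simp add: set_integrable_def\<close>)
    also have "\<dots> \<le> (\<integral>\<^sup>+t. ennreal (2 * C * w (1 - r) / (1 - r)) * (ennreal (cmod (deriv f (of_real r * cis t))) * indicator {0<..<2*pi} t) \<partial>lborel)"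
    proof (rule nn_integral_mono_AE)
      have "AE t in lborel. t \<noteq> (0::real)" "AE t in lborel. t \<noteq> 2*pi" by (rule AE_lborel_singleton)+
      then show "AE t in lborel. ennreal (cmod (indicator {0..2*pi} t *\<^sub>R k t)) \<le>
        ennreal (2 * C * w (1 - r) / (1 - r)) * (ennreal (cmod (deriv f (of_real r * cis t))) * indicator {0<..<2*pi} t)"
      proof eventually_elim
        case (elim t)
        show ?case
        proof (cases "t \<in> {0..2*pi}")
          case True
          then have t: "t \<in> {0<..<2*pi}" using elim by auto
          have w0: "0 \<le> 2 * C * w (1 - r) / (1 - r)" using C pos[of "1 - r"] r by simp
          have "of_real r * cis t \<noteq> 0" using r by simp
          from R_bound[OF circle_in[OF r' r(2)] this]
          have "cmod (R (of_real r * cis t)) \<le> 2 * C * w (1 - r) / (1 - r)"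
            using r by (simp add: norm_mult field_simps)
          then have "cmod (k t) \<le> (2 * C * w (1 - r) / (1 - r)) * cmod (deriv f (of_real r * cis t))"
            unfolding k_def norm_mult complex_mod_cnj by (subst mult.commute) (rule mult_right_mono, auto)
          then have "ennreal (cmod (k t)) \<le> ennreal (2 * C * w (1 - r) / (1 - r)) * ennreal (cmod (deriv f (of_real r * cis t)))"
            unfolding ennreal_mult[OF w0 norm_ge_zero, symmetric] by (rule ennreal_leI)
          then show ?thesis using True t by simp
        qed simp
      qed
    qed
    also have "\<dots> = ennreal (2 * C * w (1 - r) / (1 - r)) * J r"
      unfolding J_def using df_circle_meas[OF r' r(2)] by (subst nn_integral_cmult) auto
    finally show ?thesis .
  qed
  define h where "h r = of_real (2 * r * (1 - r\<^sup>2)) * \<Phi> r" for r :: real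
  have herglotz_coeff: "continuous_on X h" for X unfolding h_def \<Phi>_def by (intro continuous_intros)
  have h_int: "(h has_integral (\<Sum>m<d. taylor_coeff f m * cnj (q m))) {0..1}"
  proof -
    have one: "((\<lambda>r. of_real (2 * r * (1 - r\<^sup>2) * r ^ (2 * m))) has_integral complex_of_real (1 / (real (Suc m) * real (m + 2)))) {0..1}" for m
    proof -
      have "((\<lambda>r. 2 * r * (1 - r\<^sup>2) * r ^ (2 * m)) has_integral
        ((1 ^ (2 * m + 2) / real (m + 1) - 1 ^ (2 * m + 4) / real (m + 2)) - (0 ^ (2 * m + 2) / real (m + 1) - 0 ^ (2 * m + 4) / real (m + 2)))) {0..1::real}"
      proof (rule fundamental_theorem_of_calculus)
        fix r :: real
        have "((\<lambda>r. r ^ (2 * m + 2) / real (m + 1) - r ^ (2 * m + 4) / real (m + 2)) has_real_derivative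
          (real (2 * m + 2) * r ^ (2 * m + 1) / real (m + 1) - real (2 * m + 4) * r ^ (2 * m + 3) / real (m + 2))) (at r within {0..1})"
          by (auto intro!: derivative_eq_intros simp del: of_nat_add of_nat_mult power_Suc simp: numeral_eq_Suc)
        also have "real (2 * m + 2) * r ^ (2 * m + 1) / real (m + 1) = 2 * r ^ (2 * m + 1)" by (simp add: field_simps)
        also have "real (2 * m + 4) * r ^ (2 * m + 3) / real (m + 2) = 2 * r ^ (2 * m + 3)" by (simp add: field_simps)
        also have "2 * r ^ (2 * m + 1) - 2 * r ^ (2 * m + 3) = 2 * r * (1 - r\<^sup>2) * r ^ (2 * m)"
          by (simp add: power_add power2_eq_square power3_eq_cube algebra_simps)
        finally show "((\<lambda>r. r ^ (2 * m + 2) / real (m + 1) - r ^ (2 * m + 4) / real (m + 2)) has_vector_derivative 2 * r * (1 - r\<^sup>2) * r ^ (2 * m)) (at r within {0..1})"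
          by (simp only: has_real_derivative_iff_has_vector_derivative)
      qed simp
      moreover have "(1 ^ (2 * m + 2) / real (m + 1) - 1 ^ (2 * m + 4) / real (m + 2)) - (0 ^ (2 * m + 2) / real (m + 1) - 0 ^ (2 * m + 4) / real (m + 2)) = 1 / (real (Suc m) * real (m + 2))"
        by (simp add: field_simps)
      ultimately have "((\<lambda>r. 2 * r * (1 - r\<^sup>2) * r ^ (2 * m)) has_integral 1 / (real (Suc m) * real (m + 2))) {0..1::real}" by simp
      from has_integral_linear[OF this bounded_linear_of_real] show ?thesis by (simp only: o_def)
    qed
    have "((\<lambda>r. \<Sum>m<d. c m * of_real (2 * r * (1 - r\<^sup>2) * r ^ (2 * m))) has_integral (\<Sum>m<d. c m * of_real (1 / (real (Suc m) * real (m + 2))))) {0..1}"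
      by (intro has_integral_sum has_integral_mult_right one) auto
    moreover have "(\<lambda>r. \<Sum>m<d. c m * of_real (2 * r * (1 - r\<^sup>2) * r ^ (2 * m))) = h"
      unfolding h_def \<Phi>_def sum_distrib_left by (intro ext sum.cong refl) simp
    moreover have "(\<Sum>m<d. c m * of_real (1 / (real (Suc m) * real (m + 2)))) = (\<Sum>m<d. taylor_coeff f (Suc m) * cnj (q (Suc m)))"
    proof (intro sum.cong refl)
      fix m
      have nz: "complex_of_nat (Suc m) * of_nat (m + 2) \<noteq> 0" by (simp del: of_nat_Suc of_nat_add)
      have "complex_of_real (1 / (real (Suc m) * real (m + 2))) = 1 / (of_nat (Suc m) * of_nat (m + 2))"
        by (simp only: of_real_divide of_real_mult of_real_1 of_real_of_nat_eq)
      then show "c m * of_real (1 / (real (Suc m) * real (m + 2))) = taylor_coeff f (Suc m) * cnj (q (Suc m))"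
        by (simp only: c_def times_divide_eq_right mult_1_right) (rule nonzero_mult_div_cancel_left[OF nz])
    qed
    moreover have "(\<Sum>m<d. taylor_coeff f (Suc m) * cnj (q (Suc m))) = (\<Sum>m<d. taylor_coeff f m * cnj (q m))"
    proof -
      have "(\<Sum>m<Suc d. taylor_coeff f m * cnj (q m)) = taylor_coeff f 0 * cnj (q 0) + (\<Sum>m<d. taylor_coeff f (Suc m) * cnj (q (Suc m)))"
        by (rule sum.lessThan_Suc_shift)
      then show ?thesis using q by simp
    qed
    ultimately show ?thesis by (simp only:)
  qed
  have si: "set_integrable lborel {0..1} h" by (rule borel_integrable_atLeastAtMost'[OF herglotz_coeff])
  have "(\<Sum>m<d. taylor_coeff f m * cnj (q m)) = set_lebesgue_integral lborel {0..1} h"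
    using set_borel_integral_eq_integral(2)[OF si] h_int by (simp add: integral_unique)
  then have "ennreal (cmod (\<Sum>m<d. taylor_coeff f m * cnj (q m))) \<le> (\<integral>\<^sup>+r. ennreal (cmod (indicator {0..1} r *\<^sub>R h r)) \<partial>lborel)"
    unfolding set_lebesgue_integral_def
    using integral_norm_bound_ennreal[OF si[unfolded set_integrable_def]] by (simp only:)
  also have "\<dots> \<le> (\<integral>\<^sup>+r. ennreal (2 * C) * (ennreal (r * w (1 - r)) * indicator {0<..<1} r * J r) \<partial>lborel)"
  proof (rule nn_integral_mono_AE)
    have "AE r in lborel. r \<noteq> (0::real)" "AE r in lborel. r \<noteq> (1::real)" by (rule AE_lborel_singleton)+
    then show "AE r in lborel. ennreal (cmod (indicator {0..1} r *\<^sub>R h r)) \<le> ennreal (2 * C) * (ennreal (r * w (1 - r)) * indicator {0<..<1} r * J r)"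
    proof eventually_elim
      case (elim r)
      show ?case
      proof (cases "r \<in> {0..1}")
        case True
        then have r: "0 < r" "r < 1" using elim by auto
        have w0: "0 \<le> w (1 - r)" using pos[of "1 - r"] r by simp
        define s where "s = r * (1 - r\<^sup>2) / pi"
        have s0: "0 \<le> s" using r by (simp add: s_def power_le_one)
        have "cmod (h r) = s * (2 * pi * cmod (\<Phi> r))"
        proof -
          have "0 \<le> 2 * r * (1 - r\<^sup>2)" using r by (simp add: power_le_one)
          then show ?thesis unfolding h_def s_def norm_mult norm_of_real by simp
        qed
        then have "ennreal (cmod (h r)) = ennreal s * ennreal (2 * pi * cmod (\<Phi> r))" using s0 by (simp add: ennreal_mult)
        also have "\<dots> \<le> ennreal s * (ennreal (2 * C * w (1 - r) / (1 - r)) * J r)" by (intro mult_left_mono \<Phi>[OF r]) auto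
        also have "\<dots> = ennreal (s * (2 * C * w (1 - r) / (1 - r))) * J r"
        proof -
          have "0 \<le> 2 * C * w (1 - r) / (1 - r)" using C w0 r by simp
          then show ?thesis by (simp only: ennreal_mult[OF s0] mult.assoc)
        qed
        also have "\<dots> \<le> ennreal (2 * C * (r * w (1 - r))) * J r"
        proof (intro mult_right_mono ennreal_leI)
          \<comment> \<open>From (1 - r^2) / (1 - r) = 1 + r <= 2, and 4 / pi <= 2.\<close>
          have "s * (2 * C * w (1 - r) / (1 - r)) = C * (r * w (1 - r)) * (2 * (1 + r) / pi)"
            using r by (simp add: s_def field_simps power2_eq_square)
          also have "\<dots> \<le> C * (r * w (1 - r)) * 2"
          proof (intro mult_left_mono)
            show "2 * (1 + r) / pi \<le> 2" using r pi_gt3 by (simp add: field_simps)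
          qed (use C r w0 in auto)
          finally show "s * (2 * C * w (1 - r) / (1 - r)) \<le> 2 * C * (r * w (1 - r))" by simp
        qed simp
        also have "\<dots> = ennreal (2 * C) * (ennreal (r * w (1 - r)) * J r)" using C r w0 by (simp add: ennreal_mult mult.assoc)
        finally show ?thesis using r by simp
      qed simp
    qed
  qed
  also have "\<dots> = ennreal (2 * C) * N"
    unfolding N_polar(2) by (rule nn_integral_cmult) (use N_polar(1) in simp)
  finally show ?thesis .
qed

end


section \<open>The Taylor coefficient criterion\<close>

context majorant_hol
begin

text \<open>The value is 2 m / (m + 2); what matters is that the bound is uniform in
  \<open>m\<close>.\<close>

lemma kernel_integral:
  fixes m :: nat
  assumes m: "0 < m"
  shows "(\<integral>\<^sup>+r. ennreal (real m * r ^ m * (1 + real m * (1 - r))) * indicator {0..1} r \<partial>lborel) \<le> 2"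
proof -
  define F where "F r = (real m + (real m)\<^sup>2) * (r ^ (m + 1) / real (m + 1)) - (real m)\<^sup>2 * (r ^ (m + 2) / real (m + 2))" for r :: real
  have "(\<integral>\<^sup>+r. ennreal (real m * r ^ m * (1 + real m * (1 - r))) * indicator {0..1} r \<partial>lborel) = ennreal (F 1 - F 0)"
  proof (rule nn_integral_FTC_Icc)
    fix r :: real assume "r \<in> {0..1}"
    then have r: "0 \<le> r" "r \<le> 1" by auto
    show "0 \<le> real m * r ^ m * (1 + real m * (1 - r))" using r by simp
    have "((\<lambda>r. r ^ (m + 1) / real (m + 1)) has_real_derivative r ^ m) (at r)"
      "((\<lambda>r. r ^ (m + 2) / real (m + 2)) has_real_derivative r ^ (m + 1)) (at r)"
      by (auto intro!: derivative_eq_intros simp del: of_nat_add power_Suc)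
    then have "(F has_real_derivative (real m + (real m)\<^sup>2) * r ^ m - (real m)\<^sup>2 * r ^ (m + 1)) (at r)"
      unfolding F_def by (intro DERIV_diff DERIV_cmult)
    moreover have "(real m + (real m)\<^sup>2) * r ^ m - (real m)\<^sup>2 * r ^ (m + 1) = real m * r ^ m * (1 + real m * (1 - r))"
      by (simp add: power2_eq_square algebra_simps)
    ultimately show "(F has_real_derivative real m * r ^ m * (1 + real m * (1 - r))) (at r)" by simp
  qed auto
  then have eq: "(\<integral>\<^sup>+r. ennreal (real m * r ^ m * (1 + real m * (1 - r))) * indicator {0..1} r \<partial>lborel) = ennreal (F 1 - F 0)" .
  have "F 1 - F 0 = real m - (real m)\<^sup>2 / real (m + 2)"
  proof -
    have "(real m + (real m)\<^sup>2) / real (m + 1) = real m" by (simp add: power2_eq_square field_simps)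
    moreover have "F 1 = (real m + (real m)\<^sup>2) / real (m + 1) - (real m)\<^sup>2 / real (m + 2)" unfolding F_def by (simp only: power_one times_divide_eq_right mult_1_right)
    moreover have "F 0 = 0" by (simp add: F_def)
    ultimately show ?thesis by linarith
  qed
  also have "\<dots> \<le> 2" by (simp add: power2_eq_square field_simps)
  finally have "ennreal (F 1 - F 0) \<le> ennreal 2" by (rule ennreal_leI)
  then show ?thesis unfolding eq by simp
qed

text \<open>f' on a circle is bounded by its series of absolute values, w(1 - r) is compared with
  w(1 / (n + 1)) by \<open>w_le_affine\<close>, and the remaining integrals in r are bounded
  uniformly in n. Read contrapositively, an infinite area integral forces the coefficient sum to
  diverge.\<close>

theorem coefficient_criterion:
  assumes fin: "(\<Sum>n. ennreal (cmod (taylor_coeff f (Suc n)) * w (1 / real (Suc n)))) < \<infinity>"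
  shows "N < \<infinity>"
proof -
  define c where "c n = cmod (taylor_coeff f (Suc n)) * w (1 / real (Suc n))" for n
  have wn: "0 \<le> w (1 / real (Suc n))" for n using pos[of "1 / real (Suc n)"] by simp
  have c0: "0 \<le> c n" for n unfolding c_def using wn by simp
  define k where "k n r = real (Suc n) * r ^ Suc n * (1 + real (Suc n) * (1 - r))" for n :: nat and r :: real
  have "N \<le> (\<integral>\<^sup>+r. (\<Sum>n. ennreal (2 * pi * c n) * (ennreal (k n r) * indicator {0..1} r)) \<partial>lborel)"
    unfolding N_polar(2)
  proof (rule nn_integral_mono)
    fix r :: real
    show "ennreal (r * w (1 - r)) * indicator {0<..<1} r * J r \<le> (\<Sum>n. ennreal (2 * pi * c n) * (ennreal (k n r) * indicator {0..1} r))"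
    proof (cases "r \<in> {0<..<1}")
      case True
      then have r: "0 \<le> r" "0 < r" "r < 1" by auto
      define s where "s = (\<Sum>n. cmod (taylor_coeff (deriv f) n) * r ^ n)"
      note sm = taylor_coeff_summable[OF df r(1,3)]
      have w0: "0 \<le> w (1 - r)" using pos[of "1 - r"] r by simp
      have df_le: "cmod (deriv f (of_real r * cis t)) \<le> s" for t
      proof -
        have "deriv f (of_real r * cis t) = (\<Sum>n. taylor_coeff (deriv f) n * (of_real r * cis t) ^ n)"
          using taylor_coeff_sums[OF df circle_in[OF r(1,3)]] by (simp add: sums_iff)
        also have "cmod \<dots> \<le> s" unfolding s_def
          by (rule norm_suminf_le[OF _ sm]) (use r in \<open>simp add: norm_mult norm_power\<close>)
        finally show ?thesis .
      qed
      have "J r \<le> (\<integral>\<^sup>+t. ennreal s * indicator {0<..<2*pi} t \<partial>lborel)"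
        unfolding J_def by (intro nn_integral_mono mult_right_mono ennreal_leI df_le) auto
      also have "\<dots> = ennreal s * ennreal (2 * pi)" by (subst nn_integral_cmult_indicator) auto
      finally have "ennreal (r * w (1 - r)) * J r \<le> ennreal (r * w (1 - r)) * (ennreal s * ennreal (2 * pi))"
        by (rule mult_left_mono) simp
      also have "\<dots> = ennreal (2 * pi * (r * w (1 - r))) * ennreal s"
        using r w0 by (simp add: ennreal_mult mult_ac)
      also have "ennreal s = (\<Sum>n. ennreal (cmod (taylor_coeff (deriv f) n) * r ^ n))"
        unfolding s_def by (rule suminf_ennreal2[symmetric, OF _ sm]) (use r in simp)
      also have "ennreal (2 * pi * (r * w (1 - r))) * \<dots> = (\<Sum>n. ennreal (2 * pi * (r * w (1 - r))) * ennreal (cmod (taylor_coeff (deriv f) n) * r ^ n))"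
        by (rule ennreal_suminf_cmult[symmetric])
      also have "\<dots> \<le> (\<Sum>n. ennreal (2 * pi * c n) * (ennreal (k n r) * indicator {0..1} r))"
      proof (intro suminf_le allI)
        fix n
        have "w (1 - r) \<le> w (1 / real (Suc n)) * (1 + (1 - r) / (1 / real (Suc n)))"
          by (rule w_le_affine) (use r in auto)
        also have "\<dots> = w (1 / real (Suc n)) * (1 + real (Suc n) * (1 - r))" by (simp add: mult.commute)
        finally have wle: "w (1 - r) \<le> w (1 / real (Suc n)) * (1 + real (Suc n) * (1 - r))" .
        have "2 * pi * (r * w (1 - r)) * (cmod (taylor_coeff (deriv f) n) * r ^ n)
          = (2 * pi * cmod (taylor_coeff f (Suc n)) * (real (Suc n) * r ^ Suc n)) * w (1 - r)"
          unfolding taylor_coeff_deriv norm_mult norm_of_nat by (simp del: of_nat_Suc)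
        also have "\<dots> \<le> (2 * pi * cmod (taylor_coeff f (Suc n)) * (real (Suc n) * r ^ Suc n)) * (w (1 / real (Suc n)) * (1 + real (Suc n) * (1 - r)))"
          by (intro mult_left_mono wle) (use r in auto)
        also have "\<dots> = (2 * pi * c n) * k n r" by (simp add: c_def k_def del: of_nat_Suc)
        finally have "ennreal (2 * pi * (r * w (1 - r)) * (cmod (taylor_coeff (deriv f) n) * r ^ n)) \<le> ennreal ((2 * pi * c n) * k n r)"
          by (rule ennreal_leI)
        then show "ennreal (2 * pi * (r * w (1 - r))) * ennreal (cmod (taylor_coeff (deriv f) n) * r ^ n) \<le> ennreal (2 * pi * c n) * (ennreal (k n r) * indicator {0..1} r)"
          using r w0 c0[of n] by (simp add: ennreal_mult[symmetric] ennreal_mult'[symmetric])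
      qed auto
      finally show ?thesis using True by simp
    qed simp
  qed
  also have "\<dots> = (\<Sum>n. \<integral>\<^sup>+r. ennreal (2 * pi * c n) * (ennreal (k n r) * indicator {0..1} r) \<partial>lborel)"
    by (rule nn_integral_suminf) (simp add: k_def)
  also have "\<dots> = (\<Sum>n. ennreal (2 * pi * c n) * (\<integral>\<^sup>+r. ennreal (k n r) * indicator {0..1} r \<partial>lborel))"
    by (intro suminf_cong nn_integral_cmult) (simp add: k_def)
  also have "\<dots> \<le> (\<Sum>n. ennreal (c n) * ennreal (4 * pi))"
  proof (intro suminf_le allI)
    fix n
    have "ennreal (2 * pi * c n) * (\<integral>\<^sup>+r. ennreal (k n r) * indicator {0..1} r \<partial>lborel) \<le> ennreal (2 * pi * c n) * 2"
      unfolding k_def by (intro mult_left_mono kernel_integral) auto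
    also have "ennreal (2 * pi * c n) * 2 = ennreal (2 * pi * c n) * ennreal 2" by simp
    also have "\<dots> = ennreal (2 * pi * c n * 2)" by (rule ennreal_mult[symmetric]) (use c0[of n] in auto)
    also have "2 * pi * c n * 2 = c n * (4 * pi)" by simp
    also have "ennreal (c n * (4 * pi)) = ennreal (c n) * ennreal (4 * pi)" by (rule ennreal_mult) (use c0[of n] in auto)
    finally show "ennreal (2 * pi * c n) * (\<integral>\<^sup>+r. ennreal (k n r) * indicator {0..1} r \<partial>lborel) \<le> ennreal (c n) * ennreal (4 * pi)" .
  qed auto
  also have "\<dots> = (\<Sum>n. ennreal (c n)) * ennreal (4 * pi)" by (rule ennreal_suminf_multc)
  also have "\<dots> < \<infinity>" using fin unfolding c_def by (simp add: ennreal_mult_less_top)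
  finally show ?thesis .
qed

end


subsection \<open>The intersection is trivial\<close>

lemma majorantE:
  assumes "majorant w"
  obtains \<alpha> where "regular_majorant w \<alpha>"
  using assms unfolding majorant_def regular_majorant_def by auto

lemma fps_nth_expansion_taylor_coeff: "fps_nth (fps_expansion f 0) n = taylor_coeff f n"
  by (simp add: fps_expansion_def taylor_coeff_def)

context majorant_hol
begin

text \<open>The coefficient f_j is <f, z^j G_n> - <f, z^j (G_n - 1)>. The first pairing is small
  because \<open>f\<close> lies in \<open>H\<close>, the second because \<open>N\<close> is finite,
  and the constant \<open>K\<close> in front of \<open>\<epsilon> n\<close> does not depend on
  \<open>n\<close>.\<close>

theorem taylor_coeff_zero:
  fixes g :: "nat \<Rightarrow> nat \<Rightarrow> complex" and d :: "nat \<Rightarrow> nat" and \<epsilon> :: "nat \<Rightarrow> real"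
  assumes cset: "circle_set E" and E_pos: "0 < measure lborel E"
    and g0: "\<And>n. g n 0 = 1" and gd: "\<And>n m. d n \<le> m \<Longrightarrow> g n m = 0"
    and dg: "\<And>n z. z \<in> \<D> \<Longrightarrow> (1 - cmod z) * cmod (deriv (\<lambda>z. \<Sum>m<d n. g n m * z ^ m) z) \<le> \<epsilon> n * w (1 - cmod z)"
    and small: "\<And>n t. t \<in> E \<Longrightarrow> cmod (\<Sum>m<d n. g n m * cis t ^ m) \<le> \<epsilon> n"
    and \<epsilon>: "\<And>n. 0 < \<epsilon> n" "\<epsilon> \<longlonglongrightarrow> 0"
    and rk: "disc_rkhs (dBR_kernel (circle_set.b E)) H ip" and fH: "f \<in> H" and fin: "N < \<infinity>"
  shows "taylor_coeff f j = 0"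
proof -
  interpret circle_set E by (rule cset)
  define F where "F = Re (ip f f)"
  have F0: "0 \<le> F" unfolding F_def by (rule disc_rkhs.ip_ge_zero[OF rk fH])
  define Nr where "Nr = enn2real N"
  have Nr: "N = ennreal Nr" "0 \<le> Nr" using fin by (auto simp: Nr_def)
  define K where "K = sqrt (2 * F) + 2 * (real j + 1) * Nr"
  have main: "cmod (taylor_coeff f j) \<le> K * \<epsilon> n" for n
  proof -
    define D where "D = d n + j"
    define G where "G z = (\<Sum>m<d n. g n m * z ^ m)" for z
    \<comment> \<open>Coefficients of z^j G. Those of z^j (G - 1), called \<open>q'\<close>, vanish
      at index 0 even for j = 0, as \<open>pairing_bound\<close> requires.\<close>
    define q where "q m = (if m < j then 0 else g n (m - j))" for m
    define q' where "q' m = q m - (if m = j then 1 else 0)" for m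
    have e0: "0 \<le> \<epsilon> n" using \<epsilon>(1)[of n] by simp
    have dn: "0 < d n" using g0[of n] gd[where n = n and m = 0] by (cases "d n") auto
    have qD: "q m = 0" if "D \<le> m" for m using that gd[of n "m - j"] by (auto simp: q_def D_def)
    have q'D: "q' m = 0" if "D \<le> m" for m using that qD[OF that] dn by (auto simp: q'_def D_def)
    have q'0: "q' 0 = 0" using g0[of n] by (auto simp: q'_def q_def)
    have Q: "(\<Sum>m<D. q m * z ^ m) = z ^ j * G z" for z
    proof -
      have "(\<Sum>m<D. q m * z ^ m) = (\<Sum>m\<in>{0 + j..<d n + j}. q m * z ^ m)"
        by (rule sum.mono_neutral_right) (auto simp: D_def q_def)
      also have "\<dots> = (\<Sum>m\<in>{0..<d n}. q (m + j) * z ^ (m + j))" by (rule sum.shift_bounds_nat_ivl)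
      also have "\<dots> = z ^ j * G z"
        by (simp add: G_def q_def sum_distrib_left power_add mult_ac atLeast0LessThan)
      finally show ?thesis .
    qed
    have Q': "(\<Sum>m<D. q' m * z ^ m) = z ^ j * (G z - 1)" for z
    proof -
      have "(\<Sum>m<D. q' m * z ^ m) = (\<Sum>m<D. q m * z ^ m) - (\<Sum>m<D. if m = j then z ^ j else 0)"
        unfolding sum_subtractf[symmetric] by (intro sum.cong refl) (auto simp: q'_def left_diff_distrib)
      also have "(\<Sum>m<D. if m = j then z ^ j else 0) = z ^ j" using dn by (simp add: D_def)
      finally show ?thesis by (simp add: Q algebra_simps)
    qed
    have G_hol: "G holomorphic_on X" for X unfolding G_def[abs_def] by (intro holomorphic_intros)
    have G0: "G 0 = 1"
    proof -
      have "G 0 = (\<Sum>m\<in>{0}. g n m * 0 ^ m)" unfolding G_def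
        by (rule sum.mono_neutral_right) (use dn in auto)
      then show ?thesis using g0 by simp
    qed
    have dG: "(1 - cmod z) * cmod (deriv G z) \<le> \<epsilon> n * w (1 - cmod z)" if "z \<in> \<D>" for z
      using dg[OF that, of n] unfolding G_def[abs_def] .
    have "(cmod (\<Sum>m<D. taylor_coeff f m * cnj (q m)))\<^sup>2 \<le> F * (2 * (\<epsilon> n)\<^sup>2)"
    proof -
      have smallQ: "cmod (\<Sum>m<D. q m * cis t ^ m) \<le> \<epsilon> n" if "t \<in> E" for t
        using small[OF that, of n] unfolding Q by (simp add: norm_mult norm_power G_def)
      obtain p where p: "p holomorphic_on \<D>" "square_summable (taylor_coeff p)" "\<And>z. z \<in> \<D> \<Longrightarrow> b z * p z = (\<Sum>m<D. q m * z ^ m)"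
        "(\<Sum>m. (cmod (taylor_coeff p m))\<^sup>2) \<le> (\<Sum>m<D. (cmod (q m))\<^sup>2) + 2 * (\<epsilon> n)\<^sup>2"
        using quotient_norm[where d = D and q = q and \<epsilon> = "\<epsilon> n", OF qD smallQ] by blast
      have "(cmod (\<Sum>m<D. taylor_coeff f m * cnj (q m)))\<^sup>2 \<le> F * ((\<Sum>m. (cmod (taylor_coeff p m))\<^sup>2) - (\<Sum>m<D. (cmod (q m))\<^sup>2))"
        unfolding F_def by (rule dBR_pairing[OF b_hol b_disc[OF E_pos] rk fH qD p(1,2,3)])
      also have "\<dots> \<le> F * (2 * (\<epsilon> n)\<^sup>2)" using p(4) F0 by (intro mult_left_mono) auto
      finally show ?thesis .
    qed
    then have "(cmod (\<Sum>m<D. taylor_coeff f m * cnj (q m)))\<^sup>2 \<le> (sqrt (2 * F) * \<epsilon> n)\<^sup>2"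
      using F0 by (simp add: power_mult_distrib mult_ac)
    then have 1: "cmod (\<Sum>m<D. taylor_coeff f m * cnj (q m)) \<le> sqrt (2 * F) * \<epsilon> n"
      by (rule power2_le_imp_le) (use F0 e0 in auto)
    \<comment> \<open>Differentiating z^j produces the term j (G - G 0), controlled by
      \<open>bloch_diff\<close>; hence the factor j + 1.\<close>
    have dV: "(1 - cmod z) * cmod (deriv (\<lambda>z. \<Sum>m<D. q' m * z ^ m) z) \<le> ((real j + 1) * \<epsilon> n) * w (1 - cmod z)"
      if z: "z \<in> \<D>" for z
    proof -
      have z1: "cmod z < 1" using z by simp
      have w0: "0 \<le> \<epsilon> n * w (1 - cmod z)" using e0 pos[of "1 - cmod z"] z1 by simp
      have derG: "(G has_field_derivative deriv G z) (at z)"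
        by (rule holomorphic_derivI[OF G_hol[of UNIV]]) auto
      have "((\<lambda>z. z ^ j * (G z - 1)) has_field_derivative (of_nat j * z ^ (j - 1) * (G z - 1) + deriv G z * z ^ j)) (at z)"
        by (auto intro!: derivative_eq_intros derG)
      then have "deriv (\<lambda>z. \<Sum>m<D. q' m * z ^ m) z = of_nat j * z ^ (j - 1) * (G z - 1) + deriv G z * z ^ j"
        unfolding Q' by (rule DERIV_imp_deriv)
      then have "cmod (deriv (\<lambda>z. \<Sum>m<D. q' m * z ^ m) z) \<le> real j * cmod z ^ (j - 1) * cmod (G z - 1) + cmod (deriv G z) * cmod z ^ j"
        using norm_triangle_ineq[of "of_nat j * z ^ (j - 1) * (G z - 1)" "deriv G z * z ^ j"] by (simp add: norm_mult norm_power)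
      also have "\<dots> \<le> real j * 1 * cmod (G z - 1) + cmod (deriv G z) * 1"
        using z1 by (intro add_mono mult_mono power_le_one) auto
      finally have "(1 - cmod z) * cmod (deriv (\<lambda>z. \<Sum>m<D. q' m * z ^ m) z)
        \<le> (1 - cmod z) * (real j * cmod (G z - 1) + cmod (deriv G z))"
        using z1 by (intro mult_left_mono) auto
      also have "\<dots> = real j * ((1 - cmod z) * cmod (G z - G 0)) + (1 - cmod z) * cmod (deriv G z)"
        by (simp add: G0 algebra_simps)
      also have "\<dots> \<le> real j * (cmod z * (\<epsilon> n * w (1 - cmod z))) + \<epsilon> n * w (1 - cmod z)"
        by (intro add_mono mult_left_mono bloch_diff[OF G_hol e0 dG z] dG[OF z]) auto
      also have "\<dots> \<le> real j * (1 * (\<epsilon> n * w (1 - cmod z))) + \<epsilon> n * w (1 - cmod z)"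
      proof -
        have "cmod z * (\<epsilon> n * w (1 - cmod z)) \<le> 1 * (\<epsilon> n * w (1 - cmod z))"
          by (rule mult_right_mono) (use z1 w0 in auto)
        then show ?thesis by (intro add_right_mono mult_left_mono) auto
      qed
      finally show ?thesis by (simp add: algebra_simps)
    qed
    have je: "0 \<le> (real j + 1) * \<epsilon> n" using e0 by simp
    have "ennreal (cmod (\<Sum>m<D. taylor_coeff f m * cnj (q' m))) \<le> ennreal (2 * ((real j + 1) * \<epsilon> n)) * N"
      by (rule pairing_bound[OF q'D q'0 je dV])
    also have "\<dots> = ennreal (2 * ((real j + 1) * \<epsilon> n) * Nr)"
      unfolding Nr(1) by (rule ennreal_mult[symmetric]) (use je Nr(2) in auto)
    finally have 2: "cmod (\<Sum>m<D. taylor_coeff f m * cnj (q' m)) \<le> 2 * ((real j + 1) * \<epsilon> n) * Nr"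
      using je Nr(2) by (subst (asm) ennreal_le_iff) auto
    have "(\<Sum>m<D. taylor_coeff f m * cnj (q' m)) = (\<Sum>m<D. taylor_coeff f m * cnj (q m)) - (\<Sum>m<D. if m = j then taylor_coeff f j else 0)"
      unfolding sum_subtractf[symmetric] by (intro sum.cong refl) (auto simp: q'_def right_diff_distrib)
    also have "(\<Sum>m<D. if m = j then taylor_coeff f j else 0) = taylor_coeff f j" using dn by (simp add: D_def)
    finally have "taylor_coeff f j = (\<Sum>m<D. taylor_coeff f m * cnj (q m)) - (\<Sum>m<D. taylor_coeff f m * cnj (q' m))" by simp
    then have "cmod (taylor_coeff f j) \<le> cmod (\<Sum>m<D. taylor_coeff f m * cnj (q m)) + cmod (\<Sum>m<D. taylor_coeff f m * cnj (q' m))"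
      by (simp only: norm_triangle_ineq4)
    then show ?thesis using 1 2 by (simp add: K_def algebra_simps)
  qed
  have "(\<lambda>n. K * \<epsilon> n) \<longlonglongrightarrow> K * 0" by (intro tendsto_intros \<epsilon>(2))
  then have "cmod (taylor_coeff f j) \<le> K * 0" by (rule LIMSEQ_le_const) (use main in blast)
  then show ?thesis by simp
qed

end

text \<open>The exceptional sets have total measure at most 1, which is less than 2 pi.\<close>

lemma common_small_set:
  fixes B :: "nat \<Rightarrow> real set"
  assumes B: "\<And>n. B n \<in> fmeasurable lborel" and m: "\<And>n. measure lborel (B n) \<le> (1/2) ^ Suc n"
  shows "0 < measure lborel ({0..2*pi} - (\<Union>n. B n))"
proof -
  define E where "E = {0..2*pi} - (\<Union>n. B n)"
  have Bs: "B n \<in> sets lborel" for n using B by (rule fmeasurableD)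
  have Es: "E \<in> sets lborel" unfolding E_def using Bs by (intro sets.Diff sets.countable_UN) auto
  have "emeasure lborel (\<Union>n. B n) \<le> (\<Sum>n. emeasure lborel (B n))"
    by (rule emeasure_subadditive_countably) (use Bs in auto)
  also have "\<dots> \<le> (\<Sum>n. ennreal ((1/2) ^ Suc n))"
  proof (intro suminf_le allI)
    fix n
    have "emeasure lborel (B n) = ennreal (measure lborel (B n))"
      by (rule emeasure_eq_measure2[OF B])
    then show "emeasure lborel (B n) \<le> ennreal ((1/2) ^ Suc n)" using m by (simp add: ennreal_leI del: power_Suc)
  qed auto
  also have "\<dots> = ennreal (\<Sum>n. (1/2) ^ Suc n)"
    by (rule suminf_ennreal2) (auto intro: summable_mult summable_geometric)
  also have "(\<Sum>n. (1/2::real) ^ Suc n) = 1"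
    using power_half_series by (simp add: sums_iff)
  finally have U: "emeasure lborel (\<Union>n. B n) \<le> 1" by simp
  have "ennreal (2 * pi) = emeasure lborel {0..2*pi}" by simp
  also have "\<dots> \<le> emeasure lborel (E \<union> (\<Union>n. B n))"
    by (rule emeasure_mono) (use Es Bs in \<open>auto simp: E_def\<close>)
  also have "\<dots> \<le> emeasure lborel E + emeasure lborel (\<Union>n. B n)"
    by (rule emeasure_subadditive) (use Es Bs in auto)
  also have "\<dots> \<le> emeasure lborel E + 1" using U by (intro add_left_mono)
  finally have le: "ennreal (2 * pi) \<le> emeasure lborel E + 1" .
  have "emeasure lborel E \<noteq> 0"
  proof
    assume "emeasure lborel E = 0"
    then have "ennreal (2 * pi) \<le> ennreal 1" using le by simp
    then show False using pi_gt3 by (subst (asm) ennreal_le_iff) auto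
  qed
  moreover have "emeasure lborel E \<le> emeasure lborel {0..2*pi}" by (rule emeasure_mono) (auto simp: E_def)
  then have "emeasure lborel E < \<infinity>" by (rule order_le_less_trans) simp
  ultimately show ?thesis unfolding E_def[symmetric] measure_def
    by (simp add: enn2real_positive_iff zero_less_iff_neq_zero)
qed

theorem theorem7p3:
  fixes w :: "real \<Rightarrow> real"
  assumes "majorant w"
    and "(\<integral>\<^sup>+t\<in>{0<..1}. ennreal ((w t)\<^sup>2 / t) \<partial>lborel) = \<infinity>"
  shows "\<exists>b. b holomorphic_on \<D> \<and> b ` \<D> \<subseteq> \<D> \<and> outer_function b \<and>
    dBR b \<inter> W1a w = {\<lambda>z. 0} \<and>
    (\<forall>f\<in>dBR b. f \<noteq> (\<lambda>z. 0) \<longrightarrow>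
      (\<Sum>n. ennreal (cmod (fps_nth (fps_expansion f 0) (Suc n)) * w (1 / real (Suc n)))) = \<infinity>)"
proof -
  obtain \<alpha> where "regular_majorant w \<alpha>" by (rule majorantE[OF assms(1)])
  then interpret regular_majorant w \<alpha> .
  define \<epsilon> where "\<epsilon> n = (1/2 :: real) ^ Suc n" for n
  have \<epsilon>: "0 < \<epsilon> n" for n by (simp add: \<epsilon>_def)
  have \<epsilon>0: "\<epsilon> \<longlonglongrightarrow> 0"
    unfolding \<epsilon>_def by (rule LIMSEQ_Suc[OF LIMSEQ_realpow_zero]) auto
  define P where "P n d g \<longleftrightarrow> g 0 = 1 \<and> (\<forall>m. d \<le> m \<longrightarrow> g m = 0) \<and>
    (\<forall>z\<in>\<D>. (1 - cmod z) * cmod (deriv (\<lambda>z. \<Sum>m<d. g m * z ^ m) z) \<le> \<epsilon> n * w (1 - cmod z)) \<and>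
    measure lborel {t \<in> {0..2*pi}. \<epsilon> n < cmod (\<Sum>m<d. g m * cis t ^ m)} \<le> \<epsilon> n" for n d and g :: "nat \<Rightarrow> complex"
  have "\<exists>d g. P n d g" for n
  proof (rule bloch_polynomial[OF assms(2) \<epsilon>[of n]])
    fix d and g :: "nat \<Rightarrow> complex"
    assume "g 0 = 1" "\<And>m. d \<le> m \<Longrightarrow> g m = 0"
      "\<And>z. z \<in> \<D> \<Longrightarrow> (1 - cmod z) * cmod (deriv (\<lambda>z. \<Sum>m<d. g m * z ^ m) z) \<le> \<epsilon> n * w (1 - cmod z)"
      "measure lborel {t \<in> {0..2*pi}. \<epsilon> n < cmod (\<Sum>m<d. g m * cis t ^ m)} \<le> \<epsilon> n"
    then have "P n d g" unfolding P_def by blast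
    then show "\<exists>d g. P n d g" by blast
  qed
  then obtain d g where P: "\<And>n. P n (d n) (g n)" by metis
  have g: "\<And>n. g n 0 = (1::complex)" "\<And>n m. d n \<le> m \<Longrightarrow> g n m = 0"
    "\<And>n z. z \<in> \<D> \<Longrightarrow> (1 - cmod z) * cmod (deriv (\<lambda>z. \<Sum>m<d n. g n m * z ^ m) z) \<le> \<epsilon> n * w (1 - cmod z)"
    "\<And>n. measure lborel {t \<in> {0..2*pi}. \<epsilon> n < cmod (\<Sum>m<d n. g n m * cis t ^ m)} \<le> \<epsilon> n"
    using P unfolding P_def by blast+
  define B where "B n = {t \<in> {0..2*pi}. \<epsilon> n < cmod (\<Sum>m<d n. g n m * cis t ^ m)}" for n
  define E where "E = {0..2*pi} - (\<Union>n. B n)"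
  have Bm: "B n \<in> fmeasurable lborel" for n
  proof -
    have "{0..2*pi} - {t \<in> {0..2*pi}. - \<epsilon> n \<le> - cmod (\<Sum>m<d n. g n m * cis t ^ m)} \<in> fmeasurable lborel"
      by (intro fmeasurable.Diff fmeasurable_superlevel continuous_intros fmeasurable_compact compact_Icc)
    also have "{0..2*pi} - {t \<in> {0..2*pi}. - \<epsilon> n \<le> - cmod (\<Sum>m<d n. g n m * cis t ^ m)} = B n" by (auto simp: B_def)
    finally show ?thesis .
  qed
  have cset: "circle_set E"
  proof
    have "B n \<in> sets borel" for n using fmeasurableD[OF Bm[of n]] by simp
    then show "E \<in> sets borel" unfolding E_def by (intro sets.Diff sets.countable_UN) auto
    show "E \<subseteq> {0..2*pi}" by (auto simp: E_def)
  qed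
  have E_pos: "0 < measure lborel E"
    unfolding E_def by (rule common_small_set[OF Bm]) (use g(4) in \<open>simp add: B_def \<epsilon>_def\<close>)
  have small: "cmod (\<Sum>m<d n. g n m * cis t ^ m) \<le> \<epsilon> n" if "t \<in> E" for n t
    using that by (auto simp: E_def B_def not_less)
  interpret circle_set E by (rule cset)
  obtain ip where rk: "disc_rkhs (dBR_kernel b) (dBR b) ip"
    using dBR_rkhs[OF b_hol b_disc[OF E_pos]] by blast
  have hol: "f \<in> hol_disc" if "f \<in> dBR b" for f
    using disc_rkhs.holomorphic[OF rk] that by blast
  \<comment> \<open>One statement serves both conclusions: finiteness of the area integral comes
    from membership in W^1_a(w), or from a finite coefficient sum through
    \<open>coefficient_criterion\<close>.\<close>
  have key: "f = (\<lambda>z. 0)" if fmem: "f \<in> dBR b" and fin: "majorant_hol.N w f < \<infinity>" for f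
  proof -
    have fh: "f holomorphic_on \<D>" using hol[OF fmem] by (simp add: hol_disc_def)
    interpret majorant_hol w \<alpha> f by unfold_locales (rule fh)
    have tc0: "taylor_coeff f j = 0" for j
      by (rule taylor_coeff_zero[OF cset E_pos g(1,2,3) small \<epsilon> \<epsilon>0 rk fmem fin])
    show ?thesis
    proof
      fix z show "f z = 0"
      proof (cases "z \<in> \<D>")
        case True
        then show ?thesis using taylor_coeff_sums[OF fh True] by (simp add: tc0 sums_iff)
      next
        case False
        then show ?thesis using hol[OF fmem] by (simp add: hol_disc_def)
      qed
    qed
  qed
  show ?thesis
  proof (intro exI[of _ b] conjI ballI impI)
    show "b holomorphic_on \<D>" by (rule b_hol)
    show "b ` \<D> \<subseteq> \<D>" by (rule b_disc[OF E_pos])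
    show "outer_function b" by (rule b_outer)
    show "dBR b \<inter> W1a w = {\<lambda>z. 0}"
    proof (rule equalityI; rule subsetI)
      fix f assume "f \<in> dBR b \<inter> W1a w"
      then have fW: "f \<in> dBR b" "W1a_norm w f < \<infinity>" by (auto simp: W1a_def)
      have fh: "f holomorphic_on \<D>" using hol[OF fW(1)] by (simp add: hol_disc_def)
      interpret majorant_hol w \<alpha> f by unfold_locales (rule fh)
      have "N \<le> W1a_norm w f" unfolding N_def W1a_norm_def by simp
      then have "N < \<infinity>" using fW(2) by (rule order_le_less_trans)
      from key[OF fW(1) this] show "f \<in> {\<lambda>z. 0}" by simp
    next
      fix f :: "complex \<Rightarrow> complex" assume "f \<in> {\<lambda>z. 0}"
      then have f0: "f = (\<lambda>z. 0)" by simp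
      have "f \<in> dBR b" unfolding f0 by (rule disc_rkhs.zero[OF rk])
      moreover have "f \<in> W1a w" unfolding f0 W1a_def W1a_norm_def hol_disc_def by simp
      ultimately show "f \<in> dBR b \<inter> W1a w" by simp
    qed
    fix f assume fne: "f \<in> dBR b" "f \<noteq> (\<lambda>z. 0)"
    have fh: "f holomorphic_on \<D>" using hol[OF fne(1)] by (simp add: hol_disc_def)
    interpret majorant_hol w \<alpha> f by unfold_locales (rule fh)
    show "(\<Sum>n. ennreal (cmod (fps_nth (fps_expansion f 0) (Suc n)) * w (1 / real (Suc n)))) = \<infinity>"
    proof (rule ccontr)
      assume "\<not> ?thesis"
      then have "(\<Sum>n. ennreal (cmod (taylor_coeff f (Suc n)) * w (1 / real (Suc n)))) < \<infinity>"
        unfolding fps_nth_expansion_taylor_coeff by (simp add: less_top)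
      from key[OF fne(1) coefficient_criterion[OF this]] fne(2) show False by simp
    qed
  qed
qed

end
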